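(* The function field of the modular curve $X_1(14)$ is generated over $\mathbf C$ by $\upsilon$ and $g_1$. After \[ X_0=-\frac1{g_1},\qquad Y_0=\frac{(g_1-1)(-g_1^2+\upsilon-g_1-1)}{g_1^3}, \] one obtains the minimal Weierstrass equation \[ Y_0^2+X_0Y_0+Y_0=X_0^3-X_0 \] for $X_1(14)$.
   Context: For $k=1,2,3$ put $a_k(\tau)=\sum_{n\in\mathbf Z}(-1)^{n+k+1}q^{(14n+7-2k)^2/56}$, where $q^r=e^{2\pi i r\tau}$, and $\upsilon=a_2^2a_3/a_1^3$, $\phi_1=-a_3/a_2$, $g_1(\tau)=\phi_1(\tau)^2/\phi_1(2\tau)$. The function field of $X_1(14)$ over $\mathbf C$ is the field $\mathcal A_0(\Gamma_1(14))$ of modular functions for $\Gamma_1(14)=\Gamma_0(2)\cap\Gamma_1(7)$ (equality as transformation groups of the upper half-plane). The functions satisfy $g_1^3+g_1^2-\frac{\upsilon^2-1}{\upsilon}g_1+\frac{(\upsilon-1)^2}{\upsilon}=0$. "Minimal" means that the displayed integral Weierstrass equation is a global minimal model over $\mathbf Q$. *)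

theory Defs
  imports
    "HOL-Complex_Analysis.Complex_Analysis"
    "HOL-Computational_Algebra.Computational_Algebra"
    "HOL-Number_Theory.Cong"
    "HOL-Algebra.Generated_Fields"
begin

section \<open>Meromorphic functions on the upper half-plane\<close>

definition upper_half_plane :: "complex set" where
  "upper_half_plane = {\<tau>. Im \<tau> > 0}"

text \<open>
  A meromorphic function on the upper half-plane is represented by the unique total function that
  agrees with it at every regular point, and is 0 at the poles and outside the upper half-plane.
  The following maps any function that is meromorphic on the upper half-plane to that
  representative; two functions have the same image iff they agree off a discrete set.
\<close>

definition mer :: "(complex \<Rightarrow> complex) \<Rightarrow> complex \<Rightarrow> complex" where
  "mer f \<tau> = (if \<tau> \<in> upper_half_plane then remove_sings f \<tau> else 0)"

section \<open>Modular functions\<close>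

definition SL2Z :: "(int ^ 2 ^ 2) set" where
  "SL2Z = {A. det A = 1}"

definition Gamma1 :: "int \<Rightarrow> (int ^ 2 ^ 2) set" where
  "Gamma1 N = {A \<in> SL2Z. [A $ 1 $ 1 = 1] (mod N) \<and> [A $ 2 $ 2 = 1] (mod N) \<and> [A $ 2 $ 1 = 0] (mod N)}"

definition act :: "int ^ 2 ^ 2 \<Rightarrow> complex \<Rightarrow> complex" where
  "act A = moebius (of_int (A $ 1 $ 1)) (of_int (A $ 1 $ 2)) (of_int (A $ 2 $ 1)) (of_int (A $ 2 $ 2))"

text \<open>
  Near \<open>\<i>\<infinity>\<close> the function is a function of \<open>q\<^sup>1\<^sup>/\<^sup>h\<close>, for some width \<open>h\<close>, that has at worst a pole at
  \<open>q\<^sup>1\<^sup>/\<^sup>h = 0\<close>.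
\<close>

definition meromorphic_at_ii_inf :: "(complex \<Rightarrow> complex) \<Rightarrow> bool" where
  "meromorphic_at_ii_inf f \<longleftrightarrow>
     (\<exists>h::nat. \<exists>F c. h > 0 \<and> F meromorphic_on {0} \<and>
        (\<forall>\<tau>. Im \<tau> > c \<longrightarrow> f \<tau> = F (exp (2 * of_real pi * \<i> * \<tau> / of_nat h))))"

definition modular_functions :: "(int ^ 2 ^ 2) set \<Rightarrow> (complex \<Rightarrow> complex) set" where
  "modular_functions \<Gamma> =
     {f. f nicely_meromorphic_on upper_half_plane \<and>
         (\<forall>\<tau>. \<tau> \<notin> upper_half_plane \<longrightarrow> f \<tau> = 0) \<and>
         (\<forall>A\<in>\<Gamma>. \<forall>\<tau>\<in>upper_half_plane. f (act A \<tau>) = f \<tau>) \<and>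
         (\<forall>A\<in>SL2Z. meromorphic_at_ii_inf (\<lambda>\<tau>. f (act A \<tau>)))}"

definition modular_function_field :: "(int ^ 2 ^ 2) set \<Rightarrow> (complex \<Rightarrow> complex) ring" where
  "modular_function_field \<Gamma> =
     \<lparr> carrier = modular_functions \<Gamma>,
       monoid.mult = (\<lambda>f g. mer (\<lambda>\<tau>. f \<tau> * g \<tau>)),
       one = mer (\<lambda>_. 1),
       zero = mer (\<lambda>_. 0),
       add = (\<lambda>f g. mer (\<lambda>\<tau>. f \<tau> + g \<tau>)) \<rparr>"

definition generated_over_C :: "(complex \<Rightarrow> complex) ring \<Rightarrow> (complex \<Rightarrow> complex) set \<Rightarrow> bool" where
  "generated_over_C K S \<longleftrightarrow> carrier K = generate_field K (range (\<lambda>c. mer (\<lambda>_. c)) \<union> S)"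

section \<open>The functions on $X_1(14)$\<close>

definition theta_a :: "int \<Rightarrow> complex \<Rightarrow> complex" where
  "theta_a k \<tau> = (\<Sum>\<^sub>\<infinity>n\<in>(UNIV::int set).
     (-1) powi (n + k + 1) *
     exp (2 * of_real pi * \<i> * (of_int ((14 * n + 7 - 2 * k)\<^sup>2) / 56) * \<tau>))"

definition upsilon :: "complex \<Rightarrow> complex" where
  "upsilon = mer (\<lambda>\<tau>. (theta_a 2 \<tau>)\<^sup>2 * theta_a 3 \<tau> / (theta_a 1 \<tau>) ^ 3)"

definition phi1 :: "complex \<Rightarrow> complex" where
  "phi1 = mer (\<lambda>\<tau>. - theta_a 3 \<tau> / theta_a 2 \<tau>)"

definition g1 :: "complex \<Rightarrow> complex" where
  "g1 = mer (\<lambda>\<tau>. (phi1 \<tau>)\<^sup>2 / phi1 (2 * \<tau>))"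

definition X0 :: "complex \<Rightarrow> complex" where
  "X0 = mer (\<lambda>\<tau>. - 1 / g1 \<tau>)"

definition Y0 :: "complex \<Rightarrow> complex" where
  "Y0 = mer (\<lambda>\<tau>. (g1 \<tau> - 1) * (- (g1 \<tau>)\<^sup>2 + upsilon \<tau> - g1 \<tau> - 1) / (g1 \<tau>) ^ 3)"

section \<open>Weierstrass equations\<close>

text \<open>\<open>y\<^sup>2 + a\<^sub>1 x y + a\<^sub>3 y = x\<^sup>3 + a\<^sub>2 x\<^sup>2 + a\<^sub>4 x + a\<^sub>6\<close>\<close>

datatype 'a weierstrass =
  Weierstrass (wa1: 'a) (wa2: 'a) (wa3: 'a) (wa4: 'a) (wa6: 'a)

definition weierstrass_disc :: "'a::comm_ring_1 weierstrass \<Rightarrow> 'a" where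
  "weierstrass_disc E =
     (let b2 = (wa1 E)\<^sup>2 + 4 * wa2 E;
          b4 = 2 * wa4 E + wa1 E * wa3 E;
          b6 = (wa3 E)\<^sup>2 + 4 * wa6 E;
          b8 = (wa1 E)\<^sup>2 * wa6 E + 4 * wa2 E * wa6 E - wa1 E * wa3 E * wa4 E
               + wa2 E * (wa3 E)\<^sup>2 - (wa4 E)\<^sup>2
      in - (b2\<^sup>2 * b8) - 8 * b4 ^ 3 - 27 * b6\<^sup>2 + 9 * b2 * b4 * b6)"

text \<open>An element of \<open>\<complex>[x][y]\<close>: the outer polynomial variable is \<open>y\<close>, the inner one is \<open>x\<close>.\<close>

definition weierstrass_poly :: "complex weierstrass \<Rightarrow> complex poly poly" where
  "weierstrass_poly E =
     [: - [:wa6 E, wa4 E, wa2 E, 1:], [:wa3 E, wa1 E:], 1 :]"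

definition eval_xy :: "complex poly poly \<Rightarrow> complex \<Rightarrow> complex \<Rightarrow> complex" where
  "eval_xy P x y = poly (poly P [:y:]) x"

text \<open>
  \<open>E\<close> is an equation, with coordinate functions \<open>X\<close> and \<open>Y\<close>, for the smooth projective curve with
  function field \<open>K\<close>: \<open>E\<close> is nonsingular, and \<open>x \<mapsto> X\<close>, \<open>y \<mapsto> Y\<close> induces an isomorphism from the
  fraction field of \<open>\<complex>[x, y] / (E)\<close> onto \<open>K\<close>, i.e. the evaluation homomorphism has kernel \<open>(E)\<close> and
  \<open>X\<close>, \<open>Y\<close> generate \<open>K\<close>.
\<close>

definition weierstrass_model ::
    "complex weierstrass \<Rightarrow> (complex \<Rightarrow> complex) \<Rightarrow> (complex \<Rightarrow> complex) \<Rightarrow> (complex \<Rightarrow> complex) ring \<Rightarrow> bool" where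
  "weierstrass_model E X Y K \<longleftrightarrow>
     weierstrass_disc E \<noteq> 0 \<and>
     X \<in> carrier K \<and> Y \<in> carrier K \<and>
     (\<forall>P. mer (\<lambda>\<tau>. eval_xy P (X \<tau>) (Y \<tau>)) = \<zero>\<^bsub>K\<^esub> \<longleftrightarrow> weierstrass_poly E dvd P) \<and>
     generated_over_C K {X, Y}"

section \<open>Global minimal models over the rationals\<close>

text \<open>The equation obtained from the substitution \<open>x = u\<^sup>2 x' + r\<close>, \<open>y = u\<^sup>3 y' + u\<^sup>2 s x' + t\<close>.\<close>

definition change_vars :: "'a::field \<Rightarrow> 'a \<Rightarrow> 'a \<Rightarrow> 'a \<Rightarrow> 'a weierstrass \<Rightarrow> 'a weierstrass" where
  "change_vars u r s t E = Weierstrass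
     ((wa1 E + 2 * s) / u)
     ((wa2 E - s * wa1 E + 3 * r - s\<^sup>2) / u\<^sup>2)
     ((wa3 E + r * wa1 E + 2 * t) / u ^ 3)
     ((wa4 E - s * wa3 E + 2 * r * wa2 E - (t + r * s) * wa1 E + 3 * r\<^sup>2 - 2 * s * t) / u ^ 4)
     ((wa6 E + r * wa4 E + r\<^sup>2 * wa2 E + r ^ 3 - t * wa3 E - t\<^sup>2 - r * t * wa1 E) / u ^ 6)"

text \<open>Only meaningful for nonzero arguments: the value at 0 is 0 instead of \<open>\<infinity>\<close>.\<close>

definition rat_val :: "int \<Rightarrow> rat \<Rightarrow> int" where
  "rat_val p x = int (multiplicity p (fst (quotient_of x))) - int (multiplicity p (snd (quotient_of x)))"

definition p_integral :: "int \<Rightarrow> rat \<Rightarrow> bool" where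
  "p_integral p x \<longleftrightarrow> \<not> p dvd snd (quotient_of x)"

definition minimal_at :: "int \<Rightarrow> rat weierstrass \<Rightarrow> bool" where
  "minimal_at p E \<longleftrightarrow>
     (\<forall>a\<in>set_weierstrass E. p_integral p a) \<and>
     (\<forall>u r s t. u \<noteq> 0 \<and> (\<forall>a\<in>set_weierstrass (change_vars u r s t E). p_integral p a) \<longrightarrow>
        rat_val p (weierstrass_disc E) \<le> rat_val p (weierstrass_disc (change_vars u r s t E)))"

definition global_minimal_model :: "rat weierstrass \<Rightarrow> bool" where
  "global_minimal_model E \<longleftrightarrow>
     weierstrass_disc E \<noteq> 0 \<and> set_weierstrass E \<subseteq> \<int> \<and> (\<forall>p. prime p \<longrightarrow> minimal_at p E)"

end

theory Submission
  imports Defs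
begin

text \<open>
  The theta series \<open>a\<^sub>k(\<tau>)\<close> are, up to a factor that does not depend on \<open>k\<close>, the values of a Klein form
  at the points \<open>(k/7, 0)\<close> over the lattice of \<open>7\<tau>\<close>. Klein forms are given by infinite products, so they
  have no unexpected zeros; they transform under \<open>SL\<^sub>2(\<int>)\<close> by a factor that does not depend on the point,
  and they satisfy Weierstrass' three-term relation. All three facts follow from Liouville's theorem,
  applied to a quotient of two entire functions with the same quasi-periods. Hence \<open>\<upsilon>\<close> and \<open>g\<^sub>1\<close> are
  holomorphic and zero-free on the upper half-plane and modular, and five three-term relations at the
  levels 7 and 14 combine to the cubic relation between them.

  On \<open>X\<^sub>1(7)\<close> the function \<open>\<upsilon>\<close> has a single simple pole, at \<open>\<i>\<infinity>\<close>. Multiplying a modular function by a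
  polynomial in \<open>\<upsilon>\<close> removes all its poles except at \<open>\<i>\<infinity>\<close>, and subtracting a polynomial in \<open>\<upsilon>\<close> removes
  that one; the rest is constant by the maximum principle. So the function field of \<open>X\<^sub>1(7)\<close> is \<open>\<complex>(\<upsilon>)\<close>.
  A modular function for \<open>\<Gamma>\<^sub>1(14)\<close> is then recovered from \<open>g\<^sub>1\<close> by Lagrange interpolation over the three
  cosets of \<open>\<Gamma>\<^sub>1(14)\<close> in \<open>\<Gamma>\<^sub>1(7)\<close>, whose coefficients are traces down to \<open>X\<^sub>1(7)\<close>.

  In the Weierstrass coordinates the kernel of evaluation is generated by the equation, because
  \<open>Y\<^sub>0 \<in> \<complex>(X\<^sub>0)\<close> would make a cubic times a square equal to a square. The equation is minimal because
  its discriminant is \<open>-28\<close>.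
\<close>

section \<open>Infinite products\<close>

text \<open>Behind the cubic stand five modular units: g - 1, g + 1, u - 1, u - g - 1 and u - g - 1
  - g^2, with u = \<open>upsilon\<close> and g = \<open>g1\<close>. The five three-term relations
  show that each is, up to a constant, a monomial in Klein forms of level 14. Comparing exponents
  gives the multiplicative relation (g - 1) (u - g - 1) (u - g - 1 - g^2) = (g + 1) g^3, and this is
  the cubic multiplied out. Multiplied by (g - 1) / g^6 it reads Y (Y + X + 1) = X^3 - X with X = -
  1 / g and Y = (g - 1) (u - g - 1 - g^2) / g^3, which explains the substitution.

  The modular curves enter only through functions on the upper half-plane and their expansions at
  the cusps. Compactness is replaced by two facts: every point can be moved into the strip of height
  at least 1/2, and a function invariant under \<open>Gamma1 N\<close>, composed with a matrix,
  depends only on the entries of that matrix modulo N. So finitely many expansions control the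
  function everywhere.\<close>

definition expi2 :: "complex \<Rightarrow> complex" where
  "expi2 z = exp (2 * of_real pi * \<i> * z)"

lemma expi2_0 [simp]: "expi2 0 = 1"
  by (simp add: expi2_def)

lemma expi2_nonzero [simp]: "expi2 z \<noteq> 0"
  by (simp add: expi2_def)

lemma expi2_add: "expi2 (a + b) = expi2 a * expi2 b"
  by (simp add: expi2_def ring_distribs exp_add)

lemma expi2_minus: "expi2 (- a) = inverse (expi2 a)"
  by (simp add: expi2_def exp_minus)

lemma expi2_diff: "expi2 (a - b) = expi2 a / expi2 b"
  by (simp add: expi2_def ring_distribs exp_diff)

lemma expi2_power: "expi2 a ^ n = expi2 (of_nat n * a)"
  by (simp add: expi2_def exp_of_nat_mult [symmetric] mult_ac)

lemma norm_expi2: "norm (expi2 z) = exp (- (2 * pi * Im z))"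
  by (simp add: expi2_def)

lemma expi2_of_int [simp]: "expi2 (of_int n) = 1"
  using exp_integer_2pi[of "of_int n"] by (simp add: expi2_def mult_ac)

lemma expi2_1 [simp]: "expi2 1 = 1"
  using expi2_of_int[of 1] by simp

lemma expi2_eq_1_iff: "expi2 z = 1 \<longleftrightarrow> z \<in> \<int>"
proof
  assume "expi2 z = 1"
  then obtain n where "Re (2 * of_real pi * \<i> * z) = 0" "Im (2 * of_real pi * \<i> * z) = of_int (2 * n) * pi"
    unfolding expi2_def exp_eq_1 by blast
  then have "z = of_int n"
    by (simp add: complex_eq_iff)
  then show "z \<in> \<int>" by simp
next
  assume "z \<in> \<int>"
  then show "expi2 z = 1" by (elim Ints_cases) simp
qed

lemma expi2_half [simp]: "expi2 (1/2) = -1"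
  by (simp add: expi2_def)

lemma expi2_half_int: "expi2 (of_int n / 2) = (-1) powi n"
proof -
  have "expi2 (of_int n / 2) = exp (of_int n * (\<i> * of_real pi))"
    by (simp add: expi2_def mult_ac)
  also have "\<dots> = exp (\<i> * of_real pi) powi n"
    by (rule exp_power_int [symmetric])
  finally show ?thesis by simp
qed

lemma holomorphic_on_expi2 [holomorphic_intros]:
  "f holomorphic_on A \<Longrightarrow> (\<lambda>z. expi2 (f z)) holomorphic_on A"
  unfolding expi2_def by (intro holomorphic_intros)

lemma continuous_on_expi2 [continuous_intros]:
  "continuous_on A f \<Longrightarrow> continuous_on A (\<lambda>z. expi2 (f z))"
  unfolding expi2_def by (intro continuous_intros)

section \<open>The q-Pochhammer symbol: convergence, zeros, analytic dependence\<close>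

definition qpoch :: "complex \<Rightarrow> complex \<Rightarrow> complex" where
  "qpoch w Q = (\<Prod>n. 1 - w * Q ^ n)"

lemma abs_convergent_qpoch:
  fixes w Q :: complex
  assumes "norm Q < 1"
  shows "abs_convergent_prod (\<lambda>n. 1 - w * Q ^ n)"
proof -
  have "summable (\<lambda>n. norm w * norm Q ^ n)"
    using assms by (intro summable_mult summable_geometric) auto
  then have "summable (\<lambda>n. norm ((1 - w * Q ^ n) - 1))"
    by (simp add: norm_mult norm_power)
  then show ?thesis
    by (rule summable_imp_abs_convergent_prod)
qed

lemma convergent_qpoch:
  fixes w Q :: complex
  assumes "norm Q < 1"
  shows "convergent_prod (\<lambda>n. 1 - w * Q ^ n)"
  using abs_convergent_prod_imp_convergent_prod[OF abs_convergent_qpoch[OF assms]] .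

lemma qpoch_LIMSEQ:
  assumes "norm Q < 1"
  shows "(\<lambda>n. \<Prod>i<n. 1 - w * Q ^ i) \<longlonglongrightarrow> qpoch w Q"
  using convergent_prod_LIMSEQ[OF convergent_qpoch[OF assms]]
  unfolding qpoch_def by (subst (asm) LIMSEQ_lessThan_iff_atMost [symmetric])

lemma qpoch_rec:
  assumes "norm Q < 1"
  shows "qpoch w Q = (1 - w) * qpoch (w * Q) Q"
proof -
  have "(\<lambda>n. \<Prod>i<Suc n. 1 - w * Q ^ i) \<longlonglongrightarrow> qpoch w Q"
    using qpoch_LIMSEQ[OF assms, of w] by (rule LIMSEQ_Suc)
  moreover have "(\<lambda>n. \<Prod>i<Suc n. 1 - w * Q ^ i) \<longlonglongrightarrow> (1 - w) * qpoch (w * Q) Q"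
    unfolding prod.lessThan_Suc_shift
    using tendsto_mult[OF tendsto_const[of "1 - w"] qpoch_LIMSEQ[OF assms, of "w * Q"]]
    by (simp add: mult.assoc)
  ultimately show ?thesis
    by (rule LIMSEQ_unique)
qed

text \<open>Separates even and odd indices. This is the source of the duplication formula
  \<open>kl_split\<close>, and so of the passage from level 7 to level 14.\<close>

lemma qpoch_split:
  assumes "norm Q < 1"
  shows "qpoch w Q = qpoch w (Q\<^sup>2) * qpoch (w * Q) (Q\<^sup>2)"
proof -
  have Q2: "norm (Q\<^sup>2) < 1"
    using assms by (simp add: norm_power power_less_one_iff)
  have eq: "(\<Prod>i<2*n. 1 - w * Q ^ i) =
      (\<Prod>i<n. 1 - w * (Q\<^sup>2) ^ i) * (\<Prod>i<n. 1 - w * Q * (Q\<^sup>2) ^ i)" for n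
    by (induction n) (simp_all add: power_mult [symmetric] mult_ac)
  have "(\<lambda>n. \<Prod>i<2*n. 1 - w * Q ^ i) \<longlonglongrightarrow> qpoch w Q"
    using LIMSEQ_subseq_LIMSEQ[OF qpoch_LIMSEQ[OF assms, of w], of "\<lambda>n. 2 * n"]
    by (simp add: strict_mono_def o_def)
  moreover have "(\<lambda>n. \<Prod>i<2*n. 1 - w * Q ^ i) \<longlonglongrightarrow> qpoch w (Q\<^sup>2) * qpoch (w * Q) (Q\<^sup>2)"
    unfolding eq by (intro tendsto_mult qpoch_LIMSEQ Q2)
  ultimately show ?thesis
    by (rule LIMSEQ_unique)
qed

text \<open>Convergence of an infinite product includes that the limit is nonzero after removal of
  finitely many factors, so that only a vanishing factor can produce a zero.\<close>

lemma qpoch_eq_0_iff: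
  assumes "norm Q < 1"
  shows "qpoch w Q = 0 \<longleftrightarrow> (\<exists>n. w * Q ^ n = 1)"
proof -
  have "qpoch w Q = 0 \<longleftrightarrow> (\<lambda>n. \<Prod>i\<le>n. 1 - w * Q ^ i) \<longlonglongrightarrow> 0"
    using convergent_prod_LIMSEQ[OF convergent_qpoch[OF assms, of w]]
    unfolding qpoch_def by (metis LIMSEQ_unique)
  also have "\<dots> \<longleftrightarrow> (\<exists>n. 1 - w * Q ^ n = 0)"
    by (rule convergent_prod_to_zero_iff[OF convergent_qpoch[OF assms]])
  finally show ?thesis
    by (metis right_minus_eq)
qed

text \<open>The bound is uniform in \<open>Q\<close>, which allows both arguments to tend to 0 at
  the same time in \<open>qpoch_tendsto_1\<close>. The factor 2 is the sum of the geometric series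
  with ratio 1/2.\<close>

lemma norm_qpoch_minus_1_le:
  assumes "norm Q \<le> 1/2"
  shows "norm (qpoch w Q - 1) \<le> exp (2 * norm w) - 1"
proof -
  have Q: "norm Q < 1" using assms by simp
  have le: "norm ((\<Prod>i<n. 1 - w * Q ^ i) - 1) \<le> exp (2 * norm w) - 1" for n
  proof -
    have "norm ((\<Prod>i<n. 1 - w * Q ^ i) - 1) = norm ((\<Prod>i<n. 1 + (- (w * Q ^ i))) - 1)"
      by simp
    also have "\<dots> \<le> (\<Prod>i<n. 1 + norm (- (w * Q ^ i))) - 1"
      by (rule norm_prod_minus1_le_prod_minus1)
    also have "(\<Prod>i<n. 1 + norm (- (w * Q ^ i))) \<le> (\<Prod>i<n. exp (norm w * (1/2) ^ i))"
    proof (intro prod_mono conjI)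
      fix i assume "i \<in> {..<n}"
      have "1 + norm (- (w * Q ^ i)) \<le> 1 + norm w * (1/2) ^ i"
        using assms by (auto simp: norm_mult norm_power simp del: power_divide power_one_over
            intro!: mult_left_mono power_mono)
      also have "\<dots> \<le> exp (norm w * (1/2) ^ i)"
        by (rule exp_ge_add_one_self)
      finally show "1 + norm (- (w * Q ^ i)) \<le> exp (norm w * (1/2) ^ i)" .
    qed auto
    also have "\<dots> = exp (norm w * (\<Sum>i<n. (1/2) ^ i))"
      by (simp add: exp_sum [symmetric] sum_distrib_left)
    also have "\<dots> \<le> exp (2 * norm w)"
    proof -
      have "(\<Sum>i<n. (1/2::real) ^ i) \<le> (\<Sum>i. (1/2) ^ i)"
        by (intro sum_le_suminf summable_geometric) auto
      also have "\<dots> = 2"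
        by (simp add: suminf_geometric)
      finally have "norm w * (\<Sum>i<n. (1/2) ^ i) \<le> norm w * 2"
        by (intro mult_left_mono) auto
      then show ?thesis by (simp add: mult.commute)
    qed
    finally show ?thesis by simp
  qed
  have "(\<lambda>n. norm ((\<Prod>i<n. 1 - w * Q ^ i) - 1)) \<longlonglongrightarrow> norm (qpoch w Q - 1)"
    by (intro tendsto_intros qpoch_LIMSEQ Q)
  then show ?thesis
    by (rule LIMSEQ_le_const2) (use le in auto)
qed

lemma qpoch_tendsto_1:
  assumes "(f \<longlongrightarrow> 0) F" "(g \<longlongrightarrow> 0) F"
  shows "((\<lambda>x. qpoch (f x) (g x)) \<longlongrightarrow> 1) F"
proof -
  have "eventually (\<lambda>x. norm (g x) < 1/2) F"
    using order_tendstoD(2)[OF tendsto_norm_zero[OF assms(2)], of "1/2"] by simp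
  then have ev: "eventually (\<lambda>x. norm (qpoch (f x) (g x) - 1) \<le> exp (2 * norm (f x)) - 1) F"
    by eventually_elim (auto intro!: norm_qpoch_minus_1_le)
  have "((\<lambda>x. exp (2 * norm (f x)) - 1) \<longlongrightarrow> exp (2 * norm (0::complex)) - 1) F"
    by (intro tendsto_intros assms)
  then have "((\<lambda>x. exp (2 * norm (f x)) - 1) \<longlongrightarrow> 0) F"
    by simp
  from Lim_null_comparison[OF ev this] have "((\<lambda>x. qpoch (f x) (g x) - 1) \<longlongrightarrow> 0) F" .
  then show ?thesis
    by (rule LIM_zero_cancel)
qed

text \<open>Both arguments vary, because theta functions are differentiated in the point and also in
  the lattice parameter. On a closed disc the maxima of the norms of \<open>f\<close> and
  \<open>g\<close> yield a geometric majorant.\<close>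

lemma holomorphic_on_qpoch [holomorphic_intros]:
  assumes f: "f holomorphic_on S" and g: "g holomorphic_on S" and S: "open S"
    and g1: "\<And>z. z \<in> S \<Longrightarrow> norm (g z) < 1"
  shows "(\<lambda>z. qpoch (f z) (g z)) holomorphic_on S"
proof (rule holomorphic_uniform_sequence[OF S])
  show "(\<lambda>z. \<Prod>i<n. 1 - f z * g z ^ i) holomorphic_on S" for n
    by (intro holomorphic_intros f g)
  fix x assume x: "x \<in> S"
  obtain d where d: "d > 0" "cball x d \<subseteq> S"
    using S x by (meson open_contains_cball)
  let ?K = "cball x d"
  have cf: "continuous_on ?K f" and cg: "continuous_on ?K g"
    using f g d by (auto intro: holomorphic_on_imp_continuous_on continuous_on_subset)
  have ne: "?K \<noteq> {}" using d by auto
  obtain y where y: "y \<in> ?K" "\<And>z. z \<in> ?K \<Longrightarrow> norm (g z) \<le> norm (g y)"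
    using continuous_attains_sup[OF compact_cball ne continuous_on_norm[OF cg]] by blast
  obtain y' where y': "\<And>z. z \<in> ?K \<Longrightarrow> norm (f z) \<le> norm (f y')"
    using continuous_attains_sup[OF compact_cball ne continuous_on_norm[OF cf]] by blast
  have gy: "norm (g y) < 1" using y d g1 by auto
  have "uniformly_convergent_on ?K (\<lambda>N z. \<Prod>n<N. 1 - f z * g z ^ n)"
  proof (rule uniformly_convergent_on_prod')
    show "continuous_on ?K (\<lambda>z. 1 - f z * g z ^ n)" for n
      by (intro continuous_intros cf cg)
    show "uniformly_convergent_on ?K (\<lambda>N z. \<Sum>n<N. norm (1 - f z * g z ^ n - 1))"
    proof (rule Weierstrass_m_test')
      show "summable (\<lambda>n. norm (f y') * norm (g y) ^ n)"
        using gy by (intro summable_mult summable_geometric) auto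
      show "norm (norm (1 - f z * g z ^ n - 1)) \<le> norm (f y') * norm (g y) ^ n" if "z \<in> ?K" for n z
        using y(2)[OF that] y'[OF that] by (auto simp: norm_mult norm_power intro!: mult_mono power_mono)
    qed
  qed auto
  then obtain l where l: "uniform_limit ?K (\<lambda>N z. \<Prod>n<N. 1 - f z * g z ^ n) l sequentially"
    by (auto simp: uniformly_convergent_on_def)
  have "l z = qpoch (f z) (g z)" if "z \<in> ?K" for z
    using tendsto_uniform_limitI[OF l that] qpoch_LIMSEQ[of "g z" "f z"] g1 that d
    by (meson LIMSEQ_unique subsetD)
  then have "uniform_limit ?K (\<lambda>N z. \<Prod>n<N. 1 - f z * g z ^ n) (\<lambda>z. qpoch (f z) (g z)) sequentially"
    using l by (subst uniform_limit_cong'[where g = "\<lambda>N z. \<Prod>n<N. 1 - f z * g z ^ n" and i = l]) auto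
  then show "\<exists>d>0. cball x d \<subseteq> S \<and> uniform_limit (cball x d) (\<lambda>n z. \<Prod>i<n. 1 - f z * g z ^ i)
      (\<lambda>z. qpoch (f z) (g z)) sequentially"
    using d by blast
qed

section \<open>Theta functions\<close>

lemma remove_sings_shift:
  assumes "\<And>z. f (z + c) = f z"
  shows "remove_sings f (z + c) = remove_sings f z"
proof -
  have "filtermap (\<lambda>x. x + c) (at z) = at (z + c)"
    using filtermap_at_shift[of "-c" z] by simp
  from remove_sings_compose[OF this, of f] show ?thesis
    by (simp add: o_def assms)
qed

text \<open>The codomain is arbitrary, so that the lemma also covers predicates: the zero set of a
  quasi-periodic function is periodic although the function is not.\<close>

lemma periodic_of_int:
  assumes "\<And>z. f (z + c) = f (z :: complex)"
  shows "f (z + of_int n * c) = f z"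
proof (induction n rule: int_induct[of _ 0])
  case (step1 i)
  then show ?case using assms[of "z + of_int i * c"] by (simp add: algebra_simps)
next
  case (step2 i)
  then show ?case using assms[of "z + of_int (i - 1) * c"] by (simp add: algebra_simps)
qed simp

text \<open>All values are already taken on the compact period parallelogram \<open>Q\<close>, so
  the function is bounded.\<close>

lemma entire_elliptic_constant:
  assumes t: "Im t > 0" and h: "h holomorphic_on UNIV"
    and p1: "\<And>z. h (z + 1) = h z" and pt: "\<And>z. h (z + t) = h z"
  obtains C where "\<And>z. h z = C"
proof -
  define Q where "Q = (\<lambda>(x, y). of_real x + of_real y * t) ` (({0..1} \<times> {0..1}) :: (real \<times> real) set)"
  have "compact Q"
    unfolding Q_def by (intro compact_continuous_image compact_Times)
      (auto intro!: continuous_intros simp: case_prod_unfold)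
  then have "compact (h ` Q)"
    using h by (intro compact_continuous_image holomorphic_on_imp_continuous_on)
      (auto intro: holomorphic_on_subset)
  then have bdd: "bounded (h ` Q)"
    by (rule compact_imp_bounded)
  have "h z \<in> h ` Q" for z
  proof -
    define y where "y = Im z / Im t"
    define x where "x = Re z - y * Re t"
    have z: "z = of_real x + of_real y * t"
      using t by (auto simp: complex_eq_iff x_def y_def)
    define z' where "z' = of_real (frac x) + of_real (frac y) * t"
    have "z = (z' + of_int \<lfloor>x\<rfloor> * 1) + of_int \<lfloor>y\<rfloor> * t"
      unfolding z z'_def frac_def by (simp add: algebra_simps)
    then have "h z = h z'"
      using periodic_of_int[of h, OF p1] periodic_of_int[of h, OF pt] by metis
    moreover have "z' \<in> Q"
      unfolding Q_def z'_def using frac_ge_0[of x] frac_ge_0[of y] frac_lt_1[of x] frac_lt_1[of y]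
      by (intro image_eqI[of _ _ "(frac x, frac y)"]) auto
    ultimately show ?thesis by blast
  qed
  then have "range h \<subseteq> h ` Q" by blast
  with bdd have "bounded (range h)"
    by (rule bounded_subset)
  then have "h constant_on UNIV"
    by (rule Liouville_theorem[OF h])
  then show ?thesis
    using that by (auto simp: constant_on_def)
qed

text \<open>The quotient of \<open>f\<close> by \<open>P\<close> is an elliptic function without poles.\<close>

lemma theta_proportional:
  assumes t: "Im t > 0" and f: "f holomorphic_on UNIV" and P: "P holomorphic_on UNIV"
    and f1: "\<And>z. f (z + 1) = a * f z" and P1: "\<And>z. P (z + 1) = a * P z" and a: "a \<noteq> 0"
    and ft: "\<And>z. f (z + t) = b z * f z" and Pt: "\<And>z. P (z + t) = b z * P z"
    and b: "\<And>z. b z \<noteq> 0"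
    and zero: "\<And>z. P z = 0 \<Longrightarrow> f z = 0 \<and> (\<exists>c. c \<noteq> 0 \<and> (P has_field_derivative c) (at z))"
    and nz: "P z0 \<noteq> 0"
  obtains C where "\<And>z. f z = C * P z"
proof -
  define h where "h = remove_sings (\<lambda>z. f z / P z)"
  have ana: "(\<lambda>z. f z / P z) analytic_on {z}" if "P z \<noteq> 0" for z
    using f P that by (intro analytic_on_divide) (auto simp: analytic_on_holomorphic)
  have hana: "h analytic_on {z}" for z
  proof (cases "P z = 0")
    case False
    then show ?thesis
      unfolding h_def by (intro remove_sings_analytic_on ana)
  next
    case True
    then obtain c where c: "c \<noteq> 0" "(P has_field_derivative c) (at z)" and fz: "f z = 0"
      using zero by blast
    have "isolated_singularity_at (\<lambda>z. f z / P z) z"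
    proof -
      have "f analytic_on {z}" "P analytic_on {z}"
        using f P by (auto simp: analytic_on_holomorphic)
      then have "(\<lambda>z. f z / P z) meromorphic_on {z}"
        by (intro meromorphic_intros analytic_on_imp_meromorphic_on)
      then show ?thesis
        by (simp add: meromorphic_at_iff)
    qed
    \<comment> \<open>\<open>f\<close> and \<open>P\<close> both vanish at \<open>z\<close>, the
      latter to first order: the quotient of the two difference quotients converges, and the
      singularity is removable.\<close>
    moreover have "(\<lambda>z. f z / P z) \<midarrow>z\<rightarrow> deriv f z / c"
    proof -
      have "(f has_field_derivative deriv f z) (at z)"
        using f by (intro holomorphic_derivI[of _ UNIV]) auto
      then have "((\<lambda>w. ((f w - f z) / (w - z)) / ((P w - P z) / (w - z))) \<longlongrightarrow> deriv f z / c) (at z)"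
        using c by (intro tendsto_divide) (auto simp: has_field_derivative_iff)
      moreover have "eventually (\<lambda>w. ((f w - f z) / (w - z)) / ((P w - P z) / (w - z)) = f w / P w) (at z)"
        by (auto simp: eventually_at_filter fz True)
      ultimately show ?thesis
        by (rule Lim_transform_eventually)
    qed
    ultimately show ?thesis
      unfolding h_def by (rule remove_sings_analytic_at)
  qed
  have "h holomorphic_on UNIV"
    using hana analytic_on_analytic_at analytic_imp_holomorphic by blast
  moreover have "h (z + 1) = h z" "h (z + t) = h z" for z
    unfolding h_def by (rule remove_sings_shift, simp add: f1 P1 a ft Pt b)+
  ultimately obtain C where C: "\<And>z. h z = C"
    using entire_elliptic_constant[OF t] by blast
  have "f z = C * P z" for z
  proof (cases "P z = 0")
    case True
    then show ?thesis using zero by simp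
  next
    case False
    then have "h z = f z / P z"
      unfolding h_def by (intro remove_sings_at_analytic ana)
    with False C[of z] show ?thesis by (simp add: field_simps)
  qed
  then show ?thesis using that by blast
qed

text \<open>
  The odd Jacobi theta function without its factor that depends on \<open>t\<close> only; that factor
  cancels in all quotients that occur.
\<close>

definition sg :: "complex \<Rightarrow> complex \<Rightarrow> complex" where
  "sg z t = expi2 (- z / 2) * qpoch (expi2 z) (expi2 t) * qpoch (expi2 (t - z)) (expi2 t)"

section \<open>Quasi-periods and zeros of the odd theta function\<close>

lemma norm_expi2_less_1 [simp]: "Im t > 0 \<Longrightarrow> norm (expi2 t) < 1"
  by (simp add: norm_expi2)

text \<open>Isolates the factor responsible for the zero at the origin.\<close>

lemma sg_altdef:
  assumes "Im t > 0"
  shows "sg z t = (1 - expi2 z) *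
    (expi2 (- z / 2) * qpoch (expi2 (z + t)) (expi2 t) * qpoch (expi2 (t - z)) (expi2 t))"
  using qpoch_rec[of "expi2 t" "expi2 z"] assms by (simp add: sg_def expi2_add mult_ac)

lemma sg_minus:
  assumes "Im t > 0"
  shows "sg (- z) t = - sg z t"
proof -
  have "expi2 (z / 2) = expi2 (- z / 2) * expi2 z"
    by (simp add: expi2_add [symmetric])
  then have "(1 - expi2 (- z)) * expi2 (z / 2) = - ((1 - expi2 z) * expi2 (- z / 2))"
    by (simp add: expi2_minus field_simps)
  moreover have "sg (- z) t = (1 - expi2 (- z)) * expi2 (z / 2) *
      (qpoch (expi2 (z + t)) (expi2 t) * qpoch (expi2 (t - z)) (expi2 t))"
    using sg_altdef[OF assms, of "-z"] by (simp add: mult_ac add_ac)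
  ultimately show ?thesis
    using sg_altdef[OF assms, of z] by (simp add: mult_ac)
qed

lemma sg_add_1: "sg (z + 1) t = - sg z t"
proof -
  have "- (z + 1) / 2 = - z / 2 - 1 / 2"
    by (simp add: field_simps)
  then have "expi2 (- (z + 1) / 2) = - expi2 (- z / 2)"
    using expi2_diff[of "- z / 2" "1/2"] by (simp only: expi2_half) simp
  moreover have "expi2 (t - (z + 1)) = expi2 (t - z)" "expi2 (z + 1) = expi2 z"
    using expi2_diff[of "t - z" 1] by (simp_all add: diff_diff_add expi2_add)
  ultimately show ?thesis
    unfolding sg_def by simp
qed

lemma sg_add_t:
  assumes "Im t > 0"
  shows "sg (z + t) t = - (expi2 (- t / 2 - z) * sg z t)"
proof -
  have 1: "expi2 (- (z + t) / 2) = expi2 (- z / 2) * expi2 (- t / 2)"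
    by (simp add: expi2_add [symmetric] field_simps)
  have 2: "qpoch (expi2 (t - (z + t))) (expi2 t) = (1 - expi2 (- z)) * qpoch (expi2 (t - z)) (expi2 t)"
    using qpoch_rec[of "expi2 t" "expi2 (-z)"] assms by (simp add: expi2_add [symmetric] algebra_simps)
  have 3: "expi2 (- t / 2 - z) = expi2 (- t / 2) * expi2 (- z)"
    by (simp add: expi2_add [symmetric])
  have 4: "(1 - expi2 (- z)) = - expi2 (-z) * (1 - expi2 z)"
    by (simp add: expi2_minus field_simps)
  have "sg (z + t) t = expi2 (- z / 2) * expi2 (- t / 2) * qpoch (expi2 (z + t)) (expi2 t) *
      ((1 - expi2 (- z)) * qpoch (expi2 (t - z)) (expi2 t))"
    unfolding sg_def 1 2 ..
  also have "\<dots> = - (expi2 (- t / 2 - z) * sg z t)"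
    unfolding sg_altdef[OF assms] 3 4 by (simp add: algebra_simps)
  finally show ?thesis .
qed

lemma sg_add_int: "sg (z + of_int n) t = (-1) powi n * sg z t"
proof (induction n rule: int_induct[of _ 0])
  case (step1 i)
  then show ?case using sg_add_1[of "z + of_int i" t] by (simp add: power_int_add algebra_simps)
next
  case (step2 i)
  then show ?case using sg_add_1[of "z + of_int (i - 1)" t]
    by (simp add: power_int_diff algebra_simps)
qed simp

lemma sg_add_int_t:
  assumes "Im t > 0"
  shows "sg (z + of_int m * t) t = (-1) powi m * expi2 (- (of_int m)\<^sup>2 * t / 2 - of_int m * z) * sg z t"
proof (induction m rule: int_induct[of _ 0])
  case (step1 i)
  have "sg (z + of_int (i + 1) * t) t = - (expi2 (- t / 2 - (z + of_int i * t)) * sg (z + of_int i * t) t)"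
    using sg_add_t[OF assms, of "z + of_int i * t"] by (simp add: algebra_simps)
  also have "\<dots> = (-1) powi (i + 1) *
      (expi2 (- t / 2 - (z + of_int i * t)) * expi2 (- (of_int i)\<^sup>2 * t / 2 - of_int i * z)) * sg z t"
    by (simp add: step1 power_int_add)
  also have "expi2 (- t / 2 - (z + of_int i * t)) * expi2 (- (of_int i)\<^sup>2 * t / 2 - of_int i * z) =
      expi2 (- (of_int (i + 1))\<^sup>2 * t / 2 - of_int (i + 1) * z)"
    unfolding expi2_add [symmetric] by (rule arg_cong[of _ _ expi2]) (simp add: power2_eq_square field_simps)
  finally show ?case .
next
  case (step2 i)
  define j where "j = i - 1"
  have i: "i = j + 1" by (simp add: j_def)
  have *: "sg (z + of_int i * t) t = - (expi2 (- t / 2 - (z + of_int j * t)) * sg (z + of_int j * t) t)"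
    using sg_add_t[OF assms, of "z + of_int j * t"] by (simp add: algebra_simps i)
  then have "sg (z + of_int j * t) t = - (expi2 (t / 2 + (z + of_int j * t)) * sg (z + of_int i * t) t)"
  proof -
    have "expi2 (t / 2 + (z + of_int j * t)) * expi2 (- t / 2 - (z + of_int j * t)) = 1"
      unfolding expi2_add [symmetric] by simp
    then have "expi2 (t / 2 + (z + of_int j * t)) * (expi2 (- t / 2 - (z + of_int j * t)) * x) = x" for x
      by (metis mult.assoc mult_1)
    with * show ?thesis by simp
  qed
  also have "\<dots> = (-1) powi j *
      (expi2 (t / 2 + (z + of_int j * t)) * expi2 (- (of_int i)\<^sup>2 * t / 2 - of_int i * z)) * sg z t"
    unfolding step2(2) by (simp add: power_int_add i)
  also have "expi2 (t / 2 + (z + of_int j * t)) * expi2 (- (of_int i)\<^sup>2 * t / 2 - of_int i * z) =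
      expi2 (- (of_int j)\<^sup>2 * t / 2 - of_int j * z)"
    unfolding expi2_add [symmetric] i by (rule arg_cong[of _ _ expi2]) (simp add: power2_eq_square field_simps)
  finally show ?case unfolding j_def .
qed simp

lemma sg_add_lattice:
  assumes "Im t > 0"
  shows "sg (z + of_int m * t + of_int n) t =
    (-1) powi (m + n) * expi2 (- (of_int m)\<^sup>2 * t / 2 - of_int m * z) * sg z t"
  by (simp add: sg_add_int sg_add_int_t[OF assms] power_int_add)

lemma sg_0 [simp]: "Im t > 0 \<Longrightarrow> sg 0 t = 0"
  by (simp add: sg_altdef)

text \<open>The first product vanishes at the lattice points whose coefficient of \<open>t\<close>
  is at most 0, the second at those where it is at least 1.\<close>

lemma sg_eq_0_iff:
  assumes "Im t > 0"
  shows "sg z t = 0 \<longleftrightarrow> (\<exists>m n. z = of_int m * t + of_int n)"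
proof
  assume "sg z t = 0"
  then consider n where "expi2 (z + of_nat n * t) = 1" | n where "expi2 (t - z + of_nat n * t) = 1"
    using qpoch_eq_0_iff[of "expi2 t"] assms by (auto simp: sg_def expi2_power expi2_add)
  then show "\<exists>m n. z = of_int m * t + of_int n"
  proof cases
    case (1 n)
    then obtain k where "z + of_nat n * t = of_int k"
      by (auto simp: expi2_eq_1_iff elim: Ints_cases)
    then show ?thesis
      by (intro exI[of _ "- int n"] exI[of _ k]) (simp add: algebra_simps)
  next
    case (2 n)
    then obtain k where "t - z + of_nat n * t = of_int k"
      by (auto simp: expi2_eq_1_iff elim: Ints_cases)
    then show ?thesis
      by (intro exI[of _ "int n + 1"] exI[of _ "-k"]) (simp add: algebra_simps)
  qed
next
  assume "\<exists>m n. z = of_int m * t + of_int n"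
  then show "sg z t = 0"
    using sg_add_lattice[OF assms, of 0] assms by auto
qed

lemma holomorphic_on_sg:
  assumes "f holomorphic_on S" "g holomorphic_on S" "open S" "\<And>z. z \<in> S \<Longrightarrow> Im (g z) > 0"
  shows "(\<lambda>z. sg (f z) (g z)) holomorphic_on S"
  unfolding sg_def using assms by (intro holomorphic_intros) auto

text \<open>Quasi-periodicity moves any zero to the origin. There \<open>1 - expi2\<close> has a
  simple zero, and the remaining factor \<open>v\<close> does not vanish, since \<open>expi2\<close>
  of a positive multiple of \<open>t\<close> has norm less than 1.\<close>

lemma sg_simple_zero:
  assumes t: "Im t > 0" and z: "sg z t = 0"
  shows "\<exists>c. c \<noteq> 0 \<and> ((\<lambda>z. sg z t) has_field_derivative c) (at z)"
proof -
  obtain m n where mn: "z = of_int m * t + of_int n"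
    using z sg_eq_0_iff[OF t] by blast
  define v where "v = (\<lambda>z. expi2 (- z / 2) * qpoch (expi2 (z + t)) (expi2 t) * qpoch (expi2 (t - z)) (expi2 t))"
  define M where "M = (\<lambda>u. (-1) powi (m + n) * expi2 (- (of_int m)\<^sup>2 * t / 2 - of_int m * u) :: complex)"
  have eq: "sg w t = M (w - z) * ((1 - expi2 (w - z)) * v (w - z))" for w
  proof -
    have "w = (w - z) + of_int m * t + of_int n"
      by (simp add: mn)
    then have "sg w t = M (w - z) * sg (w - z) t"
      using sg_add_lattice[OF t, of "w - z" m n] unfolding M_def by metis
    then show ?thesis
      unfolding v_def sg_altdef[OF t, of "w - z"] .
  qed
  have v: "v holomorphic_on UNIV"
    unfolding v_def using t by (intro holomorphic_intros) auto
  have M: "M holomorphic_on UNIV"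
    unfolding M_def by (intro holomorphic_intros) auto
  have v0: "v 0 \<noteq> 0"
  proof
    assume "v 0 = 0"
    then obtain n where "expi2 (t + of_nat n * t) = 1"
      using qpoch_eq_0_iff[of "expi2 t"] t by (auto simp: v_def expi2_power expi2_add)
    then have "norm (expi2 (t + of_nat n * t)) = 1" by simp
    moreover have "Im (t + of_nat n * t) > 0"
      using t by (simp add: add_pos_nonneg)
    then have "norm (expi2 (t + of_nat n * t)) < 1"
      by (rule norm_expi2_less_1)
    ultimately show False by simp
  qed
  define F where "F = (\<lambda>u. M u * v u)"
  have F: "F holomorphic_on UNIV" unfolding F_def by (intro holomorphic_intros M v)
  have dF: "((\<lambda>w. F (w - z)) has_field_derivative deriv F 0 * 1) (at z)"
  proof (rule DERIV_chain'[where g = F and f = "\<lambda>w. w - z"])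
    show "((\<lambda>w. w - z) has_field_derivative 1) (at z)" by (auto intro!: derivative_eq_intros)
    show "(F has_field_derivative deriv F 0) (at (z - z))"
      using holomorphic_derivI[OF F open_UNIV, of 0] by simp
  qed
  have dE: "((\<lambda>w. 1 - expi2 (w - z)) has_field_derivative - (2 * of_real pi * \<i>)) (at z)"
    unfolding expi2_def by (auto intro!: derivative_eq_intros)
  have "((\<lambda>w. (1 - expi2 (w - z)) * F (w - z)) has_field_derivative - (2 * of_real pi * \<i>) * F 0) (at z)"
    using DERIV_mult[OF dE dF] by simp
  moreover have "(\<lambda>w. sg w t) = (\<lambda>w. (1 - expi2 (w - z)) * F (w - z))"
    using eq by (auto simp: F_def fun_eq_iff)
  moreover have "F 0 \<noteq> 0"
    using v0 by (simp add: F_def M_def power_int_eq_0_iff)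
  ultimately show ?thesis
    by (intro exI[of _ "- (2 * of_real pi * \<i>) * F 0"]) simp
qed

lemma sg_half_nonzero [simp]:
  assumes "Im t > 0"
  shows "sg (1/2) t \<noteq> 0"
proof
  assume "sg (1/2) t = 0"
  then obtain m n where mn: "1/2 = of_int m * t + of_int n"
    using sg_eq_0_iff[OF assms] by blast
  from arg_cong[OF this, of Im] have "m = 0"
    using assms by simp
  with mn have "(1/2 :: complex) = of_int n" by simp
  then have "complex_of_int (2 * n) = of_int 1" by (simp add: field_simps)
  then have "2 * n = 1" by (simp only: of_int_eq_iff)
  then show False by presburger
qed

section \<open>Modular transformation and the three-term relation\<close>

lemma Im_moebius:
  assumes "Im t > 0" "a * d - b * c = (1::int)"
  shows "Im ((of_int a * t + of_int b) / (of_int c * t + of_int d)) = Im t / (norm (of_int c * t + of_int d))\<^sup>2"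
proof -
  have "Im ((of_int a * t + of_int b) / (of_int c * t + of_int d)) =
    (of_int (a * d - b * c) * Im t) / (norm (of_int c * t + of_int d))\<^sup>2"
    unfolding Im_divide cmod_power2 by (simp add: algebra_simps)
  then show ?thesis using assms by simp
qed

lemma moebius_denom_nonzero:
  assumes "Im t > 0" "a * d - b * c = (1::int)"
  shows "of_int c * t + of_int d \<noteq> 0"
proof
  assume *: "of_int c * t + of_int d = 0"
  then have "Im (of_int c * t + of_int d) = 0" by simp
  then have "c = 0" using assms by simp
  with * assms show False by simp
qed

lemma minus_one_powi_parity: "(-1) powi n = (if even n then 1 else -1 :: complex)"
  by (auto simp: power_int_def minus_one_power_iff even_nat_iff)

text \<open>Once the Gaussian factor is removed, the left side has the same quasi-periods and zeros
  as \<open>sg z t\<close>, so \<open>theta_proportional\<close> applies. The point is that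
  \<open>C\<close> depends on the matrix and on \<open>t\<close> only: it cancels in quotients,
  whatever its value.\<close>

lemma sg_modular:
  assumes t: "Im t > 0" and det: "a * d - b * c = (1::int)"
  defines "j \<equiv> of_int c * t + of_int d"
  obtains C where "C \<noteq> 0"
    "\<And>z. sg (z / j) ((of_int a * t + of_int b) / j) = C * expi2 (of_int c * z\<^sup>2 / (2 * j)) * sg z t"
proof -
  define t' where "t' = (of_int a * t + of_int b) / j"
  have j: "j \<noteq> 0"
    unfolding j_def by (rule moebius_denom_nonzero[OF t det])
  have t': "Im t' > 0"
    unfolding t'_def j_def using Im_moebius[OF t det] moebius_denom_nonzero[OF t det] t by simp
  have det': "of_int a * of_int d - of_int b * of_int c = (1 :: complex)"
    using arg_cong[OF det, of complex_of_int] by simp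
  \<comment> \<open>Dividing the lattice of \<open>t\<close> by \<open>j\<close> gives the lattice
    of \<open>t'\<close>; the coefficients of \<open>1 / j\<close> and \<open>t / j\<close> come
    from the inverse matrix.\<close>
  have j1: "1 / j = of_int a - of_int c * t'"
  proof -
    have "j * (of_int a - of_int c * t') = of_int a * of_int d - of_int b * of_int c"
      using j by (simp add: t'_def j_def field_simps)
    with det' show ?thesis using j by (simp add: field_simps)
  qed
  have jt: "t / j = of_int d * t' - of_int b"
  proof -
    have "j * (of_int d * t' - of_int b) = (of_int a * of_int d - of_int b * of_int c) * t"
      using j by (simp add: t'_def j_def field_simps)
    with det' show ?thesis using j by (simp add: field_simps)
  qed
  define f where "f = (\<lambda>z. expi2 (- of_int c * z\<^sup>2 / (2 * j)) * sg (z / j) t')"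
  \<comment> \<open>The determinant excludes two even entries in a column. Hence (a + 1) (c + 1) and
    (b + 1) (d + 1) are even, so a + c + a c and b + d + b d are odd, and the signs below combine to
    -1.\<close>
  have "odd a \<or> odd c"
    using det by (metis dvd_diff_commute even_add even_mult_iff odd_one uminus_add_conv_diff dvd_minus_iff)
  have "odd b \<or> odd d"
    using det by (metis dvd_diff_commute even_add even_mult_iff odd_one uminus_add_conv_diff dvd_minus_iff)
  have f1: "f (z + 1) = (-1) * f z" for z
  proof -
    have "(z + 1) / j = z / j + of_int (- c) * t' + of_int a"
      using j1 by (simp add: add_divide_distrib)
    then have "f (z + 1) = (-1) powi (- c + a) * (expi2 (- of_int c * (z + 1)\<^sup>2 / (2 * j)) *
        expi2 (- (of_int (-c))\<^sup>2 * t' / 2 - of_int (-c) * (z / j))) * sg (z / j) t'"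
      unfolding f_def using sg_add_lattice[OF t', of "z / j" "-c" a] by simp
    also have "expi2 (- of_int c * (z + 1)\<^sup>2 / (2 * j)) * expi2 (- (of_int (-c))\<^sup>2 * t' / 2 - of_int (-c) * (z / j))
      = expi2 (- of_int c * z\<^sup>2 / (2 * j)) * expi2 (of_int (- c * a) / 2)"
    proof -
      have "- of_int c * (z + 1)\<^sup>2 / (2 * j) + (- (of_int (-c))\<^sup>2 * t' / 2 - of_int (-c) * (z / j)) =
        - of_int c * z\<^sup>2 / (2 * j) - of_int c / 2 * (1 / j + of_int c * t')"
        using j by (simp add: field_simps power2_eq_square)
      also have "\<dots> = - of_int c * z\<^sup>2 / (2 * j) + of_int (- c * a) / 2"
        unfolding j1 by simp
      finally show ?thesis
        unfolding expi2_add [symmetric] by (rule arg_cong)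
    qed
    also have "(-1) powi (- c + a) * (expi2 (- of_int c * z\<^sup>2 / (2 * j)) * expi2 (of_int (- c * a) / 2)) * sg (z / j) t'
       = ((-1) powi (- c + a) * (-1) powi (- c * a)) * f z"
      unfolding expi2_half_int f_def by (simp only: mult_ac)
    also have "(-1) powi (- c + a) * (-1) powi (- c * a) = (-1 :: complex)"
      using \<open>odd a \<or> odd c\<close> by (auto simp: minus_one_powi_parity)
    finally show ?thesis .
  qed
  have ft: "f (z + t) = (- expi2 (- t / 2 - z)) * f z" for z
  proof -
    have "(z + t) / j = z / j + of_int d * t' + of_int (- b)"
      using jt by (simp add: add_divide_distrib)
    then have "f (z + t) = (-1) powi (d + - b) * (expi2 (- of_int c * (z + t)\<^sup>2 / (2 * j)) *
        expi2 (- (of_int d)\<^sup>2 * t' / 2 - of_int d * (z / j))) * sg (z / j) t'"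
      unfolding f_def using sg_add_lattice[OF t', of "z / j" d "-b"] by simp
    also have "expi2 (- of_int c * (z + t)\<^sup>2 / (2 * j)) * expi2 (- (of_int d)\<^sup>2 * t' / 2 - of_int d * (z / j))
      = expi2 (- of_int c * z\<^sup>2 / (2 * j)) * expi2 (- t / 2 - z) * expi2 (of_int (- (b * d)) / 2)"
    proof -
      have 1: "- of_int c * (z + t)\<^sup>2 / (2 * j) + (- (of_int d)\<^sup>2 * t' / 2 - of_int d * (z / j)) =
        - of_int c * z\<^sup>2 / (2 * j) - z * ((of_int c * t + of_int d) / j) - (of_int c * t * (t / j) + (of_int d)\<^sup>2 * t') / 2"
        using j by (simp add: field_simps power2_eq_square)
      have jj: "(of_int c * t + of_int d) / j = 1"
        using j unfolding j_def by simp
      have "of_int c * t * (t / j) + (of_int d)\<^sup>2 * t' = of_int d * (j * t') - of_int b * of_int c * t"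
        unfolding jt by (simp add: j_def power2_eq_square algebra_simps)
      also have "j * t' = of_int a * t + of_int b"
        using j by (simp add: t'_def)
      also have "of_int d * (of_int a * t + of_int b) - of_int b * of_int c * t =
         (of_int a * of_int d - of_int b * of_int c) * t + of_int (b * d)"
        by (simp add: algebra_simps)
      finally have 2: "of_int c * t * (t / j) + (of_int d)\<^sup>2 * t' = t + of_int (b * d)"
        unfolding det' by simp
      have "- of_int c * (z + t)\<^sup>2 / (2 * j) + (- (of_int d)\<^sup>2 * t' / 2 - of_int d * (z / j)) =
        - of_int c * z\<^sup>2 / (2 * j) + (- t / 2 - z) + of_int (- (b * d)) / 2"
        unfolding 1 2 jj by (simp add: diff_divide_distrib add_divide_distrib)
      then show ?thesis
        unfolding expi2_add [symmetric] by (rule arg_cong)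
    qed
    also have "(-1) powi (d + - b) * (expi2 (- of_int c * z\<^sup>2 / (2 * j)) * expi2 (- t / 2 - z) *
        expi2 (of_int (- (b * d)) / 2)) * sg (z / j) t'
       = ((-1) powi (d + - b) * (-1) powi (- (b * d))) * expi2 (- t / 2 - z) * f z"
      unfolding expi2_half_int f_def by (simp only: mult_ac)
    also have "(-1) powi (d + - b) * (-1) powi (- (b * d)) = (-1 :: complex)"
      using \<open>odd b \<or> odd d\<close> by (auto simp: minus_one_powi_parity)
    finally show ?thesis by simp
  qed
  have "f holomorphic_on UNIV" "(\<lambda>z. sg z t) holomorphic_on UNIV"
    unfolding f_def using j t t' by (auto intro!: holomorphic_intros holomorphic_on_sg)
  moreover have "f z = 0 \<and> (\<exists>c. c \<noteq> 0 \<and> ((\<lambda>z. sg z t) has_field_derivative c) (at z))"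
    if z0: "sg z t = 0" for z
  proof -
    obtain m n where "z = of_int m * t + of_int n"
      using z0 sg_eq_0_iff[OF t] by blast
    then have "z / j = of_int m * (t / j) + of_int n * (1 / j)"
      by (simp add: add_divide_distrib)
    also have "\<dots> = of_int (m * d - n * c) * t' + of_int (n * a - m * b)"
      unfolding j1 jt by (simp add: algebra_simps)
    finally have "f z = 0"
      unfolding f_def using sg_eq_0_iff[OF t', of "z / j"] by (metis mult_zero_right)
    with sg_simple_zero[OF t z0] show ?thesis by blast
  qed
  ultimately obtain C where C: "\<And>z. f z = C * sg z t"
    using theta_proportional[OF t, of f "\<lambda>z. sg z t" "-1" "\<lambda>z. - expi2 (- t / 2 - z)" "1/2"] f1 ft t
    by (auto simp: sg_add_1 sg_add_t)
  \<comment> \<open>Here the theta factor is \<open>sg (1/2) t'\<close>, at a half period.\<close>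
  have "f (j / 2) \<noteq> 0"
    unfolding f_def using j t' by simp
  with C have "C \<noteq> 0" by auto
  moreover have "sg (z / j) t' = C * expi2 (of_int c * z\<^sup>2 / (2 * j)) * sg z t" for z
  proof -
    have "C * expi2 (of_int c * z\<^sup>2 / (2 * j)) * sg z t = expi2 (of_int c * z\<^sup>2 / (2 * j)) * f z"
      by (simp add: C)
    also have "\<dots> = (expi2 (of_int c * z\<^sup>2 / (2 * j)) * expi2 (- of_int c * z\<^sup>2 / (2 * j))) * sg (z / j) t'"
      by (simp add: f_def)
    also have "expi2 (of_int c * z\<^sup>2 / (2 * j)) * expi2 (- of_int c * z\<^sup>2 / (2 * j)) = 1"
      unfolding expi2_add [symmetric] by simp
    finally show ?thesis by simp
  qed
  ultimately show ?thesis
    using that unfolding t'_def by blast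
qed

text \<open>As functions of \<open>x\<close> the three terms share the quasi-periods of
  \<open>P y\<close>. By the antisymmetry of \<open>P\<close> their sum \<open>f\<close> vanishes at
  \<open>y\<close>, and as an even function also at \<open>- y\<close>; hence it is a multiple of
  \<open>P y\<close>. It vanishes at \<open>z\<close> too, where \<open>P y\<close> does not, so the
  multiple is 0.\<close>

lemma sg_three_term:
  assumes t: "Im t > 0" and nz: "sg (2 * y) t \<noteq> 0" "sg (z + y) t \<noteq> 0" "sg (z - y) t \<noteq> 0"
  shows "sg (x + y) t * sg (x - y) t * (sg (z + w) t * sg (z - w) t) +
         sg (x + z) t * sg (x - z) t * (sg (w + y) t * sg (w - y) t) +
         sg (x + w) t * sg (x - w) t * (sg (y + z) t * sg (y - z) t) = 0"
proof -
  define P where "P = (\<lambda>u x. sg (x + u) t * sg (x - u) t)"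
  define f where "f = (\<lambda>x. P y x * P w z + P z x * P y w + P w x * P z y)"
  have P1: "P u (x + 1) = 1 * P u x" for u x
    using sg_add_1[of "x + u" t] sg_add_1[of "x - u" t] by (simp add: P_def algebra_simps)
  have Pt: "P u (x + t) = expi2 (- t - 2 * x) * P u x" for u x
  proof -
    have "P u (x + t) = (expi2 (- t / 2 - (x + u)) * expi2 (- t / 2 - (x - u))) * P u x"
      using sg_add_t[OF t, of "x + u"] sg_add_t[OF t, of "x - u"] by (simp add: P_def algebra_simps)
    also have "expi2 (- t / 2 - (x + u)) * expi2 (- t / 2 - (x - u)) = expi2 (- t - 2 * x)"
      unfolding expi2_add [symmetric] by (rule arg_cong[of _ _ expi2]) (simp add: field_simps)
    finally show ?thesis .
  qed
  have hol: "P u holomorphic_on UNIV" for u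
    unfolding P_def using t by (auto intro!: holomorphic_intros holomorphic_on_sg)
  then have "f holomorphic_on UNIV"
    unfolding f_def by (intro holomorphic_intros)
  have P_minus: "P u (- x) = P u x" and P_swap: "P x u = - P u x" for u x
  proof -
    have "sg (- x - u) t = - sg (x + u) t" "sg (- x + u) t = - sg (x - u) t" "sg (u - x) t = - sg (x - u) t"
      using sg_minus[OF t, of "x + u"] sg_minus[OF t, of "x - u"] by simp_all
    then show "P u (- x) = P u x" "P x u = - P u x"
      by (simp_all add: P_def add.commute mult.commute)
  qed
  have fP: "f x = 0 \<and> (\<exists>c. c \<noteq> 0 \<and> (P y has_field_derivative c) (at x))" if x: "P y x = 0" for x
  proof
    have f1: "f (x + 1) = 0 \<longleftrightarrow> f x = 0" and ft: "f (x + t) = 0 \<longleftrightarrow> f x = 0" for x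
    proof -
      have "f (x + 1) = f x" by (simp add: f_def P1)
      moreover have "f (x + t) = expi2 (- t - 2 * x) * f x"
        unfolding f_def Pt by (simp add: algebra_simps)
      ultimately show "f (x + 1) = 0 \<longleftrightarrow> f x = 0" "f (x + t) = 0 \<longleftrightarrow> f x = 0" by simp_all
    qed
    have shift: "f (x + of_int m * t + of_int n) = 0 \<longleftrightarrow> f x = 0" for x m n
      using periodic_of_int[of "\<lambda>x. f x = 0" 1 "x + of_int m * t" n, OF f1]
        periodic_of_int[of "\<lambda>x. f x = 0" t x m, OF ft] by simp
    have "P y y = 0"
      unfolding P_def using t by simp
    then have "f y = 0"
      using P_swap[of w y] P_swap[of y z] by (simp add: f_def)
    moreover have "f (- y) = f y" by (simp add: f_def P_minus)
    moreover from x consider m n where "x + y = of_int m * t + of_int n" | m n where "x - y = of_int m * t + of_int n"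
      using sg_eq_0_iff[OF t] by (auto simp: P_def)
    then have "\<exists>m n. x = - y + of_int m * t + of_int n \<or> x = y + of_int m * t + of_int n"
    proof cases
      case (1 m n)
      then have "x = - y + of_int m * t + of_int n" by (simp add: algebra_simps)
      then show ?thesis by blast
    next
      case (2 m n)
      then have "x = y + of_int m * t + of_int n" by (simp add: algebra_simps)
      then show ?thesis by blast
    qed
    ultimately show "f x = 0"
      using shift by metis
    \<comment> \<open>Since \<open>2 * y\<close> is not a lattice point, the two factors of
      \<open>P y\<close> have no common zero, and all zeros of \<open>P y\<close> are
      simple.\<close>
    have "\<not> (sg (x + y) t = 0 \<and> sg (x - y) t = 0)"
    proof
      assume "sg (x + y) t = 0 \<and> sg (x - y) t = 0"
      then obtain m n m' n' where "x + y = of_int m * t + of_int n" "x - y = of_int m' * t + of_int n'"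
        using sg_eq_0_iff[OF t] by metis
      then have "2 * y = of_int (m - m') * t + of_int (n - n')"
        by (simp add: algebra_simps)
      then show False
        using nz(1) sg_eq_0_iff[OF t] by blast
    qed
    have d: "((\<lambda>x. sg (x + u) t) has_field_derivative deriv (\<lambda>z. sg z t) (x + u)) (at x)" for u
    proof -
      have "((\<lambda>z. sg z t) has_field_derivative deriv (\<lambda>z. sg z t) (x + u)) (at (x + u))"
        by (rule holomorphic_derivI[of _ UNIV]) (use t in \<open>auto intro!: holomorphic_intros holomorphic_on_sg\<close>)
      then show ?thesis
        by (simp add: DERIV_shift)
    qed
    have d0: "deriv (\<lambda>z. sg z t) u \<noteq> 0" if "sg u t = 0" for u
      using sg_simple_zero[OF t that] DERIV_imp_deriv by blast
    have "(P y has_field_derivative deriv (\<lambda>z. sg z t) (x + y) * sg (x - y) t +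
        deriv (\<lambda>z. sg z t) (x - y) * sg (x + y) t) (at x)"
      unfolding P_def using DERIV_mult[OF d[of y] d[of "- y"]] by simp
    moreover have "deriv (\<lambda>z. sg z t) (x + y) * sg (x - y) t + deriv (\<lambda>z. sg z t) (x - y) * sg (x + y) t \<noteq> 0"
      using x \<open>\<not> (sg (x + y) t = 0 \<and> sg (x - y) t = 0)\<close> d0 by (auto simp: P_def)
    ultimately show "\<exists>c. c \<noteq> 0 \<and> (P y has_field_derivative c) (at x)" by blast
  qed
  have Pz: "P y z \<noteq> 0"
    using nz by (simp add: P_def)
  have f1: "f (x + 1) = 1 * f x" and ft: "f (x + t) = expi2 (- t - 2 * x) * f x" for x
    unfolding f_def P1 Pt by (simp_all add: algebra_simps)
  obtain C where C: "\<And>x. f x = C * P y x"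
    using theta_proportional[OF t \<open>f holomorphic_on UNIV\<close> hol[of y] f1 P1 one_neq_zero ft Pt expi2_nonzero fP Pz]
    by blast
  have "P z z = 0"
    unfolding P_def using t by simp
  then have "f z = 0"
    using P_swap[of y z] by (simp add: f_def)
  with C[of z] Pz have "C = 0" by simp
  with C have "f x = 0" by simp
  then show ?thesis
    by (simp add: f_def P_def)
qed

section \<open>Klein forms\<close>

text \<open>The Klein form at the point \<open>r t + s\<close>, again up to a factor that depends on \<open>t\<close> only.\<close>

definition kl :: "real \<Rightarrow> real \<Rightarrow> complex \<Rightarrow> complex" where
  "kl r s t = expi2 (of_real r * (of_real r * t + of_real s) / 2) * sg (of_real r * t + of_real s) t"

lemma holomorphic_on_kl:
  assumes "g holomorphic_on S" "open S" "\<And>z. z \<in> S \<Longrightarrow> Im (g z) > 0"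
  shows "(\<lambda>z. kl r s (g z)) holomorphic_on S"
  unfolding kl_def using assms by (intro holomorphic_intros holomorphic_on_sg) auto

lemma kl_eq_0_iff:
  assumes "Im t > 0"
  shows "kl r s t = 0 \<longleftrightarrow> r \<in> \<int> \<and> s \<in> \<int>"
proof -
  have "of_real r * t + of_real s = of_int m * t + of_int n \<longleftrightarrow> r = of_int m \<and> s = of_int n" for m n
    using assms by (auto simp: complex_eq_iff)
  then show ?thesis
    using sg_eq_0_iff[OF assms] by (auto simp: kl_def Ints_def)
qed

lemma kl_minus:
  assumes "Im t > 0"
  shows "kl (- r) (- s) t = - kl r s t"
  using sg_minus[OF assms, of "of_real r * t + of_real s"] by (simp add: kl_def algebra_simps)

text \<open>For rational \<open>r\<close> and \<open>s\<close> the factor is a root of unity that is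
  constant in \<open>t\<close>. All characters in the transformation of \<open>V\<close> under
  \<open>Gamma1 7\<close> come from here.\<close>

lemma kl_shift:
  assumes "Im t > 0"
  shows "kl (r + of_int m) (s + of_int n) t =
    (-1) powi (m + n + m * n) * expi2 (of_real (r * of_int n - of_int m * s) / 2) * kl r s t"
proof -
  define z where "z = of_real r * t + of_real s"
  have arg: "of_real (r + of_int m) * t + of_real (s + of_int n) = z + of_int m * t + of_int n"
    by (simp add: z_def algebra_simps)
  have "kl (r + of_int m) (s + of_int n) t = (-1) powi (m + n) *
    (expi2 (of_real (r + of_int m) * (z + of_int m * t + of_int n) / 2) *
     expi2 (- (of_int m)\<^sup>2 * t / 2 - of_int m * z)) * sg z t"
    unfolding kl_def arg sg_add_lattice[OF assms] by (simp only: mult_ac)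
  also have "expi2 (of_real (r + of_int m) * (z + of_int m * t + of_int n) / 2) *
     expi2 (- (of_int m)\<^sup>2 * t / 2 - of_int m * z) =
     expi2 (of_int (m * n) / 2) * (expi2 (of_real (r * of_int n - of_int m * s) / 2) * expi2 (of_real r * z / 2))"
    unfolding expi2_add [symmetric]
    by (rule arg_cong[of _ _ expi2]) (simp add: z_def power2_eq_square field_simps)
  also have "(-1) powi (m + n) * (expi2 (of_int (m * n) / 2) *
     (expi2 (of_real (r * of_int n - of_int m * s) / 2) * expi2 (of_real r * z / 2))) * sg z t =
     ((-1) powi (m + n) * (-1) powi (m * n)) * expi2 (of_real (r * of_int n - of_int m * s) / 2) * kl r s t"
    unfolding expi2_half_int kl_def z_def by (simp only: mult_ac)
  finally show ?thesis by (simp add: power_int_add)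
qed

lemma kl_one_minus:
  assumes "Im t > 0"
  shows "kl (1 - r) 0 t = kl r 0 t"
  using kl_shift[OF assms, of "-r" 1 0 0] kl_minus[OF assms, of r 0] by simp

text \<open>The exponential in \<open>kl\<close> is chosen to absorb the Gaussian factor of
  \<open>sg_modular\<close>: if r' t + s' = z, then r + c z = r' j, and the two exponents add up to
  r' z / 2. What remains is the row vector (r, s) times the matrix.\<close>

lemma kl_modular:
  assumes t: "Im t > 0" and det: "a * d - b * c = (1::int)"
  obtains C where "C \<noteq> 0"
    "\<And>r s. kl r s ((of_int a * t + of_int b) / (of_int c * t + of_int d)) =
       C * kl (r * of_int a + s * of_int c) (r * of_int b + s * of_int d) t"
proof -
  define j where "j = of_int c * t + of_int d"
  have j: "j \<noteq> 0"
    unfolding j_def by (rule moebius_denom_nonzero[OF t det])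
  obtain C where C: "C \<noteq> 0"
    "\<And>z. sg (z / j) ((of_int a * t + of_int b) / j) = C * expi2 (of_int c * z\<^sup>2 / (2 * j)) * sg z t"
    using sg_modular[OF t det] unfolding j_def by blast
  have det': "of_int a * of_int d - of_int b * of_int c = (1 :: complex)"
    using arg_cong[OF det, of complex_of_int] by simp
  have "kl r s ((of_int a * t + of_int b) / j) =
       C * kl (r * of_int a + s * of_int c) (r * of_int b + s * of_int d) t" for r s
  proof -
    define r' where "r' = r * of_int a + s * of_int c"
    define s' where "s' = r * of_int b + s * of_int d"
    define z where "z = of_real r' * t + of_real s'"
    have z: "of_real r * ((of_int a * t + of_int b) / j) + of_real s = z / j"
      using j by (simp add: z_def r'_def s'_def field_simps) (simp add: j_def algebra_simps)
    have r: "of_real r = of_real r' * of_int d - of_real s' * (of_int c :: complex)"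
    proof -
      have "of_real r' * of_int d - of_real s' * (of_int c :: complex) =
          of_real r * (of_int a * of_int d - of_int b * of_int c)"
        by (simp add: r'_def s'_def algebra_simps)
      then show ?thesis using det' by simp
    qed
    have rj: "of_real r + of_int c * z = of_real r' * j"
      unfolding r z_def j_def by (simp add: algebra_simps)
    have "of_real r * (z / j) / 2 + of_int c * z\<^sup>2 / (2 * j) = z * (of_real r + of_int c * z) / (2 * j)"
      using j by (simp add: field_simps power2_eq_square)
    also have "\<dots> = of_real r' * z / 2"
      unfolding rj using j by simp
    finally have "expi2 (of_real r * (z / j) / 2) * expi2 (of_int c * z\<^sup>2 / (2 * j)) = expi2 (of_real r' * z / 2)"
      unfolding expi2_add [symmetric] by (rule arg_cong)
    then show ?thesis
      unfolding kl_def z C(2) r'_def [symmetric] s'_def [symmetric] z_def [symmetric]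
      by (simp add: mult_ac)
  qed
  with C(1) show ?thesis
    using that unfolding j_def by blast
qed

text \<open>The exponential factors of the three products agree, because the sum of (a + b)^2, (a -
  b)^2, (c + d)^2 and (c - d)^2 is twice the sum of the four squares and so symmetric in the
  parameters.\<close>

lemma kl_three_term:
  assumes t: "Im t > 0" and nz: "2 * y \<notin> \<int>" "z + y \<notin> \<int>" "z - y \<notin> \<int>"
  shows "kl (x + y) 0 t * kl (x - y) 0 t * (kl (z + w) 0 t * kl (z - w) 0 t) +
         kl (x + z) 0 t * kl (x - z) 0 t * (kl (w + y) 0 t * kl (w - y) 0 t) +
         kl (x + w) 0 t * kl (x - w) 0 t * (kl (y + z) 0 t * kl (y - z) 0 t) = 0"
proof -
  define X Y Z W where "X = of_real x * t" "Y = of_real y * t" "Z = of_real z * t" "W = of_real w * t"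
  define E where "E = (\<lambda>u. expi2 (of_real (u\<^sup>2) * t / 2))"
  have kl: "kl u 0 t = E u * sg (of_real u * t) t" for u
    by (simp add: kl_def E_def power2_eq_square mult_ac)
  have E: "E (a + b) * E (a - b) * (E (c + d) * E (c - d)) = expi2 (of_real (a\<^sup>2 + b\<^sup>2 + c\<^sup>2 + d\<^sup>2) * t)" for a b c d
    unfolding E_def expi2_add [symmetric]
    by (rule arg_cong[of _ _ expi2]) (simp add: power2_eq_square field_simps)
  have sg0: "sg (of_real u * t) t \<noteq> 0" if "u \<notin> \<int>" for u
    using kl_eq_0_iff[OF t, of u 0] that by (auto simp: kl)
  have "sg (2 * Y) t \<noteq> 0" "sg (Z + Y) t \<noteq> 0" "sg (Z - Y) t \<noteq> 0"
    using nz[THEN sg0] by (simp_all add: X_Y_Z_W_def algebra_simps)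
  then have *: "sg (X + Y) t * sg (X - Y) t * (sg (Z + W) t * sg (Z - W) t) +
         sg (X + Z) t * sg (X - Z) t * (sg (W + Y) t * sg (W - Y) t) +
         sg (X + W) t * sg (X - W) t * (sg (Y + Z) t * sg (Y - Z) t) = 0"
    by (rule sg_three_term[OF t])
  have eq: "kl (a + b) 0 t * kl (a - b) 0 t * (kl (c + d) 0 t * kl (c - d) 0 t) =
     expi2 (of_real (a\<^sup>2 + b\<^sup>2 + c\<^sup>2 + d\<^sup>2) * t) *
     (sg (of_real a * t + of_real b * t) t * sg (of_real a * t - of_real b * t) t *
     (sg (of_real c * t + of_real d * t) t * sg (of_real c * t - of_real d * t) t))" for a b c d
    unfolding E [symmetric] kl by (simp add: algebra_simps)
  have "expi2 (of_real (x\<^sup>2 + z\<^sup>2 + w\<^sup>2 + y\<^sup>2) * t) = expi2 (of_real (x\<^sup>2 + y\<^sup>2 + z\<^sup>2 + w\<^sup>2) * t)"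
    "expi2 (of_real (x\<^sup>2 + w\<^sup>2 + y\<^sup>2 + z\<^sup>2) * t) = expi2 (of_real (x\<^sup>2 + y\<^sup>2 + z\<^sup>2 + w\<^sup>2) * t)"
    by (simp_all add: add_ac)
  then show ?thesis
    unfolding eq using * unfolding X_Y_Z_W_def by (simp only: distrib_left [symmetric]) simp
qed

section \<open>Behaviour of Klein forms at infinity, and duplication\<close>

definition at_ii_inf :: "complex filter" where
  "at_ii_inf = filtercomap Im at_top"

lemma eventually_at_ii_inf: "eventually P at_ii_inf \<longleftrightarrow> (\<exists>c. \<forall>t. Im t > c \<longrightarrow> P t)"
  unfolding at_ii_inf_def eventually_filtercomap eventually_at_top_dense by auto

lemma at_ii_inf_neq_bot [simp]: "at_ii_inf \<noteq> bot"
proof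
  assume "at_ii_inf = bot"
  then have "eventually (\<lambda>_. False) at_ii_inf" by simp
  then obtain c where "\<forall>t. \<not> (Im t > c)"
    unfolding eventually_at_ii_inf by blast
  then have "\<not> (Im (Complex 0 (c + 1)) > c)" by blast
  then show False by simp
qed

lemma expi2_tendsto_0:
  assumes "r > 0"
  shows "((\<lambda>t. expi2 (of_real r * t + c)) \<longlongrightarrow> 0) at_ii_inf"
proof (rule tendsto_norm_zero_cancel)
  have "filterlim Im at_top at_ii_inf"
    unfolding at_ii_inf_def by (rule filterlim_filtercomap)
  then have "filterlim (\<lambda>t. 2 * pi * r * Im t) at_top at_ii_inf"
    using assms by (intro filterlim_tendsto_pos_mult_at_top[OF tendsto_const]) auto
  then have "((\<lambda>t. exp (- (2 * pi * r * Im t))) \<longlongrightarrow> 0) at_ii_inf"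
    by (intro filterlim_compose[OF exp_at_bot]) (simp add: filterlim_uminus_at_bot)
  then have "((\<lambda>t. exp (- (2 * pi * r * Im t)) * exp (- (2 * pi * Im c))) \<longlongrightarrow> 0) at_ii_inf"
    by (intro tendsto_mult_left_zero)
  then show "((\<lambda>t. norm (expi2 (of_real r * t + c))) \<longlongrightarrow> 0) at_ii_inf"
    by (simp add: norm_expi2 exp_add [symmetric] algebra_simps)
qed

text \<open>The order of the form \<open>kl r s\<close> at \<open>\<i>\<infinity>\<close>, as an exponent of \<open>q\<close>.\<close>

definition lam :: "real \<Rightarrow> real" where
  "lam r = ((frac r)\<^sup>2 - frac r) / 2"

text \<open>The prefactor of \<open>kl\<close> contributes the exponent r^2 / 2, the exponential in
  \<open>sg\<close> contributes - r / 2, and the products tend to 1. For \<open>r = 0\<close> the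
  first product has one factor that does not depend on \<open>t\<close>; it is nonzero as
  \<open>s\<close> is not an integer.\<close>

lemma kl_asymp_aux:
  assumes r: "0 \<le> r" "r < 1" and nz: "r = 0 \<Longrightarrow> s \<notin> \<int>"
  shows "\<exists>c. c \<noteq> 0 \<and> ((\<lambda>t. kl r s t * expi2 (- of_real ((r\<^sup>2 - r) / 2) * t)) \<longlongrightarrow> c) at_ii_inf"
proof -
  define c0 where "c0 = expi2 (of_real ((r - 1) * s / 2))"
  have eq: "kl r s t * expi2 (- of_real ((r\<^sup>2 - r) / 2) * t) =
      c0 * qpoch (expi2 (of_real r * t + of_real s)) (expi2 t) *
      qpoch (expi2 (of_real (1 - r) * t + - of_real s)) (expi2 t)" for t
  proof -
    have A: "expi2 (of_real r * (of_real r * t + of_real s) / 2) * expi2 (- (of_real r * t + of_real s) / 2)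
        * expi2 (- of_real ((r\<^sup>2 - r) / 2) * t) = c0"
      unfolding c0_def expi2_add [symmetric]
      by (rule arg_cong[of _ _ expi2]) (simp add: field_simps power2_eq_square)
    have B: "t - (of_real r * t + of_real s) = of_real (1 - r) * t + - of_real s"
      by (simp add: algebra_simps)
    show ?thesis
      unfolding kl_def sg_def B A [symmetric] by (simp only: mult_ac)
  qed
  have et: "((\<lambda>t. expi2 t) \<longlongrightarrow> 0) at_ii_inf"
    using expi2_tendsto_0[of 1 0] by simp
  have 2: "((\<lambda>t. qpoch (expi2 (of_real (1 - r) * t + - of_real s)) (expi2 t)) \<longlongrightarrow> 1) at_ii_inf"
    using r by (intro qpoch_tendsto_1 expi2_tendsto_0 et) auto
  have "\<exists>c. c \<noteq> 0 \<and> ((\<lambda>t. qpoch (expi2 (of_real r * t + of_real s)) (expi2 t)) \<longlongrightarrow> c) at_ii_inf"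
  proof (cases "r = 0")
    case False
    then have "((\<lambda>t. qpoch (expi2 (of_real r * t + of_real s)) (expi2 t)) \<longlongrightarrow> 1) at_ii_inf"
      using r by (intro qpoch_tendsto_1 expi2_tendsto_0 et) auto
    then show ?thesis by (intro exI[of _ 1]) auto
  next
    case True
    have "((\<lambda>t. (1 - expi2 (of_real s)) * qpoch (expi2 (of_real 1 * t + of_real s)) (expi2 t)) \<longlongrightarrow>
        (1 - expi2 (of_real s)) * 1) at_ii_inf"
      by (intro tendsto_mult tendsto_const qpoch_tendsto_1 expi2_tendsto_0 et) auto
    moreover have "eventually (\<lambda>t. (1 - expi2 (of_real s)) * qpoch (expi2 (of_real 1 * t + of_real s)) (expi2 t) =
        qpoch (expi2 (of_real r * t + of_real s)) (expi2 t)) at_ii_inf"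
      unfolding eventually_at_ii_inf
    proof (intro exI[of _ 0] allI impI)
      fix t assume "Im t > 0"
      then show "(1 - expi2 (of_real s)) * qpoch (expi2 (of_real 1 * t + of_real s)) (expi2 t) =
        qpoch (expi2 (of_real r * t + of_real s)) (expi2 t)"
        using qpoch_rec[of "expi2 t" "expi2 (of_real s)"] True by (simp add: expi2_add mult_ac)
    qed
    ultimately have "((\<lambda>t. qpoch (expi2 (of_real r * t + of_real s)) (expi2 t)) \<longlongrightarrow>
        (1 - expi2 (of_real s)) * 1) at_ii_inf"
      by (rule Lim_transform_eventually)
    moreover have "expi2 (of_real s) \<noteq> 1"
      using nz[OF True] by (simp add: expi2_eq_1_iff)
    ultimately show ?thesis
      by (intro exI[of _ "(1 - expi2 (of_real s)) * 1"]) auto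
  qed
  then obtain c where c: "c \<noteq> 0"
    "((\<lambda>t. qpoch (expi2 (of_real r * t + of_real s)) (expi2 t)) \<longlongrightarrow> c) at_ii_inf" by blast
  have "((\<lambda>t. kl r s t * expi2 (- of_real ((r\<^sup>2 - r) / 2) * t)) \<longlongrightarrow> c0 * c * 1) at_ii_inf"
    unfolding eq by (intro tendsto_mult tendsto_const c 2)
  then show ?thesis
    using c by (intro exI[of _ "c0 * c * 1"]) (auto simp: c0_def)
qed

lemma kl_asymp:
  assumes "\<not> (r \<in> \<int> \<and> s \<in> \<int>)"
  shows "\<exists>c. c \<noteq> 0 \<and> ((\<lambda>t. kl r s t * expi2 (- of_real (lam r) * t)) \<longlongrightarrow> c) at_ii_inf"
proof -
  have "\<exists>c. c \<noteq> 0 \<and> ((\<lambda>t. kl (frac r) s t * expi2 (- of_real (((frac r)\<^sup>2 - frac r) / 2) * t)) \<longlongrightarrow> c) at_ii_inf"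
    using assms by (intro kl_asymp_aux) (auto simp: frac_lt_1)
  then obtain c where c: "c \<noteq> 0"
    "((\<lambda>t. kl (frac r) s t * expi2 (- of_real (lam r) * t)) \<longlongrightarrow> c) at_ii_inf"
    unfolding lam_def by blast
  define M where "M = (-1) powi \<lfloor>r\<rfloor> * expi2 (of_real (- of_int \<lfloor>r\<rfloor> * s) / 2)"
  have M: "M \<noteq> 0" by (simp add: M_def power_int_eq_0_iff)
  have "((\<lambda>t. M * (kl (frac r) s t * expi2 (- of_real (lam r) * t))) \<longlongrightarrow> M * c) at_ii_inf"
    by (intro tendsto_mult tendsto_const c)
  moreover have "eventually (\<lambda>t. M * (kl (frac r) s t * expi2 (- of_real (lam r) * t)) =
      kl r s t * expi2 (- of_real (lam r) * t)) at_ii_inf"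
    unfolding eventually_at_ii_inf
  proof (intro exI[of _ 0] allI impI)
    fix t assume "Im t > 0"
    then show "M * (kl (frac r) s t * expi2 (- of_real (lam r) * t)) = kl r s t * expi2 (- of_real (lam r) * t)"
      using kl_shift[of t "frac r" "\<lfloor>r\<rfloor>" s 0] by (simp add: M_def frac_def)
  qed
  ultimately have "((\<lambda>t. kl r s t * expi2 (- of_real (lam r) * t)) \<longlongrightarrow> M * c) at_ii_inf"
    by (rule Lim_transform_eventually)
  then show ?thesis using M c by (intro exI[of _ "M * c"]) auto
qed

text \<open>Of the four half products, the even part of the first and the odd part of the second
  form the theta function of \<open>2 * t\<close> at \<open>z\<close>; the other two form the one at
  \<open>t - z\<close>.\<close>

lemma kl_split:
  assumes "Im t > 0"
  shows "kl (2 * r) 0 t = expi2 (2 * t / 8) * kl r 0 (2 * t) * kl (1/2 - r) 0 (2 * t)"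
proof -
  define z where "z = of_real (2 * r) * t"
  have 1: "sg z t = sg z (2 * t) * sg (t - z) (2 * t) * expi2 (t / 2 - z / 2)"
  proof -
    have q2: "expi2 (2 * t) = (expi2 t)\<^sup>2"
      by (simp add: expi2_power)
    have 1: "qpoch (expi2 z) (expi2 t) = qpoch (expi2 z) ((expi2 t)\<^sup>2) * qpoch (expi2 (z + t)) ((expi2 t)\<^sup>2)"
      using qpoch_split[of "expi2 t" "expi2 z"] assms by (simp add: expi2_add)
    have "expi2 (t - z) * expi2 t = expi2 (2 * t - z)"
      unfolding expi2_add [symmetric] by (simp add: algebra_simps)
    then have 2: "qpoch (expi2 (t - z)) (expi2 t) = qpoch (expi2 (t - z)) ((expi2 t)\<^sup>2) * qpoch (expi2 (2 * t - z)) ((expi2 t)\<^sup>2)"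
      using qpoch_split[of "expi2 t" "expi2 (t - z)"] assms by simp
    have 3: "expi2 (- (t - z) / 2) * expi2 (t / 2 - z / 2) = 1"
      unfolding expi2_add [symmetric] by (simp add: field_simps)
    have 4: "2 * t - (t - z) = z + t" by simp
    have "E * (a * b) * (c * d) = E * a * d * (E1 * c * b) * E2" if "E1 * E2 = 1" for E a b c d E1 E2 :: complex
    proof -
      have "E * a * d * (E1 * c * b) * E2 = (E1 * E2) * (E * (a * b) * (c * d))"
        by (simp only: mult_ac)
      with that show ?thesis by simp
    qed
    from this[OF 3] show ?thesis
      unfolding sg_def q2 4 1 2 .
  qed
  have z2: "of_real r * (2 * t) = z" "of_real (1/2 - r) * (2 * t) = t - z"
    by (simp_all add: z_def algebra_simps)
  have "expi2 (of_real (2 * r) * z / 2) * expi2 (t / 2 - z / 2) =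
     expi2 (2 * t / 8) * expi2 (of_real r * z / 2) * expi2 (of_real (1/2 - r) * (t - z) / 2)"
    unfolding expi2_add [symmetric]
    by (rule arg_cong[of _ _ expi2]) (simp add: z_def field_simps)
  then show ?thesis
    unfolding kl_def of_real_0 add_0_right z2 z_def [symmetric] 1 by (simp add: mult_ac)
qed

section \<open>The theta series as Klein forms\<close>

text \<open>The general term of the odd Jacobi theta function, up to a constant factor.\<close>

definition theta_term :: "complex \<Rightarrow> complex \<Rightarrow> int \<Rightarrow> complex" where
  "theta_term z t n = (-1) powi n * expi2 (t * (of_int n + 1/2)\<^sup>2 / 2 + z * (of_int n + 1/2))"

definition theta_series :: "complex \<Rightarrow> complex \<Rightarrow> complex" where
  "theta_series z t = (\<Sum>\<^sub>\<infinity>n. theta_term z t n)"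

lemma theta_series_minus: "theta_series (- z) t = - theta_series z t"
proof -
  have "theta_term (- z) t (- 1 - n) = - theta_term z t n" for n
  proof -
    have "t * (of_int (- 1 - n) + 1/2)\<^sup>2 / 2 + - z * (of_int (- 1 - n) + 1/2) =
        t * (of_int n + 1/2)\<^sup>2 / 2 + z * (of_int n + 1/2)"
      by (simp add: field_simps power2_eq_square)
    moreover have "(-1) powi (- 1 - n) = - ((-1) powi n :: complex)"
      by (simp add: minus_one_powi_parity)
    ultimately show ?thesis
      unfolding theta_term_def by simp
  qed
  moreover have "bij (\<lambda>n::int. - 1 - n)"
    by (rule bij_betw_byWitness[where f' = "\<lambda>n. - 1 - n"]) auto
  then have "(\<Sum>\<^sub>\<infinity>n. theta_term (- z) t (- 1 - n)) = theta_series (- z) t"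
    unfolding theta_series_def by (rule infsum_reindex_bij_betw)
  ultimately show ?thesis
    unfolding theta_series_def by (simp add: infsum_uminus)
qed

lemma theta_series_add_1: "theta_series (z + 1) t = - theta_series z t"
proof -
  have "theta_term (z + 1) t n = - theta_term z t n" for n
  proof -
    have "expi2 (of_int n + 1/2) = -1"
      by (simp add: expi2_add)
    moreover have "t * (of_int n + 1/2)\<^sup>2 / 2 + (z + 1) * (of_int n + 1/2) =
        (t * (of_int n + 1/2)\<^sup>2 / 2 + z * (of_int n + 1/2)) + (of_int n + 1/2)"
      by (simp add: algebra_simps)
    ultimately show ?thesis
      unfolding theta_term_def by (simp only: expi2_add[of _ "of_int n + 1/2"]) simp
  qed
  then have "theta_term (z + 1) t = (\<lambda>n. - theta_term z t n)"
    by (rule ext)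
  then show ?thesis
    unfolding theta_series_def by (simp add: infsum_uminus)
qed

lemma theta_series_add_t: "theta_series (z + t) t = - expi2 (- t / 2 - z) * theta_series z t"
proof -
  have "theta_term (z + t) t n = - expi2 (- t / 2 - z) * theta_term z t (n + 1)" for n
  proof -
    have "t * (of_int n + 1/2)\<^sup>2 / 2 + (z + t) * (of_int n + 1/2) =
        (- t / 2 - z) + (t * (of_int (n + 1) + 1/2)\<^sup>2 / 2 + z * (of_int (n + 1) + 1/2))"
      by (simp add: field_simps power2_eq_square)
    moreover have "(-1) powi (n + 1) = - ((-1) powi n :: complex)"
      by (simp add: minus_one_powi_parity)
    ultimately show ?thesis
      unfolding theta_term_def by (simp only: expi2_add[of "- t / 2 - z"]) simp
  qed
  then have "theta_term (z + t) t = (\<lambda>n. - expi2 (- t / 2 - z) * theta_term z t (n + 1))"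
    by (rule ext)
  then have "theta_series (z + t) t = - expi2 (- t / 2 - z) * (\<Sum>\<^sub>\<infinity>n. theta_term z t (n + 1))"
    unfolding theta_series_def by (simp only: infsum_cmult_right')
  also have "bij (\<lambda>n::int. n + 1)"
    by (rule bij_betw_byWitness[where f' = "\<lambda>n. n - 1"]) auto
  then have "(\<Sum>\<^sub>\<infinity>n. theta_term z t (n + 1)) = theta_series z t"
    unfolding theta_series_def by (rule infsum_reindex_bij_betw)
  finally show ?thesis .
qed

lemma summable_on_exp_abs_int: "(\<lambda>n::int. exp (- \<bar>of_int n\<bar>) :: real) summable_on UNIV"
proof -
  define f where "f = (\<lambda>n::int. exp (- \<bar>of_int n\<bar>) :: real)"
  have "summable (\<lambda>n. exp (- 1 :: real) ^ n)"
    by (rule summable_geometric) simp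
  then have "(\<lambda>n::nat. exp (- real n)) summable_on UNIV"
    by (subst summable_on_UNIV_nonneg_real_iff) (auto simp: exp_of_nat_mult [symmetric])
  then have "(f \<circ> int) summable_on UNIV" "(f \<circ> (\<lambda>n. - int n)) summable_on UNIV"
    by (simp_all add: f_def o_def)
  then have 1: "f summable_on range int" and 2: "f summable_on range (\<lambda>n. - int n)"
    by (subst summable_on_reindex; simp add: inj_on_def)+
  have "f summable_on (range (\<lambda>n. - int n) - range int)"
    by (rule summable_on_subset_banach[OF 2]) blast
  with 1 have "f summable_on (range int \<union> (range (\<lambda>n. - int n) - range int))"
    by (rule summable_on_Un_disjoint) blast
  moreover have "range int \<union> (range (\<lambda>n. - int n) - range int) = UNIV"
  proof -
    have "n = int (nat n) \<or> n = - int (nat (- n))" for n :: int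
      by linarith
    then have "n \<in> range int \<union> range (\<lambda>n. - int n)" for n :: int
      by blast
    then show ?thesis by auto
  qed
  ultimately show ?thesis
    by (simp add: f_def)
qed

text \<open>Quadratic decay in \<open>n\<close> beats the linear growth caused by \<open>z\<close>.
  A crude majorant that is uniform on discs is enough for the Weierstrass test.\<close>

lemma theta_term_bound:
  assumes t: "Im t > 0" and R: "R \<ge> 0"
  obtains K where "\<And>z n. norm z \<le> R \<Longrightarrow> norm (theta_term z t n) \<le> K * exp (- \<bar>of_int n\<bar>)"
proof -
  define y where "y = pi * Im t"
  have y: "y > 0" using t by (simp add: y_def)
  \<comment> \<open>The summand 1 is what leaves the decaying term \<open>- \<bar>m\<bar>\<close>
    after completion of the square.\<close>
  define B where "B = 2 * pi * R + 1"
  have "norm (theta_term z t n) \<le> exp (B\<^sup>2 / (4 * y) + 1) * exp (- \<bar>of_int n\<bar>)" if z: "norm z \<le> R" for z n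
  proof -
    define m :: real where "m = of_int n + 1/2"
    have m: "of_int n + 1/2 = complex_of_real m" by (simp add: m_def)
    have "norm (theta_term z t n) = exp (- (2 * pi * Im (t * (of_real m)\<^sup>2 / 2 + z * of_real m)))"
      unfolding theta_term_def m by (simp add: norm_mult norm_expi2 norm_power_int)
    also have "- (2 * pi * Im (t * (of_real m)\<^sup>2 / 2 + z * of_real m)) = - y * m\<^sup>2 - 2 * pi * (Im z * m)"
      by (simp add: y_def algebra_simps power2_eq_square flip: of_real_mult)
    also have "\<dots> \<le> - y * m\<^sup>2 + (B - 1) * \<bar>m\<bar>"
    proof -
      have "- (Im z * m) \<le> \<bar>Im z\<bar> * \<bar>m\<bar>"
        by (metis abs_ge_minus_self abs_mult)
      also have "\<dots> \<le> R * \<bar>m\<bar>"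
        using abs_Im_le_cmod[of z] z by (intro mult_right_mono) auto
      finally have "2 * pi * - (Im z * m) \<le> 2 * pi * (R * \<bar>m\<bar>)"
        by (intro mult_left_mono) auto
      then show ?thesis by (simp add: B_def algebra_simps)
    qed
    also have "\<dots> \<le> B\<^sup>2 / (4 * y) - \<bar>m\<bar>"
    proof -
      have "0 \<le> (2 * y * \<bar>m\<bar> - B)\<^sup>2 / (4 * y)"
        using y by simp
      also have "(2 * y * \<bar>m\<bar> - B)\<^sup>2 / (4 * y) = y * m\<^sup>2 - B * \<bar>m\<bar> + B\<^sup>2 / (4 * y)"
        using y by (simp add: field_simps power2_eq_square)
      finally show ?thesis by (simp add: algebra_simps)
    qed
    also have "\<dots> \<le> (B\<^sup>2 / (4 * y) + 1) + - \<bar>of_int n\<bar>"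
      by (simp add: m_def)
    finally show ?thesis
      unfolding exp_add [symmetric] by simp
  qed
  then show ?thesis using that by blast
qed

lemma theta_series_uniform_limit:
  assumes "Im t > 0"
  shows "uniform_limit (cball 0 R) (\<lambda>X z. \<Sum>n\<in>X. theta_term z t n) (\<lambda>z. theta_series z t) (finite_subsets_at_top UNIV)"
proof (cases "R \<ge> 0")
  case True
  obtain K where "\<And>z n. norm z \<le> R \<Longrightarrow> norm (theta_term z t n) \<le> K * exp (- \<bar>of_int n\<bar>)"
    using theta_term_bound[OF assms True] by blast
  then show ?thesis
    unfolding theta_series_def
    by (intro Weierstrass_m_test_general[where M = "\<lambda>n. K * exp (- \<bar>of_int n\<bar>)"]
        summable_on_cmult_right summable_on_exp_abs_int) auto
qed auto

lemma holomorphic_theta_series: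
  assumes "Im t > 0"
  shows "(\<lambda>z. theta_series z t) holomorphic_on UNIV"
proof -
  have "(\<lambda>z. theta_series z t) holomorphic_on ball 0 R" for R
  proof (rule holomorphic_uniform_limit[OF _ theta_series_uniform_limit[OF assms]])
    show "\<forall>\<^sub>F X in finite_subsets_at_top UNIV. continuous_on (cball 0 R) (\<lambda>z. \<Sum>n\<in>X. theta_term z t n)
        \<and> (\<lambda>z. \<Sum>n\<in>X. theta_term z t n) holomorphic_on ball 0 R"
      unfolding theta_term_def by (intro always_eventually allI conjI continuous_intros holomorphic_intros)
  qed auto
  then have "(\<lambda>z. theta_series z t) holomorphic_on (\<Union>n. ball 0 (real n))"
    by (intro holomorphic_on_UN_open) auto
  moreover have "(\<Union>n. ball (0::complex) (real n)) = UNIV"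
    using reals_Archimedean2 by auto
  ultimately show ?thesis by simp
qed

text \<open>This is the Jacobi triple product with an undetermined constant. Series and product have
  the same quasi-periods, and the series vanishes on the lattice because it is odd.\<close>

lemma theta_series_proportional:
  assumes t: "Im t > 0"
  obtains C where "C \<noteq> 0" "\<And>z. theta_series z t = C * sg z t"
proof -
  have shift: "theta_series (x + of_int m * t + of_int n) t = 0 \<longleftrightarrow> theta_series x t = 0" for x m n
    using periodic_of_int[of "\<lambda>x. theta_series x t = 0" 1 "x + of_int m * t" n]
      periodic_of_int[of "\<lambda>x. theta_series x t = 0" t x m]
    by (simp add: theta_series_add_1 theta_series_add_t)
  have "theta_series 0 t = 0"
    using theta_series_minus[of 0 t] by simp
  then have "theta_series z t = 0 \<and> (\<exists>c. c \<noteq> 0 \<and> ((\<lambda>z. sg z t) has_field_derivative c) (at z))"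
    if "sg z t = 0" for z
    using sg_simple_zero[OF t that] shift[of 0] that sg_eq_0_iff[OF t, of z] by auto
  moreover have "(\<lambda>z. sg z t) holomorphic_on UNIV"
    using t by (intro holomorphic_on_sg holomorphic_intros) auto
  ultimately obtain C where C: "\<And>z. theta_series z t = C * sg z t"
    using theta_proportional[OF t holomorphic_theta_series[OF t], of "\<lambda>z. sg z t" "-1" "\<lambda>z. - expi2 (- t / 2 - z)" "1/2"] t
    by (auto simp: sg_add_1 sg_add_t theta_series_add_1 theta_series_add_t)
  \<comment> \<open>The series has a nonvanishing Fourier coefficient.\<close>
  have "C \<noteq> 0"
  proof
    assume "C = 0"
    define c where "c = (\<lambda>n::int. (-1) powi n * expi2 (t * (of_int n + 1/2)\<^sup>2 / 2))"
    have c0: "norm (c 0) > 0" by (simp add: c_def)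
    have "\<forall>\<^sub>F X in finite_subsets_at_top UNIV. \<forall>z\<in>cball 0 1. dist (\<Sum>n\<in>X. theta_term z t n) (theta_series z t) < norm (c 0) / 2"
      using c0 by (intro uniform_limitD[OF theta_series_uniform_limit[OF t]]) simp
    then obtain X where X: "finite X"
      "\<And>Y. finite Y \<Longrightarrow> X \<subseteq> Y \<Longrightarrow> \<forall>z\<in>cball 0 1. dist (\<Sum>n\<in>Y. theta_term z t n) (theta_series z t) < norm (c 0) / 2"
      unfolding eventually_finite_subsets_at_top by auto
    define Y where "Y = insert 0 X"
    have Y: "finite Y" "0 \<in> Y" "X \<subseteq> Y" using X by (auto simp: Y_def)
    \<comment> \<open>A partial sum of the series without the factor \<open>expi2 (x / 2)\<close> of
      norm 1. Its integral over the unit interval is \<open>c 0\<close>, whereas a vanishing series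
      would bound it by half the norm of \<open>c 0\<close>.\<close>
    define F where "F = (\<lambda>x::real. \<Sum>n\<in>Y. c n * expi2 (of_int n * of_real x))"
    have F_le: "norm (F x) \<le> norm (c 0) / 2" if x: "x \<in> {0..1}" for x
    proof -
      have "theta_term (of_real x) t n = c n * (expi2 (of_int n * of_real x) * expi2 (of_real x / 2))" for n
      proof -
        have "t * (of_int n + 1/2)\<^sup>2 / 2 + of_real x * (of_int n + 1/2) =
            t * (of_int n + 1/2)\<^sup>2 / 2 + (of_int n * of_real x + of_real x / 2)"
          by (simp add: algebra_simps)
        then show ?thesis
          unfolding theta_term_def c_def by (simp only: expi2_add mult.assoc)
      qed
      then have "(\<Sum>n\<in>Y. theta_term (of_real x) t n) = expi2 (of_real x / 2) * F x"
        by (simp add: F_def sum_distrib_left mult_ac)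
      moreover have "norm (expi2 (of_real x / 2)) = 1"
        by (simp add: norm_expi2)
      moreover have "complex_of_real x \<in> cball 0 1" using x by simp
      ultimately show ?thesis
        using X(2)[OF Y(1,3)] C \<open>C = 0\<close> by (fastforce simp: norm_mult)
    qed
    have "((\<lambda>x. c n * expi2 (of_int n * of_real x)) has_integral (if n = 0 then c 0 else 0)) {0..1}" for n
    proof (cases "n = 0")
      case True
      then show ?thesis using has_integral_const_real[of "c 0" 0 1] by simp
    next
      case False
      have "((\<lambda>x::real. expi2 (of_int n * of_real x)) has_integral
          expi2 (of_int n * of_real 1) / (2 * of_real pi * \<i> * of_int n) - expi2 (of_int n * of_real 0) / (2 * of_real pi * \<i> * of_int n)) {0..1}"
      proof (rule fundamental_theorem_of_calculus)
        fix x :: real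
        have "((\<lambda>w. expi2 (of_int n * w) / (2 * of_real pi * \<i> * of_int n)) has_field_derivative expi2 (of_int n * of_real x)) (at (of_real x))"
          unfolding expi2_def using False by (auto intro!: derivative_eq_intros simp: mult_ac)
        from has_vector_derivative_real_field[OF this]
        show "((\<lambda>x. expi2 (of_int n * of_real x) / (2 * of_real pi * \<i> * of_int n)) has_vector_derivative expi2 (of_int n * of_real x)) (at x within {0..1})"
          by (rule has_vector_derivative_at_within)
      qed simp
      then have "((\<lambda>x::real. expi2 (of_int n * of_real x)) has_integral 0) {0..1}" by simp
      from has_integral_mult_right[OF this, of "c n"] False show ?thesis by simp
    qed
    then have "(F has_integral (\<Sum>n\<in>Y. if n = 0 then c 0 else 0)) {0..1}"
      unfolding F_def by (intro has_integral_sum Y)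
    then have "(F has_integral c 0) {0..1}"
      using Y by simp
    then have "norm (c 0) \<le> norm (c 0) / 2 * (1 - 0)"
      using has_integral_bound_real[of "norm (c 0) / 2" "{}" F "c 0" 0 1] F_le by simp
    with c0 show False by simp
  qed
  with C that show ?thesis by blast
qed

text \<open>The exponent (14 n + 7 - 2 k)^2 / 56 equals 7 (n + 1/2 - k/7)^2 / 2; expanding the
  square gives the theta series over the lattice of \<open>7 * t\<close> at minus k/7 times
  \<open>7 * t\<close>. The constant \<open>C\<close> is the same for all \<open>k\<close>.\<close>

lemma theta_a_eq_kl:
  assumes t: "Im t > 0"
  obtains C where "C \<noteq> 0" "\<And>k. theta_a k t = C * (-1) powi k * kl (of_int k / 7) 0 (7 * t)"
proof -
  have t7: "Im (7 * t) > 0" using t by simp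
  obtain C where C: "C \<noteq> 0" "\<And>z. theta_series z (7 * t) = C * sg z (7 * t)"
    using theta_series_proportional[OF t7] by blast
  have "theta_a k t = C * (-1) powi k * kl (of_int k / 7) 0 (7 * t)" for k
  proof -
    define r :: complex where "r = of_int k / 7"
    have "(-1) powi (n + k + 1) * exp (2 * of_real pi * \<i> * (of_int ((14 * n + 7 - 2 * k)\<^sup>2) / 56) * t) =
      (- ((-1) powi k) * expi2 (r\<^sup>2 * (7 * t) / 2)) * theta_term (- (r * (7 * t))) (7 * t) n" for n
    proof -
      have "exp (2 * of_real pi * \<i> * (of_int ((14 * n + 7 - 2 * k)\<^sup>2) / 56) * t) =
        expi2 (of_int ((14 * n + 7 - 2 * k)\<^sup>2) / 56 * t)"
        unfolding expi2_def by (rule arg_cong[of _ _ exp]) (simp only: mult_ac)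
      also have "of_int ((14 * n + 7 - 2 * k)\<^sup>2) / 56 * t =
        r\<^sup>2 * (7 * t) / 2 + (7 * t * (of_int n + 1/2)\<^sup>2 / 2 + - (r * (7 * t)) * (of_int n + 1/2))"
        unfolding r_def by (simp add: field_simps power2_eq_square)
      finally have 1: "exp (2 * of_real pi * \<i> * (of_int ((14 * n + 7 - 2 * k)\<^sup>2) / 56) * t) =
        expi2 (r\<^sup>2 * (7 * t) / 2) * expi2 (7 * t * (of_int n + 1/2)\<^sup>2 / 2 + - (r * (7 * t)) * (of_int n + 1/2))"
        by (simp only: expi2_add)
      have 2: "(-1) powi (n + k + 1) = - ((-1) powi k) * ((-1) powi n :: complex)"
        by (simp add: minus_one_powi_parity)
      show ?thesis
        unfolding theta_term_def 1 2 by (simp only: mult_ac)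
    qed
    then have "theta_a k t = (- ((-1) powi k) * expi2 (r\<^sup>2 * (7 * t) / 2)) * theta_series (- (r * (7 * t))) (7 * t)"
      unfolding theta_a_def theta_series_def by (simp only: infsum_cmult_right')
    also have "\<dots> = C * (-1) powi k * (expi2 (r\<^sup>2 * (7 * t) / 2) * sg (r * (7 * t)) (7 * t))"
      unfolding C(2) sg_minus[OF t7] by simp
    also have "expi2 (r\<^sup>2 * (7 * t) / 2) * sg (r * (7 * t)) (7 * t) = kl (of_int k / 7) 0 (7 * t)"
      unfolding kl_def r_def by (simp add: power2_eq_square mult_ac)
    finally show ?thesis .
  qed
  with C(1) that show ?thesis by blast
qed

section \<open>The cubic relation\<close>

lemma open_upper_half_plane [simp, intro]: "open upper_half_plane"
  unfolding upper_half_plane_def by (rule open_halfspace_Im_gt)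

lemma connected_upper_half_plane [simp, intro]: "connected upper_half_plane"
  unfolding upper_half_plane_def by (intro convex_connected convex_halfspace_Im_gt)

lemma in_upper_half_plane: "t \<in> upper_half_plane \<longleftrightarrow> Im t > 0"
  by (simp add: upper_half_plane_def)

lemma mer_outside [simp]: "t \<notin> upper_half_plane \<Longrightarrow> mer f t = 0"
  by (simp add: mer_def)

lemma mer_eq_holomorphic:
  assumes "g holomorphic_on upper_half_plane" "\<And>t. t \<in> upper_half_plane \<Longrightarrow> f t = g t"
    and "t \<in> upper_half_plane"
  shows "mer f t = g t"
proof -
  have "f holomorphic_on upper_half_plane"
    using assms(1,2) by (simp cong: holomorphic_cong)
  then have "f analytic_on {t}"
    using assms(3) by (meson holomorphic_on_imp_analytic_at open_upper_half_plane)
  then show ?thesis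
    using assms by (simp add: mer_def)
qed

text \<open>\<open>theta_a j\<close> up to the sign (-1)^j and a factor common to all
  \<open>j\<close>. The signs cancel in \<open>upsilon\<close>, and the minus sign in
  \<open>phi1\<close> absorbs them there.\<close>

definition V :: "int \<Rightarrow> complex \<Rightarrow> complex" where
  "V j t = kl (of_int j / 7) 0 (7 * t)"

text \<open>The forms of level 14, in which \<open>V j (2 * t)\<close> is a single form and
  \<open>V j t\<close> a product of two, up to a common factor. This turns \<open>upsilon\<close>
  and \<open>g1\<close> into monomials in \<open>W 1\<close> to \<open>W 6\<close>.\<close>

definition W :: "int \<Rightarrow> complex \<Rightarrow> complex" where
  "W j t = kl (of_int j / 14) 0 (14 * t)"

lemma of_int_divide_in_Ints_iff:
  assumes "m \<noteq> 0"
  shows "(of_int j / of_int m :: real) \<in> \<int> \<longleftrightarrow> m dvd j"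
proof
  assume "(of_int j / of_int m :: real) \<in> \<int>"
  then obtain n where "of_int j / of_int m = (of_int n :: real)" by (elim Ints_cases)
  then have "of_int j = (of_int (n * m) :: real)"
    using assms by (simp add: field_simps)
  then have "j = n * m" by (simp only: of_int_eq_iff)
  then show "m dvd j" by simp
qed (use assms in auto)

lemma V_nonzero: "Im t > 0 \<Longrightarrow> \<not> 7 dvd j \<Longrightarrow> V j t \<noteq> 0"
  using kl_eq_0_iff[of "7 * t" "of_int j / 7" 0] of_int_divide_in_Ints_iff[of 7 j] by (simp add: V_def)

lemma W_nonzero: "Im t > 0 \<Longrightarrow> \<not> 14 dvd j \<Longrightarrow> W j t \<noteq> 0"
  using kl_eq_0_iff[of "14 * t" "of_int j / 14" 0] of_int_divide_in_Ints_iff[of 14 j] by (simp add: W_def)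

lemma V_holomorphic: "V j holomorphic_on upper_half_plane"
  unfolding V_def by (rule holomorphic_on_kl) (auto intro!: holomorphic_intros simp: in_upper_half_plane)

lemma V_double: "V j (2 * t) = W (2 * j) t"
  by (simp add: V_def W_def)

lemma V_conv_W:
  assumes "Im t > 0"
  shows "V j t = expi2 (14 * t / 8) * W j t * W (7 - j) t"
proof -
  have *: "of_int (7 - j) / 14 = 1 / 2 - real_of_int j / 14" by (simp add: field_simps)
  show ?thesis
    unfolding W_def * using kl_split[of "7 * t" "of_int j / 14"] assms by (simp add: V_def)
qed

lemma upsilon_eq:
  assumes "Im t > 0"
  shows "upsilon t = (V 2 t)\<^sup>2 * V 3 t / (V 1 t) ^ 3"
  unfolding upsilon_def
proof (rule mer_eq_holomorphic)
  show "(\<lambda>t. (V 2 t)\<^sup>2 * V 3 t / (V 1 t) ^ 3) holomorphic_on upper_half_plane"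
    by (intro holomorphic_intros V_holomorphic) (simp add: in_upper_half_plane V_nonzero)
  fix t assume "t \<in> upper_half_plane"
  then have "Im t > 0" by (simp add: in_upper_half_plane)
  from theta_a_eq_kl[OF this] obtain C where C: "C \<noteq> 0"
    "\<And>k. theta_a k t = C * (-1) powi k * kl (of_int k / 7) 0 (7 * t)" by blast
  have "theta_a 1 t = - (C * V 1 t)" "theta_a 2 t = C * V 2 t" "theta_a 3 t = - (C * V 3 t)"
    using C(2)[of 1] C(2)[of 2] C(2)[of 3] by (simp_all add: V_def minus_one_powi_parity)
  then show "(theta_a 2 t)\<^sup>2 * theta_a 3 t / (theta_a 1 t) ^ 3 = (V 2 t)\<^sup>2 * V 3 t / (V 1 t) ^ 3"
    using C(1) V_nonzero[OF \<open>Im t > 0\<close>, of 1] by (simp add: field_simps power2_eq_square power3_eq_cube)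
qed (use assms in \<open>simp add: in_upper_half_plane\<close>)

lemma phi1_eq:
  assumes "Im t > 0"
  shows "phi1 t = V 3 t / V 2 t"
  unfolding phi1_def
proof (rule mer_eq_holomorphic)
  show "(\<lambda>t. V 3 t / V 2 t) holomorphic_on upper_half_plane"
    by (intro holomorphic_intros V_holomorphic) (simp add: in_upper_half_plane V_nonzero)
  fix t assume "t \<in> upper_half_plane"
  then have "Im t > 0" by (simp add: in_upper_half_plane)
  from theta_a_eq_kl[OF this] obtain C where C: "C \<noteq> 0"
    "\<And>k. theta_a k t = C * (-1) powi k * kl (of_int k / 7) 0 (7 * t)" by blast
  have "theta_a 2 t = C * V 2 t" "theta_a 3 t = - (C * V 3 t)"
    using C(2)[of 2] C(2)[of 3] by (simp_all add: V_def minus_one_powi_parity)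
  then show "- theta_a 3 t / theta_a 2 t = V 3 t / V 2 t"
    using C(1) by simp
qed (use assms in \<open>simp add: in_upper_half_plane\<close>)

lemma g1_eq:
  assumes "Im t > 0"
  shows "g1 t = (V 3 t / V 2 t)\<^sup>2 / (V 3 (2 * t) / V 2 (2 * t))"
  unfolding g1_def
proof (rule mer_eq_holomorphic)
  have "(\<lambda>t. V j (2 * t)) holomorphic_on upper_half_plane" for j
    unfolding V_def by (rule holomorphic_on_kl) (auto intro!: holomorphic_intros simp: in_upper_half_plane)
  then show "(\<lambda>t. (V 3 t / V 2 t)\<^sup>2 / (V 3 (2 * t) / V 2 (2 * t))) holomorphic_on upper_half_plane"
    by (intro holomorphic_intros V_holomorphic) (simp_all add: in_upper_half_plane V_nonzero)
qed (use assms in \<open>simp_all add: in_upper_half_plane phi1_eq\<close>)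

lemma upsilon_holomorphic: "upsilon holomorphic_on upper_half_plane"
  by (rule holomorphic_transform[of "\<lambda>t. (V 2 t)\<^sup>2 * V 3 t / (V 1 t) ^ 3"])
    (auto intro!: holomorphic_intros V_holomorphic simp: in_upper_half_plane V_nonzero upsilon_eq)

lemma g1_holomorphic: "g1 holomorphic_on upper_half_plane"
proof (rule holomorphic_transform[of "\<lambda>t. (V 3 t / V 2 t)\<^sup>2 / (V 3 (2 * t) / V 2 (2 * t))"])
  have "(\<lambda>t. V j (2 * t)) holomorphic_on upper_half_plane" for j
    unfolding V_def by (rule holomorphic_on_kl) (auto intro!: holomorphic_intros simp: in_upper_half_plane)
  then show "(\<lambda>t. (V 3 t / V 2 t)\<^sup>2 / (V 3 (2 * t) / V 2 (2 * t))) holomorphic_on upper_half_plane"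
    by (intro holomorphic_intros V_holomorphic) (simp_all add: in_upper_half_plane V_nonzero)
qed (simp add: in_upper_half_plane g1_eq)

lemma upsilon_nonzero: "Im t > 0 \<Longrightarrow> upsilon t \<noteq> 0"
  by (simp add: upsilon_eq V_nonzero)

lemma g1_nonzero: "Im t > 0 \<Longrightarrow> g1 t \<noteq> 0"
  by (simp add: g1_eq V_nonzero)

section \<open>Symmetries and three-term relations at the levels 7 and 14\<close>

lemma W_reflect: "Im t > 0 \<Longrightarrow> W (14 - j) t = W j t"
  using kl_one_minus[of "14 * t" "of_int j / 14"] by (simp add: W_def diff_divide_distrib)

lemma W_minus: "Im t > 0 \<Longrightarrow> W (- j) t = - W j t"
  using kl_minus[of "14 * t" "of_int j / 14" 0] by (simp add: W_def)

lemma V_reflect: "Im t > 0 \<Longrightarrow> V (7 - j) t = V j t"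
  using kl_one_minus[of "7 * t" "of_int j / 7"] by (simp add: V_def diff_divide_distrib)

lemma V_minus: "Im t > 0 \<Longrightarrow> V (- j) t = - V j t"
  using kl_minus[of "7 * t" "of_int j / 7" 0] by (simp add: V_def)

text \<open>The parameters are halved so that half-integral arguments are covered.\<close>

lemma W_three_term:
  assumes t: "Im t > 0" and nz: "\<not> 14 dvd y" "\<not> 28 dvd (z + y)" "\<not> 28 dvd (z - y)"
    and ev: "even (x + y)" "even (x + z)" "even (x + w)"
  shows "W ((x + y) div 2) t * W ((x - y) div 2) t * (W ((z + w) div 2) t * W ((z - w) div 2) t) +
         W ((x + z) div 2) t * W ((x - z) div 2) t * (W ((w + y) div 2) t * W ((w - y) div 2) t) +
         W ((x + w) div 2) t * W ((x - w) div 2) t * (W ((y + z) div 2) t * W ((y - z) div 2) t) = 0"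
proof -
  have W: "W (n div 2) t = kl (of_int n / 28) 0 (14 * t)" if "even n" for n
    using that by (elim evenE) (simp add: W_def)
  have ev': "even (x - y)" "even (z + w)" "even (z - w)" "even (x - z)" "even (w + y)" "even (w - y)"
    "even (x - w)" "even (y + z)" "even (y - z)"
    using ev by presburger+
  have i: "(2 * (of_int y / 28) :: real) \<notin> \<int>" "(of_int z / 28 + of_int y / 28 :: real) \<notin> \<int>"
    "(of_int z / 28 - of_int y / 28 :: real) \<notin> \<int>"
    using nz of_int_divide_in_Ints_iff[of 14 y] of_int_divide_in_Ints_iff[of 28 "z + y"]
      of_int_divide_in_Ints_iff[of 28 "z - y"]
    by (simp_all add: add_divide_distrib diff_divide_distrib)
  have t14: "Im (14 * t) > 0" using t by simp
  show ?thesis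
    using kl_three_term[OF t14 i, of "of_int x / 28" "of_int w / 28"]
    unfolding ev [THEN W] ev' [THEN W]
    by (simp add: add_divide_distrib [symmetric] diff_divide_distrib [symmetric])
qed

lemma V_three_term:
  assumes t: "Im t > 0" and nz: "\<not> 7 dvd 2 * y" "\<not> 7 dvd (z + y)" "\<not> 7 dvd (z - y)"
  shows "V (x + y) t * V (x - y) t * (V (z + w) t * V (z - w) t) +
         V (x + z) t * V (x - z) t * (V (w + y) t * V (w - y) t) +
         V (x + w) t * V (x - w) t * (V (y + z) t * V (y - z) t) = 0"
proof -
  have i: "(2 * (of_int y / 7) :: real) \<notin> \<int>" "(of_int z / 7 + of_int y / 7 :: real) \<notin> \<int>"
    "(of_int z / 7 - of_int y / 7 :: real) \<notin> \<int>"
    using nz of_int_divide_in_Ints_iff[of 7 "2 * y"] of_int_divide_in_Ints_iff[of 7 "z + y"]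
      of_int_divide_in_Ints_iff[of 7 "z - y"]
    by (simp_all add: add_divide_distrib diff_divide_distrib)
  have t7: "Im (7 * t) > 0" using t by simp
  show ?thesis
    using kl_three_term[OF t7 i, of "of_int x / 7" "of_int w / 7"]
    by (simp add: V_def add_divide_distrib [symmetric] diff_divide_distrib [symmetric])
qed

text \<open>The parameters are chosen so that, after reflection, all indices lie between 1 and 7,
  and so that each right-hand side turns a sum or difference needed in
  \<open>cubic_relation_aux\<close> into a monomial.\<close>

lemma W_relations:
  assumes t: "Im t > 0"
  shows "W 3 t * W 4 t * W 5 t * W 6 t - W 1 t * W 2 t * W 3 t * W 4 t = W 2 t * W 5 t * W 6 t * W 7 t"
    and "W 2 t * W 5 t * W 5 t * W 6 t + W 1 t * W 2 t * W 2 t * W 5 t = W 3 t * W 4 t * W 4 t * W 7 t"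
    and "W 2 t * W 2 t * W 3 t * W 5 t - W 1 t * W 1 t * W 2 t * W 6 t = W 1 t * W 3 t * W 4 t * W 4 t"
    and "W 2 t * W 4 t * W 5 t * W 5 t - W 1 t * W 3 t * W 4 t * W 4 t = W 1 t * W 5 t * W 6 t * W 6 t"
proof -
  have m: "W (-1) t = - W 1 t" "W (-2) t = - W 2 t" "W (-3) t = - W 3 t" "W (-4) t = - W 4 t"
    "W (-5) t = - W 5 t" "W (-6) t = - W 6 t" "W (-7) t = - W 7 t"
    using W_minus[OF t, of 1] W_minus[OF t, of 2] W_minus[OF t, of 3] W_minus[OF t, of 4]
      W_minus[OF t, of 5] W_minus[OF t, of 6] W_minus[OF t, of 7] by simp_all
  have r: "W 8 t = W 6 t" "W 9 t = W 5 t" "W 10 t = W 4 t" "W 11 t = W 3 t" "W 12 t = W 2 t"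
    using W_reflect[OF t, of 6] W_reflect[OF t, of 5] W_reflect[OF t, of 4] W_reflect[OF t, of 3]
      W_reflect[OF t, of 2] by simp_all
  show "W 3 t * W 4 t * W 5 t * W 6 t - W 1 t * W 2 t * W 3 t * W 4 t = W 2 t * W 5 t * W 6 t * W 7 t"
    using W_three_term[OF t, of 9 5 1 11] by (simp add: m r algebra_simps)
  show "W 2 t * W 5 t * W 5 t * W 6 t + W 1 t * W 2 t * W 2 t * W 5 t = W 3 t * W 4 t * W 4 t * W 7 t"
    using W_three_term[OF t, of 4 8 0 10] by (simp add: m r algebra_simps)
  show "W 2 t * W 2 t * W 3 t * W 5 t - W 1 t * W 1 t * W 2 t * W 6 t = W 1 t * W 3 t * W 4 t * W 4 t"
    using W_three_term[OF t, of 4 2 0 8] by (simp add: m r algebra_simps)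
  show "W 2 t * W 4 t * W 5 t * W 5 t - W 1 t * W 3 t * W 4 t * W 4 t = W 1 t * W 5 t * W 6 t * W 6 t"
    using W_three_term[OF t, of 10 8 0 12] by (simp add: m r algebra_simps)
qed

text \<open>Klein's quartic x^3 y + y^3 z + z^3 x = 0 with x = \<open>V 2 t\<close>, y =
  \<open>V 3 t\<close>, z = - \<open>V 1 t\<close>.\<close>

lemma V_relation:
  assumes t: "Im t > 0"
  shows "(V 2 t) ^ 3 * V 3 t - (V 1 t) ^ 3 * V 2 t = (V 3 t) ^ 3 * V 1 t"
proof -
  have m: "V (-1) t = - V 1 t" "V (-2) t = - V 2 t" "V (-3) t = - V 3 t"
    using V_minus[OF t, of 1] V_minus[OF t, of 2] V_minus[OF t, of 3] by simp_all
  have r: "V 4 t = V 3 t" "V 5 t = V 2 t"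
    using V_reflect[OF t, of 3] V_reflect[OF t, of 2] by simp_all
  show ?thesis
    using V_three_term[OF t, of 2 1 0 3] by (simp add: m r algebra_simps power3_eq_cube)
qed

text \<open>Each relation exhibits one of the differences as a monomial in the \<open>k\<close>s.
  Then a single comparison of monomials contains the cubic.\<close>

lemma cubic_relation_aux:
  fixes k1 k2 k3 k4 k5 k6 k7 u g :: complex
  assumes nz: "k1 \<noteq> 0" "k2 \<noteq> 0" "k3 \<noteq> 0" "k4 \<noteq> 0" "k5 \<noteq> 0" "k6 \<noteq> 0" "k7 \<noteq> 0"
    and r1: "k3 * k4 * k5 * k6 - k1 * k2 * k3 * k4 = k2 * k5 * k6 * k7"
    and r2: "k2 * k5 * k5 * k6 + k1 * k2 * k2 * k5 = k3 * k4 * k4 * k7"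
    and r3: "k2 * k2 * k3 * k5 - k1 * k1 * k2 * k6 = k1 * k3 * k4 * k4"
    and r4: "k2 * k4 * k5 * k5 - k1 * k3 * k4 * k4 = k1 * k5 * k6 * k6"
    and r5: "(k2 * k5) ^ 3 * (k3 * k4) - (k1 * k6) ^ 3 * (k2 * k5) = (k3 * k4) ^ 3 * (k1 * k6)"
    and u: "u = (k2 * k5)\<^sup>2 * (k3 * k4) / (k1 * k6) ^ 3"
    and g: "g = k3\<^sup>2 * k4 ^ 3 / (k2\<^sup>2 * k5\<^sup>2 * k6)"
  shows "u * g ^ 3 + u * g\<^sup>2 - (u\<^sup>2 - 1) * g + (u - 1)\<^sup>2 = 0"
proof -
  \<comment> \<open>These are \<open>u - 1\<close>, \<open>u - g - 1\<close>, \<open>u - g\<^sup>2 - g - 1\<close> and \<open>(g \<mp> 1) / 2\<close>: all are modular units.\<close>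
  define P1 P2 where "P1 = k3 ^ 3 * k4 ^ 5 / (k1 * k2 ^ 3 * k5\<^sup>2 * k6\<^sup>2)" "P2 = k3 ^ 3 * k4 ^ 4 / (k2 ^ 4 * k5 ^ 3)"
  define N1 N2 where "N1 = k1 * k3 * k4 / (k5 * k6 * k7)" "N2 = k3 * k4 / (k2 * k7)"
  define M where "M = k3 ^ 3 * k4 ^ 3 / (k1\<^sup>2 * k6\<^sup>2 * k2 * k5)"
  have M: "u - 1 = M"
  proof -
    have "u - 1 = ((k2 * k5) ^ 3 * (k3 * k4) - (k1 * k6) ^ 3 * (k2 * k5)) / ((k1 * k6) ^ 3 * (k2 * k5))"
      using nz by (simp add: u field_simps power2_eq_square power3_eq_cube)
    also have "\<dots> = M"
      unfolding r5 M_def using nz by (simp add: field_simps power2_eq_square power3_eq_cube)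
    finally show ?thesis .
  qed
  have P1: "u - g - 1 = P1"
  proof -
    have "M - g = (k2 * k2 * k3 * k5 - k1 * k1 * k2 * k6) * (k3\<^sup>2 * k4 ^ 3 / (k1\<^sup>2 * k2 ^ 3 * k5\<^sup>2 * k6\<^sup>2))"
      using nz by (simp add: M_def g field_simps power2_eq_square power3_eq_cube)
    also have "\<dots> = P1"
      unfolding r3 P1_P2_def using nz by (simp add: field_simps eval_nat_numeral)
    finally show ?thesis using M by (simp add: algebra_simps)
  qed
  have P2: "P1 - g\<^sup>2 = P2"
  proof -
    have "P1 - g\<^sup>2 = (k2 * k4 * k5 * k5 - k1 * k3 * k4 * k4) * (k3 ^ 3 * k4 ^ 4 / (k1 * k2 ^ 4 * k5 ^ 4 * k6\<^sup>2))"
      using nz by (simp add: P1_P2_def g field_simps eval_nat_numeral)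
    also have "\<dots> = P2"
      unfolding r4 P1_P2_def using nz by (simp add: field_simps eval_nat_numeral)
    finally show ?thesis .
  qed
  have "N2 - N1 = (k3 * k4 * k5 * k6 - k1 * k2 * k3 * k4) / (k2 * k5 * k6 * k7)"
    using nz by (simp add: N1_N2_def field_simps)
  then have N: "N2 - N1 = 1"
    unfolding r1 using nz by simp
  have "N2 + N1 = (k2 * k5 * k5 * k6 + k1 * k2 * k2 * k5) * (k3 * k4 / (k2\<^sup>2 * k5\<^sup>2 * k6 * k7))"
    using nz by (simp add: N1_N2_def field_simps power2_eq_square)
  then have N': "N2 + N1 = g"
    unfolding r2 g using nz by (simp add: field_simps eval_nat_numeral)
  \<comment> \<open>Only a count of exponents: both sides are the same monomial.\<close>
  have "P1 * P2 * N1 = N2 * g ^ 3"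
    using nz by (simp add: P1_P2_def N1_N2_def g field_simps eval_nat_numeral)
  moreover have "N1 = (g - 1) / 2" "N2 = (g + 1) / 2"
    using N N' by (simp_all add: field_simps)
  moreover have "P2 = u - g - 1 - g\<^sup>2"
    using P1 P2 by simp
  ultimately have "(u - g - 1) * (u - g - 1 - g\<^sup>2) * (g - 1) = (g + 1) * g ^ 3"
    using P1 by simp
  moreover have "u * g ^ 3 + u * g\<^sup>2 - (u\<^sup>2 - 1) * g + (u - 1)\<^sup>2 =
      (g + 1) * g ^ 3 - (u - g - 1) * (u - g - 1 - g\<^sup>2) * (g - 1)"
    by (simp add: algebra_simps eval_nat_numeral)
  ultimately show ?thesis by simp
qed

theorem upsilon_g1_relation:
  assumes t: "Im t > 0"
  shows "upsilon t * g1 t ^ 3 + upsilon t * (g1 t)\<^sup>2 - ((upsilon t)\<^sup>2 - 1) * g1 t + (upsilon t - 1)\<^sup>2 = 0"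
proof (rule cubic_relation_aux[OF _ _ _ _ _ _ _ W_relations[OF t]])
  define E where "E = expi2 (14 * t / 8)"
  have E: "E \<noteq> 0" by (simp add: E_def)
  have V: "V 1 t = E * (W 1 t * W 6 t)" "V 2 t = E * (W 2 t * W 5 t)" "V 3 t = E * (W 3 t * W 4 t)"
    using V_conv_W[OF t, of 1] V_conv_W[OF t, of 2] V_conv_W[OF t, of 3] by (simp_all add: E_def)
  \<comment> \<open>The quartic is homogeneous of degree 4, so the common factor \<open>E\<close>
    drops out.\<close>
  have "E ^ 4 * ((W 2 t * W 5 t) ^ 3 * (W 3 t * W 4 t) - (W 1 t * W 6 t) ^ 3 * (W 2 t * W 5 t)) =
      E ^ 4 * ((W 3 t * W 4 t) ^ 3 * (W 1 t * W 6 t))"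
    using V_relation[OF t] unfolding V by (simp add: power_mult_distrib eval_nat_numeral algebra_simps)
  then show "(W 2 t * W 5 t) ^ 3 * (W 3 t * W 4 t) - (W 1 t * W 6 t) ^ 3 * (W 2 t * W 5 t) =
      (W 3 t * W 4 t) ^ 3 * (W 1 t * W 6 t)"
    using E by simp
  show "upsilon t = (W 2 t * W 5 t)\<^sup>2 * (W 3 t * W 4 t) / (W 1 t * W 6 t) ^ 3"
    unfolding upsilon_eq[OF t] V using E by (simp add: power_mult_distrib eval_nat_numeral mult_ac)
  show "g1 t = (W 3 t)\<^sup>2 * W 4 t ^ 3 / ((W 2 t)\<^sup>2 * (W 5 t)\<^sup>2 * W 6 t)"
    unfolding g1_eq[OF t] V_double V using E W_nonzero[OF t, of 4]
    by (simp add: power_mult_distrib eval_nat_numeral mult_ac)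
qed (use t in \<open>simp_all add: W_nonzero\<close>)

section \<open>The action of the modular group\<close>

definition mat2 :: "int \<Rightarrow> int \<Rightarrow> int \<Rightarrow> int \<Rightarrow> int ^ 2 ^ 2" where
  "mat2 a b c d = vector [vector [a, b], vector [c, d]]"

abbreviation ea :: "int ^ 2 ^ 2 \<Rightarrow> int" where "ea A \<equiv> A $ 1 $ 1"
abbreviation eb :: "int ^ 2 ^ 2 \<Rightarrow> int" where "eb A \<equiv> A $ 1 $ 2"
abbreviation ec :: "int ^ 2 ^ 2 \<Rightarrow> int" where "ec A \<equiv> A $ 2 $ 1"
abbreviation ed :: "int ^ 2 ^ 2 \<Rightarrow> int" where "ed A \<equiv> A $ 2 $ 2"

lemma mat2_nth [simp]: "ea (mat2 a b c d) = a" "eb (mat2 a b c d) = b"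
    "ec (mat2 a b c d) = c" "ed (mat2 a b c d) = d"
  unfolding mat2_def by simp_all

lemma mat2_eq_iff: "A = B \<longleftrightarrow> (ea A) = (ea B) \<and> (eb A) = (eb B) \<and> (ec A) = (ec B) \<and> (ed A) = (ed B)"
  for A B :: "int ^ 2 ^ 2"
  unfolding vec_eq_iff forall_2 by blast

lemma mult_nth [simp]:
  fixes A B :: "int ^ 2 ^ 2"
  shows "ea (A ** B) = ea A * ea B + eb A * ec B" "eb (A ** B) = ea A * eb B + eb A * ed B"
    "ec (A ** B) = ec A * ea B + ed A * ec B" "ed (A ** B) = ec A * eb B + ed A * ed B"
  by (simp_all add: matrix_matrix_mult_def sum_2)

lemma one_nth [simp]: "ea (mat 1) = 1" "eb (mat 1) = 0" "ec (mat 1) = 0" "ed (mat 1) = 1"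
  by (simp_all add: mat_def)

lemma SL2Z_iff: "A \<in> SL2Z \<longleftrightarrow> (ea A) * (ed A) - (eb A) * (ec A) = 1"
  by (simp add: SL2Z_def det_2)

lemma mat2_in_SL2Z [simp]: "mat2 a b c d \<in> SL2Z \<longleftrightarrow> a * d - b * c = 1"
  by (simp add: SL2Z_iff)

lemma SL2Z_mult [simp]: "A \<in> SL2Z \<Longrightarrow> B \<in> SL2Z \<Longrightarrow> A ** B \<in> SL2Z"
  by (simp add: SL2Z_def det_mul)

definition inv2 :: "int ^ 2 ^ 2 \<Rightarrow> int ^ 2 ^ 2" where
  "inv2 A = mat2 ((ed A)) (- (eb A)) (- (ec A)) ((ea A))"

lemma inv2_nth [simp]: "(ea (inv2 A)) = (ed A)" "(eb (inv2 A)) = - (eb A)"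
  "(ec (inv2 A)) = - (ec A)" "(ed (inv2 A)) = (ea A)"
  by (simp_all add: inv2_def)

lemma inv2_SL2Z [simp]: "A \<in> SL2Z \<Longrightarrow> inv2 A \<in> SL2Z"
  by (simp add: SL2Z_iff algebra_simps)

lemma inv2_mult: "A \<in> SL2Z \<Longrightarrow> inv2 A ** A = mat 1" "A \<in> SL2Z \<Longrightarrow> A ** inv2 A = mat 1"
  by (simp_all add: mat2_eq_iff SL2Z_iff algebra_simps)

lemma one_in_SL2Z [simp]: "mat 1 \<in> SL2Z"
  by (simp add: SL2Z_iff)

section \<open>Moebius transformations of the upper half-plane\<close>

lemma act_eq: "act A t = (of_int ((ea A)) * t + of_int ((eb A))) / (of_int ((ec A)) * t + of_int ((ed A)))"
  by (simp add: act_def moebius_def)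

lemma act_one [simp]: "act (mat 1) t = t"
  by (simp add: act_eq)

lemma act_denom_nonzero:
  assumes "A \<in> SL2Z" "t \<in> upper_half_plane"
  shows "of_int ((ec A)) * t + of_int ((ed A)) \<noteq> (0 :: complex)"
  using moebius_denom_nonzero[of t "(ea A)" "(ed A)" "(eb A)" "(ec A)"] assms
  by (simp add: SL2Z_iff in_upper_half_plane)

lemma Im_act:
  assumes "A \<in> SL2Z" "t \<in> upper_half_plane"
  shows "Im (act A t) = Im t / (norm (of_int ((ec A)) * t + of_int ((ed A))))\<^sup>2"
  using Im_moebius[of t "(ea A)" "(ed A)" "(eb A)" "(ec A)"] assms
  by (simp add: SL2Z_iff in_upper_half_plane act_eq)

lemma act_in_upper_half_plane [simp]:
  assumes "A \<in> SL2Z" "t \<in> upper_half_plane"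
  shows "act A t \<in> upper_half_plane"
  using assms Im_act[OF assms] act_denom_nonzero[OF assms] by (simp add: in_upper_half_plane)

lemma act_mult:
  assumes A: "A \<in> SL2Z" and B: "B \<in> SL2Z" and t: "t \<in> upper_half_plane"
  shows "act (A ** B) t = act A (act B t)"
proof -
  define j where "j = of_int ((ec B)) * t + of_int ((ed B))"
  have j: "j \<noteq> 0" unfolding j_def by (rule act_denom_nonzero[OF B t])
  have "of_int (ea A) * act B t + of_int (eb A) = (of_int (ea (A ** B)) * t + of_int (eb (A ** B))) / j"
    "of_int (ec A) * act B t + of_int (ed A) = (of_int (ec (A ** B)) * t + of_int (ed (A ** B))) / j"
    using j unfolding act_eq j_def [symmetric]
    by (simp add: field_simps, simp add: j_def algebra_simps)+
  then show ?thesis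
    unfolding act_eq[of A] using j by (simp add: act_eq)
qed

lemma act_inv2 [simp]:
  assumes "A \<in> SL2Z" "t \<in> upper_half_plane"
  shows "act (inv2 A) (act A t) = t" "act A (act (inv2 A) t) = t"
  using act_mult[of "inv2 A" A t] act_mult[of A "inv2 A" t] inv2_mult assms by simp_all

lemma act_holomorphic:
  assumes "A \<in> SL2Z"
  shows "act A holomorphic_on upper_half_plane"
proof -
  have "(\<lambda>t. (of_int ((ea A)) * t + of_int ((eb A))) / (of_int ((ec A)) * t + of_int ((ed A))))
      holomorphic_on upper_half_plane"
    using act_denom_nonzero[OF assms] by (intro holomorphic_intros) auto
  then show ?thesis
    by (simp add: act_eq[abs_def])
qed

lemma filterlim_act_at:
  assumes A: "A \<in> SL2Z" and z: "z \<in> upper_half_plane"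
  shows "filterlim (act A) (at (act A z)) (at z)"
proof (rule filterlim_atI)
  have "continuous (at z) (act A)"
    using holomorphic_on_imp_continuous_on[OF act_holomorphic[OF A]] z
    by (simp add: continuous_on_eq_continuous_at)
  then show "(act A \<longlongrightarrow> act A z) (at z)"
    by (simp add: isCont_def)
  have "eventually (\<lambda>w. w \<in> upper_half_plane - {z}) (at z)"
    using z by (intro eventually_at_in_open) auto
  then show "eventually (\<lambda>w. act A w \<noteq> act A z) (at z)"
    by eventually_elim (metis A DiffD1 DiffD2 act_inv2(1) insertI1 z)
qed

text \<open>Equality of the punctured neighbourhood filters makes removal of singularities commute
  with the action; see \<open>mer_act\<close>.\<close>

lemma filtermap_act_at:
  assumes A: "A \<in> SL2Z" and z: "z \<in> upper_half_plane"
  shows "filtermap (act A) (at z) = at (act A z)"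
proof (rule antisym)
  show "filtermap (act A) (at z) \<le> at (act A z)"
    using filterlim_act_at[OF A z] by (simp add: filterlim_def)
  have "filterlim (act (inv2 A)) (at z) (at (act A z))"
    using filterlim_act_at[of "inv2 A" "act A z"] A z by simp
  then have "filtermap (act A) (filtermap (act (inv2 A)) (at (act A z))) \<le> filtermap (act A) (at z)"
    by (intro filtermap_mono) (simp add: filterlim_def)
  moreover have "filtermap (act A) (filtermap (act (inv2 A)) (at (act A z))) = filtermap (\<lambda>w. w) (at (act A z))"
    unfolding filter_eq_iff eventually_filtermap
  proof (intro allI eventually_subst)
    fix P
    have "eventually (\<lambda>w. w \<in> upper_half_plane - {act A z}) (at (act A z))"
      using A z by (intro eventually_at_in_open) auto
    then show "\<forall>\<^sub>F w in at (act A z). P (act A (act (inv2 A) w)) = P w"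
      by eventually_elim (use A in auto)
  qed
  ultimately show "at (act A z) \<le> filtermap (act A) (at z)"
    by (simp add: filtermap_ident)
qed

abbreviation HH :: "complex set" where "HH \<equiv> upper_half_plane"

section \<open>Normalised representatives of meromorphic functions\<close>

lemma mer_cong:
  assumes "\<forall>\<^sub>\<approx>z\<in>HH. f z = g z"
  shows "mer f = mer g"
proof
  fix z show "mer f z = mer g z"
    using assms unfolding mer_def
    by (auto intro!: remove_sings_cong simp: eventually_cosparse_open_eq)
qed

lemma mer_ae:
  assumes "f meromorphic_on HH"
  shows "\<forall>\<^sub>\<approx>z\<in>HH. mer f z = f z"
proof -
  have "\<forall>\<^sub>\<approx>z\<in>HH. z \<in> HH" by (rule eventually_in_cosparse) auto
  with eventually_remove_sings_eq[OF assms] show ?thesis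
    by eventually_elim (simp add: mer_def)
qed

lemma mer_nicely:
  assumes "f meromorphic_on HH"
  shows "mer f nicely_meromorphic_on HH"
proof -
  have "remove_sings f nicely_meromorphic_on HH"
    by (rule remove_sings_nicely_meromorphic[OF assms])
  moreover have ev: "eventually (\<lambda>w. remove_sings f w = mer f w) (at z)" if "z \<in> HH" for z
    using eventually_at_in_open'[OF open_upper_half_plane that] by eventually_elim (simp add: mer_def)
  ultimately show ?thesis
    unfolding nicely_meromorphic_on_def
  proof (elim conjE, intro conjI ballI)
    assume "remove_sings f meromorphic_on HH"
    then show "mer f meromorphic_on HH"
      using meromorphic_on_cong[of HH "remove_sings f" "mer f" HH] ev by blast
  next
    fix z assume *: "\<forall>z\<in>HH. is_pole (remove_sings f) z \<and> remove_sings f z = 0 \<or> remove_sings f \<midarrow>z\<rightarrow> remove_sings f z"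
      and z: "z \<in> HH"
    have "is_pole (remove_sings f) z \<longleftrightarrow> is_pole (mer f) z"
      by (rule is_pole_cong[OF ev[OF z]]) simp
    moreover have "remove_sings f \<midarrow>z\<rightarrow> c \<longleftrightarrow> mer f \<midarrow>z\<rightarrow> c" for c
      by (rule tendsto_cong[OF ev[OF z]])
    moreover have "mer f z = remove_sings f z" using z by (simp add: mer_def)
    ultimately show "is_pole (mer f) z \<and> mer f z = 0 \<or> mer f \<midarrow>z\<rightarrow> mer f z"
      using * z by metis
  qed
qed

lemma mer_meromorphic [meromorphic_intros]: "f meromorphic_on HH \<Longrightarrow> mer f meromorphic_on HH"
  using mer_nicely by (auto simp: nicely_meromorphic_on_def)

lemma mer_ident:
  assumes "f nicely_meromorphic_on HH" "\<And>z. z \<notin> HH \<Longrightarrow> f z = 0"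
  shows "mer f = f"
proof
  fix z show "mer f z = f z"
  proof (cases "z \<in> HH")
    case True
    then have "is_pole f z \<and> f z = 0 \<or> f \<midarrow>z\<rightarrow> f z"
      using assms by (auto simp: nicely_meromorphic_on_def)
    then show ?thesis
      using True by (auto simp: mer_def)
  qed (use assms in auto)
qed

lemma mer_act:
  assumes "A \<in> SL2Z" "t \<in> HH"
  shows "mer f (act A t) = mer (\<lambda>t. f (act A t)) t"
  using remove_sings_compose[OF filtermap_act_at[OF assms], of f] assms by (simp add: mer_def o_def)

lemma meromorphic_act:
  assumes f: "f meromorphic_on HH" and A: "A \<in> SL2Z"
  shows "(\<lambda>t. f (act A t)) meromorphic_on HH"
proof (rule meromorphic_on_compose[OF f])
  show "act A analytic_on HH"
    using act_holomorphic[OF A] by (simp add: analytic_on_open)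
qed (use A in auto)

section \<open>The field of modular functions\<close>

lemma meromorphic_at_0_power:
  assumes "F meromorphic_on {0}" "k > 0"
  shows "(\<lambda>x. F (x ^ k)) meromorphic_on {0}"
  using assms by (intro meromorphic_on_compose[OF assms(1)]) (auto intro!: analytic_intros)

text \<open>Expansions of widths \<open>h\<close> and \<open>h'\<close> are both rewritten in the
  parameter of the common width \<open>h * h'\<close>.\<close>

lemma meromorphic_at_ii_inf_binop:
  assumes f: "meromorphic_at_ii_inf f" and g: "meromorphic_at_ii_inf g"
    and op: "\<And>F G. F meromorphic_on {0} \<Longrightarrow> G meromorphic_on {0} \<Longrightarrow> (\<lambda>x. op (F x) (G x)) meromorphic_on {0}"
  shows "meromorphic_at_ii_inf (\<lambda>t. op (f t) (g t))"
proof -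
  obtain h F c where h: "h > (0::nat)" "F meromorphic_on {0}"
    "\<And>t. Im t > c \<Longrightarrow> f t = F (exp (2 * of_real pi * \<i> * t / of_nat h))"
    using f unfolding meromorphic_at_ii_inf_def by blast
  obtain h' G c' where h': "h' > (0::nat)" "G meromorphic_on {0}"
    "\<And>t. Im t > c' \<Longrightarrow> g t = G (exp (2 * of_real pi * \<i> * t / of_nat h'))"
    using g unfolding meromorphic_at_ii_inf_def by blast
  have e: "exp (2 * of_real pi * \<i> * t / of_nat h) = exp (2 * of_real pi * \<i> * t / of_nat (h * h')) ^ h'"
    "exp (2 * of_real pi * \<i> * t / of_nat h') = exp (2 * of_real pi * \<i> * t / of_nat (h * h')) ^ h" for t
    using h(1) h'(1) by (simp_all add: exp_of_nat_mult [symmetric])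
  show ?thesis
    unfolding meromorphic_at_ii_inf_def
  proof (intro exI conjI allI impI)
    show "h * h' > 0" using h h' by simp
    show "(\<lambda>x. op (F (x ^ h')) (G (x ^ h))) meromorphic_on {0}"
      using h h' by (intro op meromorphic_at_0_power)
    fix t assume "Im t > max c c'"
    then show "op (f t) (g t) = (\<lambda>x. op (F (x ^ h')) (G (x ^ h))) (exp (2 * of_real pi * \<i> * t / of_nat (h * h')))"
      using h(3)[of t] h'(3)[of t] by (simp only: e)
  qed
qed

lemma meromorphic_at_ii_inf_const: "meromorphic_at_ii_inf (\<lambda>_. c)"
  unfolding meromorphic_at_ii_inf_def by (intro exI[of _ 1] exI[of _ "\<lambda>_. c"]) auto

lemma meromorphic_at_ii_inf_add:
  "meromorphic_at_ii_inf f \<Longrightarrow> meromorphic_at_ii_inf g \<Longrightarrow> meromorphic_at_ii_inf (\<lambda>t. f t + g t)"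
  by (rule meromorphic_at_ii_inf_binop) (auto intro!: meromorphic_intros)

lemma meromorphic_at_ii_inf_mult:
  "meromorphic_at_ii_inf f \<Longrightarrow> meromorphic_at_ii_inf g \<Longrightarrow> meromorphic_at_ii_inf (\<lambda>t. f t * g t)"
  by (rule meromorphic_at_ii_inf_binop) (auto intro!: meromorphic_intros)

lemma meromorphic_at_ii_inf_divide:
  "meromorphic_at_ii_inf f \<Longrightarrow> meromorphic_at_ii_inf g \<Longrightarrow> meromorphic_at_ii_inf (\<lambda>t. f t / g t)"
  by (rule meromorphic_at_ii_inf_binop) (auto intro!: meromorphic_intros)

lemma meromorphic_at_ii_inf_cong:
  assumes "meromorphic_at_ii_inf f" "eventually (\<lambda>t. f t = g t) at_ii_inf"
  shows "meromorphic_at_ii_inf g"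
proof -
  obtain c' where c': "\<And>t. Im t > c' \<Longrightarrow> f t = g t"
    using assms(2) unfolding eventually_at_ii_inf by blast
  obtain h F c where "h > (0::nat)" "F meromorphic_on {0}"
    "\<And>t. Im t > c \<Longrightarrow> f t = F (exp (2 * of_real pi * \<i> * t / of_nat h))"
    using assms(1) unfolding meromorphic_at_ii_inf_def by blast
  then show ?thesis
    unfolding meromorphic_at_ii_inf_def
    by (intro exI[of _ h] exI[of _ F] exI[of _ "max c c'"]) (auto simp: c' [symmetric])
qed

text \<open>The singularity of \<open>F\<close> at 0 is isolated, so no poles lie above a certain
  height. This later confines the poles to a compact set in \<open>kill_poles\<close>.\<close>

lemma meromorphic_at_ii_inf_analytic:
  assumes "meromorphic_at_ii_inf f"
  shows "eventually (\<lambda>t. f analytic_on {t}) at_ii_inf"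
proof -
  obtain h F c where h: "h > (0::nat)" "F meromorphic_on {0}"
    "\<And>t. Im t > c \<Longrightarrow> f t = F (exp (2 * of_real pi * \<i> * t / of_nat h))"
    using assms unfolding meromorphic_at_ii_inf_def by blast
  have "isolated_singularity_at F 0"
    using h(2) by (simp add: meromorphic_at_iff)
  then obtain r where r: "r > 0" "F analytic_on ball 0 r - {0}"
    by (auto simp: isolated_singularity_at_def)
  have "((\<lambda>t. expi2 (of_real (1 / real h) * t + 0)) \<longlongrightarrow> 0) at_ii_inf"
    using h(1) by (intro expi2_tendsto_0) simp
  then have "eventually (\<lambda>t. norm (expi2 (of_real (1 / real h) * t + 0)) < r) at_ii_inf"
    using r(1) by (metis order_tendstoD(2) tendsto_norm_zero)
  then obtain c' where c': "\<And>t. Im t > c' \<Longrightarrow> norm (expi2 (of_real (1 / real h) * t + 0)) < r"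
    unfolding eventually_at_ii_inf by blast
  have "f analytic_on {t}" if t: "Im t > max c c'" for t
  proof -
    define S where "S = {t. Im t > max c c'}"
    have S: "open S" "t \<in> S"
      unfolding S_def using t open_halfspace_Im_gt[of "max c c'"] by blast+
    have E: "expi2 (of_real (1 / real h) * t + 0) = exp (2 * of_real pi * \<i> * t / of_nat h)" for t
      by (simp add: expi2_def)
    have "(\<lambda>t. F (exp (2 * of_real pi * \<i> * t / of_nat h))) holomorphic_on S"
    proof (rule holomorphic_on_compose_gen[unfolded o_def, of _ _ F "ball 0 r - {0}"])
      show "(\<lambda>t. exp (2 * of_real pi * \<i> * t / of_nat h)) holomorphic_on S"
        using h(1) by (intro holomorphic_intros) auto
      show "F holomorphic_on ball 0 r - {0}" using r by (simp add: analytic_imp_holomorphic)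
      show "(\<lambda>t. exp (2 * of_real pi * \<i> * t / of_nat h)) ` S \<subseteq> ball 0 r - {0}"
        using c' unfolding S_def E by auto
    qed
    then have "f holomorphic_on S"
      by (rule holomorphic_transform) (simp add: S_def h(3))
    with S show ?thesis
      by (meson holomorphic_on_imp_analytic_at)
  qed
  then show ?thesis
    unfolding eventually_at_ii_inf by blast
qed

lemma analytic_act_iff:
  assumes A: "A \<in> SL2Z" and t: "t \<in> HH"
  shows "(\<lambda>t. f (act A t)) analytic_on {t} \<longleftrightarrow> f analytic_on {act A t}"
proof
  have act: "act B analytic_on {s}" if "B \<in> SL2Z" "s \<in> HH" for B s
    using act_holomorphic[OF that(1)] that(2) by (meson holomorphic_on_imp_analytic_at open_upper_half_plane)
  {
    assume "f analytic_on {act A t}"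
    then show "(\<lambda>t. f (act A t)) analytic_on {t}"
      using analytic_on_compose_gen[OF act[OF A t], of f "{act A t}"] by (simp add: o_def)
  next
    assume "(\<lambda>t. f (act A t)) analytic_on {t}"
    then have *: "(\<lambda>s. f (act A (act (inv2 A) s))) analytic_on {act A t}"
      using analytic_on_compose_gen[OF act[of "inv2 A" "act A t"], of "\<lambda>t. f (act A t)" "{t}"] A t
      by (simp add: o_def)
    have "eventually (\<lambda>s. s \<in> HH) (nhds (act A t))"
      using A t by (intro eventually_nhds_in_open) auto
    then have "eventually (\<lambda>s. f (act A (act (inv2 A) s)) = f s) (nhds (act A t))"
      by eventually_elim (use A in simp)
    from analytic_at_cong[OF this refl] * show "f analytic_on {act A t}" by blast
  }
qed

text \<open>Normalisation alters values only at points where the function is not analytic, and there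
  are none of large imaginary part.\<close>

lemma meromorphic_at_ii_inf_mer:
  assumes F: "F meromorphic_on HH" and A: "A \<in> SL2Z" and inf: "meromorphic_at_ii_inf (\<lambda>t. F (act A t))"
  shows "meromorphic_at_ii_inf (\<lambda>t. mer F (act A t))"
proof (rule meromorphic_at_ii_inf_cong[OF inf])
  have "eventually (\<lambda>t. t \<in> HH) at_ii_inf"
    unfolding eventually_at_ii_inf by (auto simp: in_upper_half_plane)
  with meromorphic_at_ii_inf_analytic[OF inf] show "eventually (\<lambda>t. F (act A t) = mer F (act A t)) at_ii_inf"
    by eventually_elim (use A in \<open>simp add: analytic_act_iff mer_def\<close>)
qed

text \<open>The conditions on a modular function apart from invariance and normalisation. Unlike
  \<open>modular_functions\<close> they are stable under pointwise operations.\<close>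

definition cusp_meromorphic :: "(complex \<Rightarrow> complex) \<Rightarrow> bool" where
  "cusp_meromorphic f \<longleftrightarrow> f meromorphic_on HH \<and> (\<forall>A\<in>SL2Z. meromorphic_at_ii_inf (\<lambda>t. f (act A t)))"

text \<open>Invariance may be checked off a sparse set, as \<open>mer\<close> ignores such
  sets.\<close>

lemma modular_functions_mer:
  assumes "cusp_meromorphic F" and \<Gamma>: "\<Gamma> \<subseteq> SL2Z"
    and inv: "\<And>A. A \<in> \<Gamma> \<Longrightarrow> \<forall>\<^sub>\<approx>t\<in>HH. F (act A t) = F t"
  shows "mer F \<in> modular_functions \<Gamma>"
  unfolding modular_functions_def
proof safe
  show "mer F nicely_meromorphic_on HH"
    using assms by (intro mer_nicely) (simp add: cusp_meromorphic_def)
  show "mer F (act A t) = mer F t" if "A \<in> \<Gamma>" "t \<in> HH" for A t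
    using mer_act[of A t F] mer_cong[OF inv[OF that(1)]] that \<Gamma> by auto
  show "meromorphic_at_ii_inf (\<lambda>t. mer F (act A t))" if "A \<in> SL2Z" for A
    using assms that by (intro meromorphic_at_ii_inf_mer) (auto simp: cusp_meromorphic_def)
qed (simp add: mer_def)

lemma modular_functionsD:
  assumes "f \<in> modular_functions \<Gamma>"
  shows "f nicely_meromorphic_on HH" "cusp_meromorphic f" "mer f = f"
    "A \<in> \<Gamma> \<Longrightarrow> t \<in> HH \<Longrightarrow> f (act A t) = f t"
  using assms mer_ident[of f]
  by (auto simp: modular_functions_def cusp_meromorphic_def nicely_meromorphic_on_def)

lemma modular_functions_ae:
  assumes "f \<in> modular_functions \<Gamma>" "A \<in> \<Gamma>"
  shows "\<forall>\<^sub>\<approx>t\<in>HH. f (act A t) = f t"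
proof -
  have "\<forall>\<^sub>\<approx>t\<in>HH. t \<in> HH" by (rule eventually_in_cosparse) auto
  then show ?thesis by eventually_elim (rule modular_functionsD(4)[OF assms])
qed

lemma cusp_meromorphic_add: "cusp_meromorphic f \<Longrightarrow> cusp_meromorphic g \<Longrightarrow> cusp_meromorphic (\<lambda>t. f t + g t)"
  unfolding cusp_meromorphic_def by (auto intro!: meromorphic_intros meromorphic_at_ii_inf_add)

lemma cusp_meromorphic_mult: "cusp_meromorphic f \<Longrightarrow> cusp_meromorphic g \<Longrightarrow> cusp_meromorphic (\<lambda>t. f t * g t)"
  unfolding cusp_meromorphic_def by (auto intro!: meromorphic_intros meromorphic_at_ii_inf_mult)

lemma cusp_meromorphic_divide: "cusp_meromorphic f \<Longrightarrow> cusp_meromorphic g \<Longrightarrow> cusp_meromorphic (\<lambda>t. f t / g t)"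
  unfolding cusp_meromorphic_def by (auto intro!: meromorphic_intros meromorphic_at_ii_inf_divide)

lemma cusp_meromorphic_const: "cusp_meromorphic (\<lambda>_. c)"
  unfolding cusp_meromorphic_def by (auto intro: meromorphic_at_ii_inf_const)

lemma cusp_meromorphic_minus: "cusp_meromorphic f \<Longrightarrow> cusp_meromorphic (\<lambda>t. - f t)"
  using cusp_meromorphic_mult[OF cusp_meromorphic_const[of "-1"], of f] by simp

lemma cusp_meromorphic_diff: "cusp_meromorphic f \<Longrightarrow> cusp_meromorphic g \<Longrightarrow> cusp_meromorphic (\<lambda>t. f t - g t)"
  using cusp_meromorphic_add[OF _ cusp_meromorphic_minus, of f g] by simp

lemma cusp_meromorphic_power: "cusp_meromorphic f \<Longrightarrow> cusp_meromorphic (\<lambda>t. f t ^ n)"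
  by (induction n) (auto intro: cusp_meromorphic_const cusp_meromorphic_mult)

lemma cusp_meromorphic_poly: "cusp_meromorphic f \<Longrightarrow> cusp_meromorphic (\<lambda>t. poly p (f t))"
  by (induction p) (auto intro: cusp_meromorphic_const cusp_meromorphic_mult cusp_meromorphic_add)

lemma cusp_meromorphic_act:
  assumes "cusp_meromorphic f" "A \<in> SL2Z"
  shows "cusp_meromorphic (\<lambda>t. f (act A t))"
proof -
  have "meromorphic_at_ii_inf (\<lambda>t. f (act A (act B t)))" if B: "B \<in> SL2Z" for B
  proof (rule meromorphic_at_ii_inf_cong)
    show "meromorphic_at_ii_inf (\<lambda>t. f (act (A ** B) t))"
      using assms B by (simp add: cusp_meromorphic_def)
    show "eventually (\<lambda>t. f (act (A ** B) t) = f (act A (act B t))) at_ii_inf"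
      unfolding eventually_at_ii_inf using assms B
      by (intro exI[of _ 0]) (auto simp: act_mult in_upper_half_plane)
  qed
  then show ?thesis
    using assms by (auto simp: cusp_meromorphic_def intro: meromorphic_act)
qed

lemmas cusp_intros = cusp_meromorphic_add cusp_meromorphic_mult cusp_meromorphic_divide
  cusp_meromorphic_const cusp_meromorphic_minus cusp_meromorphic_diff cusp_meromorphic_power
  cusp_meromorphic_poly cusp_meromorphic_act

context
  fixes \<Gamma> :: "(int ^ 2 ^ 2) set"
  assumes \<Gamma>: "\<Gamma> \<subseteq> SL2Z"
begin

lemma modular_functions_const: "mer (\<lambda>_. c) \<in> modular_functions \<Gamma>"
  by (rule modular_functions_mer[OF cusp_meromorphic_const \<Gamma>]) simp

lemma modular_functions_binop:
  assumes f: "f \<in> modular_functions \<Gamma>" and g: "g \<in> modular_functions \<Gamma>"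
    and "cusp_meromorphic (\<lambda>t. op (f t) (g t))"
  shows "mer (\<lambda>t. op (f t) (g t)) \<in> modular_functions \<Gamma>"
proof (rule modular_functions_mer[OF assms(3) \<Gamma>])
  fix A assume "A \<in> \<Gamma>"
  from modular_functions_ae[OF f this] modular_functions_ae[OF g this]
  show "\<forall>\<^sub>\<approx>t\<in>HH. op (f (act A t)) (g (act A t)) = op (f t) (g t)"
    by eventually_elim simp
qed

lemma modular_functions_add:
  "f \<in> modular_functions \<Gamma> \<Longrightarrow> g \<in> modular_functions \<Gamma> \<Longrightarrow> mer (\<lambda>t. f t + g t) \<in> modular_functions \<Gamma>"
  by (rule modular_functions_binop) (auto intro: cusp_intros modular_functionsD)

lemma modular_functions_mult:
  "f \<in> modular_functions \<Gamma> \<Longrightarrow> g \<in> modular_functions \<Gamma> \<Longrightarrow> mer (\<lambda>t. f t * g t) \<in> modular_functions \<Gamma>"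
  by (rule modular_functions_binop) (auto intro: cusp_intros modular_functionsD)

lemma modular_functions_divide:
  "f \<in> modular_functions \<Gamma> \<Longrightarrow> g \<in> modular_functions \<Gamma> \<Longrightarrow> mer (\<lambda>t. f t / g t) \<in> modular_functions \<Gamma>"
  by (rule modular_functions_binop) (auto intro: cusp_intros modular_functionsD)

lemma mer_meromorphicD: "f \<in> modular_functions \<Gamma> \<Longrightarrow> f meromorphic_on HH"
  using modular_functionsD(1) by (auto simp: nicely_meromorphic_on_def)

text \<open>Since values at poles are set to 0, an identity between functions holds pointwise only
  off a sparse set; every axiom is verified there and transported by \<open>mer_cong\<close>.
  Inverses exist because a nonzero meromorphic function on the connected upper half-plane has a
  sparse set of zeros.\<close>

lemma field_modular_function_field: "field (modular_function_field \<Gamma>)"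
proof -
  let ?K = "modular_function_field \<Gamma>"
  note ms = modular_function_field_def
  have mm [meromorphic_intros]: "f meromorphic_on HH" if "f \<in> modular_functions \<Gamma>" for f
    using mer_meromorphicD[OF that] .
  have ae: "\<forall>\<^sub>\<approx>t\<in>HH. mer (\<lambda>t. f t + g t) t = f t + g t" "\<forall>\<^sub>\<approx>t\<in>HH. mer (\<lambda>t. f t * g t) t = f t * g t"
    "\<forall>\<^sub>\<approx>t\<in>HH. mer (\<lambda>_. c) t = c"
    if "f \<in> modular_functions \<Gamma>" "g \<in> modular_functions \<Gamma>" for f g c
    using mm[OF that(1)] mm[OF that(2)]
    by (blast intro: mer_ae meromorphic_on_add meromorphic_on_mult meromorphic_on_const)+
  have eqI: "f = g" if "f \<in> modular_functions \<Gamma>" "g \<in> modular_functions \<Gamma>" "\<forall>\<^sub>\<approx>t\<in>HH. f t = g t" for f g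
    using mer_cong[OF that(3)] modular_functionsD(3) that(1,2) by metis
  have "cring ?K"
  proof (rule cringI)
    show "abelian_group ?K"
    proof (rule abelian_groupI)
      fix f g h
      assume "f \<in> carrier ?K" "g \<in> carrier ?K" "h \<in> carrier ?K"
      then have f: "f \<in> modular_functions \<Gamma>" and g: "g \<in> modular_functions \<Gamma>" and h: "h \<in> modular_functions \<Gamma>"
        by (auto simp: ms)
      show "(f \<oplus>\<^bsub>?K\<^esub> g) \<oplus>\<^bsub>?K\<^esub> h = f \<oplus>\<^bsub>?K\<^esub> (g \<oplus>\<^bsub>?K\<^esub> h)"
        unfolding ms ring.simps
      proof (rule mer_cong)
        show "\<forall>\<^sub>\<approx>t\<in>HH. mer (\<lambda>t. f t + g t) t + h t = f t + mer (\<lambda>t. g t + h t) t"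
          using ae(1)[OF f g] ae(1)[OF g h] by eventually_elim simp
      qed
    next
      fix f assume "f \<in> carrier ?K"
      then have f: "f \<in> modular_functions \<Gamma>" by (simp add: ms)
      have "mer (\<lambda>t. mer (\<lambda>_. 0) t + f t) = mer f"
      proof (rule mer_cong)
        show "\<forall>\<^sub>\<approx>t\<in>HH. mer (\<lambda>_. 0) t + f t = f t"
          using ae(3)[OF f f, of 0] by eventually_elim simp
      qed
      then show "\<zero>\<^bsub>?K\<^esub> \<oplus>\<^bsub>?K\<^esub> f = f"
        using modular_functionsD(3)[OF f] by (simp add: ms)
      have "mer (\<lambda>t. mer (\<lambda>_. -1) t * f t) \<in> modular_functions \<Gamma>"
        by (intro modular_functions_mult modular_functions_const f)
      moreover have "mer (\<lambda>t. mer (\<lambda>t. mer (\<lambda>_. -1) t * f t) t + f t) = mer (\<lambda>_. 0)"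
      proof (rule mer_cong)
        show "\<forall>\<^sub>\<approx>t\<in>HH. mer (\<lambda>t. mer (\<lambda>_. -1) t * f t) t + f t = 0"
          using ae(2)[OF modular_functions_const f, of "-1"] ae(3)[OF f f, of "-1"] by eventually_elim simp
      qed
      ultimately show "\<exists>g\<in>carrier ?K. g \<oplus>\<^bsub>?K\<^esub> f = \<zero>\<^bsub>?K\<^esub>"
        by (auto simp: ms)
    qed (auto simp: ms modular_functions_add modular_functions_const add.commute)
    show "comm_monoid ?K"
    proof (rule comm_monoidI)
      fix f g h
      assume "f \<in> carrier ?K" "g \<in> carrier ?K" "h \<in> carrier ?K"
      then have f: "f \<in> modular_functions \<Gamma>" and g: "g \<in> modular_functions \<Gamma>" and h: "h \<in> modular_functions \<Gamma>"
        by (auto simp: ms)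
      show "(f \<otimes>\<^bsub>?K\<^esub> g) \<otimes>\<^bsub>?K\<^esub> h = f \<otimes>\<^bsub>?K\<^esub> (g \<otimes>\<^bsub>?K\<^esub> h)"
        unfolding ms monoid.simps
      proof (rule mer_cong)
        show "\<forall>\<^sub>\<approx>t\<in>HH. mer (\<lambda>t. f t * g t) t * h t = f t * mer (\<lambda>t. g t * h t) t"
          using ae(2)[OF f g] ae(2)[OF g h] by eventually_elim simp
      qed
    next
      fix f assume "f \<in> carrier ?K"
      then have f: "f \<in> modular_functions \<Gamma>" by (simp add: ms)
      have "mer (\<lambda>t. mer (\<lambda>_. 1) t * f t) = mer f"
      proof (rule mer_cong)
        show "\<forall>\<^sub>\<approx>t\<in>HH. mer (\<lambda>_. 1) t * f t = f t"
          using ae(3)[OF f f, of 1] by eventually_elim simp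
      qed
      then show "\<one>\<^bsub>?K\<^esub> \<otimes>\<^bsub>?K\<^esub> f = f"
        using modular_functionsD(3)[OF f] by (simp add: ms)
    qed (auto simp: ms modular_functions_mult modular_functions_const mult.commute)
    fix f g h
    assume "f \<in> carrier ?K" "g \<in> carrier ?K" "h \<in> carrier ?K"
    then have f: "f \<in> modular_functions \<Gamma>" and g: "g \<in> modular_functions \<Gamma>" and h: "h \<in> modular_functions \<Gamma>"
      by (auto simp: ms)
    show "(f \<oplus>\<^bsub>?K\<^esub> g) \<otimes>\<^bsub>?K\<^esub> h = f \<otimes>\<^bsub>?K\<^esub> h \<oplus>\<^bsub>?K\<^esub> g \<otimes>\<^bsub>?K\<^esub> h"
      unfolding ms monoid.simps ring.simps
    proof (rule mer_cong)
      show "\<forall>\<^sub>\<approx>t\<in>HH. mer (\<lambda>t. f t + g t) t * h t = mer (\<lambda>t. f t * h t) t + mer (\<lambda>t. g t * h t) t"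
        using ae(1)[OF f g] ae(2)[OF f h] ae(2)[OF g h] by eventually_elim (simp add: ring_distribs)
    qed
  qed
  moreover have "\<one>\<^bsub>?K\<^esub> \<noteq> \<zero>\<^bsub>?K\<^esub>"
  proof
    assume "\<one>\<^bsub>?K\<^esub> = \<zero>\<^bsub>?K\<^esub>"
    then have "mer (\<lambda>_. 1) \<i> = mer (\<lambda>_. 0) \<i>" by (simp add: ms)
    then show False
      by (simp add: mer_def in_upper_half_plane)
  qed
  moreover have "\<exists>g\<in>carrier ?K. f \<otimes>\<^bsub>?K\<^esub> g = \<one>\<^bsub>?K\<^esub>" if "f \<in> carrier ?K" "f \<noteq> \<zero>\<^bsub>?K\<^esub>" for f
  proof -
    have f: "f \<in> modular_functions \<Gamma>" using that by (simp add: ms)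
    have "\<not> (\<forall>t\<in>HH. f t = 0)"
    proof
      assume "\<forall>t\<in>HH. f t = 0"
      then have "f t = mer (\<lambda>_. 0) t" for t
        using f by (cases "t \<in> HH") (auto simp: mer_def modular_functions_def)
      with that show False by (simp add: ms fun_eq_iff)
    qed
    then have nz: "\<forall>\<^sub>\<approx>t\<in>HH. f t \<noteq> 0"
      using nicely_meromorphic_imp_constant_or_avoid[OF modular_functionsD(1)[OF f]] by blast
    have g: "mer (\<lambda>t. mer (\<lambda>_. 1) t / f t) \<in> modular_functions \<Gamma>"
      by (intro modular_functions_divide modular_functions_const f)
    have "\<forall>\<^sub>\<approx>t\<in>HH. mer (\<lambda>t. mer (\<lambda>_. 1) t / f t) t = mer (\<lambda>_. 1) t / f t"
      by (intro mer_ae meromorphic_intros f)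
    with nz ae(3)[OF f f, of 1] have "\<forall>\<^sub>\<approx>t\<in>HH. f t * mer (\<lambda>t. mer (\<lambda>_. 1) t / f t) t = 1"
      by eventually_elim simp
    then have "mer (\<lambda>t. f t * mer (\<lambda>t. mer (\<lambda>_. 1) t / f t) t) = mer (\<lambda>_. 1)"
      by (rule mer_cong)
    with g show ?thesis
      by (auto simp: ms)
  qed
  ultimately show ?thesis
    by (intro cring.cring_fieldI2) auto
qed

end

section \<open>Expansions at the cusps and the maximum principle\<close>

lemma norm_expi2_less_1_iff: "norm (expi2 z) < 1 \<longleftrightarrow> Im z > 0"
  by (simp add: norm_expi2 zero_less_mult_iff)

lemma holomorphic_act:
  assumes "f holomorphic_on HH" "A \<in> SL2Z"
  shows "(\<lambda>t. f (act A t)) holomorphic_on HH"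
proof (rule holomorphic_on_compose_gen[unfolded o_def, OF act_holomorphic[OF assms(2)] assms(1)])
  show "act A ` HH \<subseteq> HH" using assms(2) by auto
qed

lemma periodic_half_plane:
  assumes per: "\<And>t. t \<in> HH \<Longrightarrow> f (t + of_nat h) = f t" and t: "t \<in> HH"
  shows "f (t + of_int n * of_nat h) = f t"
proof -
  have H: "t + of_int m * of_nat h \<in> HH" for m
    using t by (simp add: in_upper_half_plane)
  show ?thesis
  proof (induction n rule: int_induct[of _ 0])
    case (step1 i)
    then show ?case using per[OF H[of i]] by (simp add: algebra_simps)
  next
    case (step2 i)
    then show ?case using per[OF H[of "i - 1"]] by (simp add: algebra_simps)
  qed simp
qed

text \<open>\<open>F\<close> is \<open>f\<close> composed with a logarithm. By periodicity the
  branch is irrelevant, so a local branch shows holomorphy on the punctured disc; boundedness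
  removes the singularity at 0.\<close>

lemma q_expansion:
  assumes f: "f holomorphic_on HH" and h: "h > 0"
    and per: "\<And>t. t \<in> HH \<Longrightarrow> f (t + of_nat h) = f t"
    and bdd: "eventually (\<lambda>t. norm (f t) \<le> B) at_ii_inf"
  obtains F where "F holomorphic_on ball 0 1" "\<And>t. t \<in> HH \<Longrightarrow> f t = F (expi2 (t / of_nat h))"
proof -
  define \<tau> where "\<tau> = (\<lambda>x. of_nat h * Ln x / (2 * of_real pi * \<i>))"
  define G where "G = (\<lambda>x. f (\<tau> x))"
  have Im\<tau>: "Im (\<tau> x) = - (real h * ln (norm x) / (2 * pi))" if "x \<noteq> 0" for x
    using that by (simp add: \<tau>_def Im_divide power2_eq_square)
  have \<tau>H: "\<tau> x \<in> HH" if "x \<noteq> 0" "norm x < 1" for x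
  proof -
    have "ln (norm x) < 0" using that by simp
    then show ?thesis
      using Im\<tau>[OF that(1)] h by (simp add: in_upper_half_plane divide_neg_pos mult_pos_neg)
  qed
  have e\<tau>: "expi2 (\<tau> x / of_nat h) = x" if "x \<noteq> 0" for x
    using that h by (simp add: expi2_def \<tau>_def)
  have fG: "f s = f t" if st: "s \<in> HH" "expi2 (s / of_nat h) = expi2 (t / of_nat h)" and "t \<in> HH" for s t
  proof -
    have "expi2 (s / of_nat h - t / of_nat h) = 1"
      using st by (simp add: expi2_diff)
    then obtain n where "s / of_nat h - t / of_nat h = of_int n"
      by (auto simp: expi2_eq_1_iff elim: Ints_cases)
    then have "s = t + of_int n * of_nat h"
      using h by (simp add: field_simps)
    then show ?thesis
      using periodic_half_plane[of f h t n] per \<open>t \<in> HH\<close> by simp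
  qed
  have G: "f t = G (expi2 (t / of_nat h))" if t: "t \<in> HH" for t
  proof -
    have "norm (expi2 (t / of_nat h)) < 1"
      using t h by (intro norm_expi2_less_1) (simp add: in_upper_half_plane)
    then have "\<tau> (expi2 (t / of_nat h)) \<in> HH" by (intro \<tau>H) auto
    then show ?thesis
      unfolding G_def using fG[OF t _ _] e\<tau>[of "expi2 (t / of_nat h)"] by simp
  qed
  have Ghol: "G holomorphic_on ball 0 1 - {0}"
  proof -
    have "G analytic_on {x0}" if x0: "x0 \<in> ball 0 1 - {0}" for x0
    proof -
      \<comment> \<open>A branch of the logarithm centred at \<open>x0\<close>. On \<open>S\<close>
        the quotient \<open>x / x0\<close> has distance less than 1 from 1 and so avoids the branch
        cut.\<close>
      define L where "L = (\<lambda>x. \<tau> x0 + of_nat h * Ln (x / x0) / (2 * of_real pi * \<i>))"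
      define S where "S = ball x0 (norm x0) \<inter> (ball 0 1 - {0})"
      have S: "open S" "x0 \<in> S" using x0 by (auto simp: S_def)
      have npr: "x / x0 \<notin> \<real>\<^sub>\<le>\<^sub>0" if "x \<in> S" for x
      proof
        assume "x / x0 \<in> \<real>\<^sub>\<le>\<^sub>0"
        then have "Re (x / x0) \<le> 0" by (simp add: complex_nonpos_Reals_iff)
        then have "1 \<le> \<bar>Re (1 - x / x0)\<bar>" by simp
        also have "\<dots> \<le> norm (1 - x / x0)" by (rule abs_Re_le_cmod)
        also have "1 - x / x0 = (x0 - x) / x0" using x0 by (simp add: field_simps)
        also have "norm \<dots> < 1"
          using that x0 by (simp add: S_def norm_divide dist_norm)
        finally show False by simp
      qed
      have eL: "expi2 (L x / of_nat h) = x" if "x \<in> S" for x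
      proof -
        have "L x / of_nat h = \<tau> x0 / of_nat h + Ln (x / x0) / (2 * of_real pi * \<i>)"
          using h by (simp add: L_def field_simps)
        then have "expi2 (L x / of_nat h) = x0 * expi2 (Ln (x / x0) / (2 * of_real pi * \<i>))"
          using e\<tau>[of x0] x0 by (simp add: expi2_add)
        also have "\<dots> = x0 * exp (Ln (x / x0))" by (simp add: expi2_def)
        also have "\<dots> = x" using that x0 by (simp add: S_def)
        finally show ?thesis .
      qed
      have LH: "L x \<in> HH" if "x \<in> S" for x
      proof -
        have "norm (expi2 (L x / of_nat h)) < 1"
          using eL[OF that] that by (simp add: S_def)
        then have "Im (L x / of_nat h) > 0"
          by (simp only: norm_expi2_less_1_iff)
        then show ?thesis using h by (simp add: in_upper_half_plane field_simps)
      qed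
      have "(\<lambda>x. f (L x)) holomorphic_on S"
      proof (rule holomorphic_on_compose_gen[unfolded o_def, OF _ f])
        show "L holomorphic_on S"
          unfolding L_def using x0 npr by (intro holomorphic_intros) auto
        show "L ` S \<subseteq> HH" using LH by blast
      qed
      then have "G holomorphic_on S"
      proof (rule holomorphic_transform)
        fix x assume x: "x \<in> S"
        show "f (L x) = G x"
          using G[OF LH[OF x]] eL[OF x] by simp
      qed
      with S show ?thesis by (meson holomorphic_on_imp_analytic_at)
    qed
    then show ?thesis
      by (meson analytic_imp_holomorphic analytic_on_analytic_at)
  qed
  obtain c where c: "\<And>t. Im t > c \<Longrightarrow> norm (f t) \<le> B"
    using bdd unfolding eventually_at_ii_inf by blast
  have "eventually (\<lambda>x. norm (G x) \<le> B) (at 0)"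
  proof -
    \<comment> \<open>Points of norm less than \<open>r\<close> correspond to points of imaginary
      part above \<open>\<bar>c\<bar>\<close>.\<close>
    define r where "r = exp (- (2 * pi * \<bar>c\<bar> / real h) - 1)"
    have "eventually (\<lambda>x::complex. x \<in> ball 0 r - {0}) (at 0)"
      by (rule eventually_at_in_open) (auto simp: r_def)
    then show ?thesis
    proof eventually_elim
      case (elim x)
      then have x: "x \<noteq> 0" "norm x < r" by auto
      then have "ln (norm x) < ln r" by (subst ln_less_cancel_iff) (auto simp: r_def)
      then have "ln (norm x) < - (2 * pi * \<bar>c\<bar> / real h)" by (simp add: r_def)
      then have "real h * ln (norm x) < real h * - (2 * pi * \<bar>c\<bar> / real h)"
        using h by (intro mult_strict_left_mono) auto
      then have "real h * ln (norm x) < - (2 * pi * \<bar>c\<bar>)" using h by simp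
      then have "Im (\<tau> x) > \<bar>c\<bar>"
      proof -
        have "2 * pi * \<bar>c\<bar> < 2 * pi * Im (\<tau> x)"
          using Im\<tau>[OF x(1)] \<open>real h * ln (norm x) < - (2 * pi * \<bar>c\<bar>)\<close> by simp
        then show ?thesis by simp
      qed
      then show ?case unfolding G_def by (intro c) auto
    qed
  qed
  then obtain F where F: "F holomorphic_on ball 0 1" "\<forall>x\<in>ball 0 1 - {0}. F x = G x"
    using holomorphic_on_extend_bounded[OF Ghol] by auto
  show ?thesis
  proof (rule that[OF F(1)])
    fix t assume t: "t \<in> HH"
    have "norm (expi2 (t / of_nat h)) < 1"
      using t h by (intro norm_expi2_less_1) (simp add: in_upper_half_plane)
    then show "f t = F (expi2 (t / of_nat h))"
      using G[OF t] F(2) by simp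
  qed
qed

lemma expi2_divide_surj:
  assumes "h > 0" "x \<noteq> 0" "norm x < 1"
  obtains t where "t \<in> HH" "expi2 (t / of_nat h) = x"
proof -
  define t where "t = of_nat h * Ln x / (2 * of_real pi * \<i>)"
  have e: "expi2 (t / of_nat h) = x"
    using assms by (simp add: expi2_def t_def)
  moreover have "norm (expi2 (t / of_nat h)) < 1" using e assms by simp
  then have "Im (t / of_nat h) > 0" by (simp only: norm_expi2_less_1_iff)
  then have "t \<in> HH" using assms by (simp add: in_upper_half_plane field_simps)
  ultimately show ?thesis using that by blast
qed

text \<open>The discs of radius \<open>\<rho>\<close> already account for all values of
  \<open>f\<close>. The largest of the finitely many maxima thus bounds \<open>f\<close> everywhere,
  which makes it an interior maximum of one of the expansions on the unit disc.\<close>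

lemma constant_if_bounded_at_cusps_aux:
  assumes R: "finite R" "R \<noteq> {}" "R \<subseteq> SL2Z" and h: "h > 0"
    and cover: "\<And>z. z \<in> HH \<Longrightarrow> \<exists>B\<in>R. \<exists>w. Im w \<ge> 1/2 \<and> f z = f (act B w)"
    and F: "\<And>B. B \<in> R \<Longrightarrow> F B holomorphic_on ball 0 1"
    and fF: "\<And>B t. B \<in> R \<Longrightarrow> t \<in> HH \<Longrightarrow> f (act B t) = F B (expi2 (t / of_nat h))"
  shows "\<exists>c. \<forall>t\<in>HH. f t = c"
proof -
  \<comment> \<open>The norm of \<open>expi2 (w / of_nat h)\<close> on the line
    \<open>Im w = 1/2\<close>.\<close>
  define \<rho> where "\<rho> = exp (- (pi / real h))"
  have \<rho>: "0 < \<rho>" "\<rho> < 1" using h by (auto simp: \<rho>_def)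
  have "\<exists>x\<in>cball 0 \<rho>. \<forall>y\<in>cball 0 \<rho>. norm (F B y) \<le> norm (F B x)" if "B \<in> R" for B
  proof (rule continuous_attains_sup)
    have "continuous_on (ball 0 1) (F B)"
      by (rule holomorphic_on_imp_continuous_on[OF F[OF that]])
    then show "continuous_on (cball 0 \<rho>) (\<lambda>x. norm (F B x))"
      using \<rho> by (intro continuous_intros) (auto intro: continuous_on_subset)
  qed (use \<rho> in auto)
  then obtain x where x: "\<And>B. B \<in> R \<Longrightarrow> x B \<in> cball 0 \<rho>"
    "\<And>B y. B \<in> R \<Longrightarrow> y \<in> cball 0 \<rho> \<Longrightarrow> norm (F B y) \<le> norm (F B (x B))"
    by metis
  have "\<exists>B0\<in>R. \<forall>B\<in>R. norm (F B (x B)) \<le> norm (F B0 (x B0))"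
  proof -
    have "Max ((\<lambda>B. norm (F B (x B))) ` R) \<in> (\<lambda>B. norm (F B (x B))) ` R"
      using R by (intro Max_in) auto
    then obtain B0 where "B0 \<in> R" "Max ((\<lambda>B. norm (F B (x B))) ` R) = norm (F B0 (x B0))"
      by auto
    moreover have "norm (F B (x B)) \<le> Max ((\<lambda>B. norm (F B (x B))) ` R)" if "B \<in> R" for B
      using R that by (intro Max_ge) auto
    ultimately show ?thesis by auto
  qed
  then obtain B0 where B0: "B0 \<in> R" "\<And>B. B \<in> R \<Longrightarrow> norm (F B (x B)) \<le> norm (F B0 (x B0))"
    by blast
  have bound: "norm (f z) \<le> norm (F B0 (x B0))" if z: "z \<in> HH" for z
  proof -
    obtain B w where Bw: "B \<in> R" "Im w \<ge> 1/2" "f z = f (act B w)"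
      using cover[OF z] by blast
    have "norm (expi2 (w / of_nat h)) \<le> \<rho>"
      using Bw(2) h by (simp add: norm_expi2 \<rho>_def divide_right_mono)
    then have "norm (F B (expi2 (w / of_nat h))) \<le> norm (F B (x B))"
      using x(2)[OF Bw(1)] by simp
    also have "\<dots> \<le> norm (F B0 (x B0))" using B0(2)[OF Bw(1)] .
    finally show ?thesis
      using fF[OF Bw(1), of w] Bw by (simp add: in_upper_half_plane)
  qed
  have "F B0 constant_on ball 0 1"
  proof (rule maximum_modulus_principle[OF F[OF B0(1)], of "ball 0 1" "x B0"])
    show "x B0 \<in> ball 0 1" using x(1)[OF B0(1)] \<rho> by auto
    fix y :: complex assume y: "y \<in> ball 0 1"
    show "norm (F B0 y) \<le> norm (F B0 (x B0))"
    proof (cases "y = 0")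
      case True
      then show ?thesis using x(2)[OF B0(1), of 0] \<rho> by auto
    next
      case False
      then obtain t where t: "t \<in> HH" "expi2 (t / of_nat h) = y"
        using expi2_divide_surj[OF h, of y] y by auto
      then have "F B0 y = f (act B0 t)" using fF[OF B0(1) t(1)] by simp
      then show ?thesis using bound[of "act B0 t"] t B0 R by auto
    qed
  qed auto
  then obtain c where c: "\<And>y. y \<in> ball 0 1 \<Longrightarrow> F B0 y = c"
    by (auto simp: constant_on_def)
  have "f z = c" if z: "z \<in> HH" for z
  proof -
    define w where "w = act (inv2 B0) z"
    have B: "B0 \<in> SL2Z" using B0 R by auto
    have w: "w \<in> HH" "act B0 w = z" using z B by (auto simp: w_def)
    have "norm (expi2 (w / of_nat h)) < 1"
      using w h by (intro norm_expi2_less_1) (simp add: in_upper_half_plane)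
    then show ?thesis using fF[OF B0(1) w(1)] w c by simp
  qed
  then show ?thesis by blast
qed

section \<open>Reduction theory and matrices modulo N\<close>

definition tmat :: "int \<Rightarrow> int ^ 2 ^ 2" where "tmat n = mat2 1 n 0 1"

lemma tmat_SL2Z [simp]: "tmat n \<in> SL2Z"
  by (simp add: tmat_def)

lemma act_tmat [simp]: "act (tmat n) t = t + of_int n"
  by (simp add: tmat_def act_eq)

text \<open>A matrix minimising |c t + d| exists, as only finitely many pairs give a value of at
  most 1; a translation then adjusts the real part. With real part at most 1/2 in absolute value and
  imaginary part below 1/2 the norm would be less than 1, and an inversion would decrease the
  minimum.\<close>

lemma reduction:
  assumes t: "t \<in> HH"
  obtains A where "A \<in> SL2Z" "Im (act A t) \<ge> 1/2" "\<bar>Re (act A t)\<bar> \<le> 1/2"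
proof -
  define n where "n = (\<lambda>A. norm (of_int (ec A) * t + of_int (ed A)))"
  define X where "X = {(c, d). norm (of_int c * t + of_int d) \<le> 1}"
  have It: "Im t > 0" using t by (simp add: in_upper_half_plane)
  have "finite X"
  proof -
    define N where "N = \<lceil>1 + norm t / Im t + 1 / Im t\<rceil>"
    have "X \<subseteq> {-N..N} \<times> {-N..N}"
    proof safe
      fix c d :: int assume "(c, d) \<in> X"
      then have le: "norm (of_int c * t + of_int d) \<le> 1" by (simp add: X_def)
      have "\<bar>of_int c\<bar> * Im t = \<bar>Im (of_int c * t + of_int d)\<bar>"
        using It by (simp add: abs_mult)
      also have "\<dots> \<le> 1" using abs_Im_le_cmod le by (rule order_trans)
      finally have c: "\<bar>of_int c\<bar> \<le> 1 / Im t"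
        using It by (simp add: field_simps)
      have "\<bar>of_int d\<bar> = norm (of_int d :: complex)" by simp
      also have "of_int d = (of_int c * t + of_int d) - of_int c * t" by simp
      also have "norm \<dots> \<le> norm (of_int c * t + of_int d) + norm (of_int c * t)"
        by (rule norm_triangle_ineq4)
      also have "\<dots> \<le> 1 + 1 / Im t * norm t"
        using le mult_right_mono[OF c, of "norm t"] by (intro add_mono) (simp_all add: norm_mult)
      finally have d: "\<bar>of_int d\<bar> \<le> 1 + norm t / Im t" by simp
      have N: "1 + norm t / Im t + 1 / Im t \<le> of_int N" unfolding N_def by (rule le_of_int_ceiling)
      have pos: "norm t / Im t \<ge> 0" "1 / Im t \<ge> 0" using It by auto
      have "\<bar>of_int c\<bar> \<le> real_of_int N" "\<bar>of_int d\<bar> \<le> real_of_int N"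
        using c d N pos by linarith+
      then show "c \<in> {-N..N}" "d \<in> {-N..N}" by (auto simp: abs_le_iff)
    qed
    then show ?thesis by (rule finite_subset) auto
  qed
  define Y where "Y = n ` {A \<in> SL2Z. n A \<le> 1}"
  have "Y \<subseteq> (\<lambda>(c, d). norm (of_int c * t + of_int d)) ` X"
    by (auto simp: Y_def X_def n_def)
  then have finY: "finite Y" using \<open>finite X\<close> finite_surj by blast
  have "n (mat 1) = 1" by (simp add: n_def)
  then have Yne: "Y \<noteq> {}" by (auto simp: Y_def intro!: exI[of _ "mat 1"])
  obtain A where A: "A \<in> SL2Z" "n A \<le> 1" "n A = Min Y"
    using Min_in[OF finY Yne] by (auto simp: Y_def)
  have min: "n A \<le> n B" if "B \<in> SL2Z" for B
  proof (cases "n B \<le> 1")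
    case True
    then have "n B \<in> Y" using that by (auto simp: Y_def)
    then show ?thesis using A(3) finY by simp
  qed (use A(2) in auto)
  define m where "m = \<lfloor>Re (act A t) + 1/2\<rfloor>"
  define A' where "A' = tmat (- m) ** A"
  have A': "A' \<in> SL2Z" using A by (simp add: A'_def)
  have act': "act A' t = act A t - of_int m"
    using A t by (simp add: A'_def act_mult)
  have nA': "n A' = n A" by (simp add: n_def A'_def tmat_def)
  have "\<bar>Re (act A t) - of_int m\<bar> \<le> 1/2"
    unfolding m_def by linarith
  then have Re: "\<bar>Re (act A' t)\<bar> \<le> 1/2" by (simp add: act')
  define w where "w = act A' t"
  have wH: "w \<in> HH" using A' t by (simp add: w_def)
  have "Im w \<ge> 1/2"
  proof (rule ccontr)
    assume *: "\<not> Im w \<ge> 1/2"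
    have "(norm w)\<^sup>2 = (Re w)\<^sup>2 + (Im w)\<^sup>2" by (simp add: cmod_power2)
    also have "(Re w)\<^sup>2 \<le> (1/2)\<^sup>2"
      using Re power_mono[of "\<bar>Re w\<bar>" "1/2" 2] by (simp add: w_def)
    also have "(Im w)\<^sup>2 \<le> (1/2)\<^sup>2"
      using * wH by (intro power_mono) (auto simp: in_upper_half_plane)
    finally have w1: "(norm w)\<^sup>2 \<le> 1/2" by (simp add: power2_eq_square)
    define B where "B = mat2 0 (-1) 1 0 ** A'"
    have B: "B \<in> SL2Z" using A' by (simp add: B_def)
    have den: "n A' \<noteq> 0" using act_denom_nonzero[OF A' t] by (simp add: n_def)
    have "n B = norm (of_int (ea A') * t + of_int (eb A'))" by (simp add: n_def B_def)
    also have "\<dots> = norm w * n A'"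
      using den by (simp add: w_def act_eq n_def norm_divide)
    finally have nB: "n B = norm w * n A'" .
    have "norm w < 1"
    proof (rule ccontr)
      assume "\<not> norm w < 1"
      then have "1\<^sup>2 \<le> (norm w)\<^sup>2" by (intro power_mono) auto
      with w1 show False by simp
    qed
    moreover have "n A' > 0" using den by (simp add: n_def)
    ultimately have "n B < n A'" using nB by simp
    then show False using min[OF B] nA' by simp
  qed
  with A' Re show ?thesis using that by (auto simp: w_def)
qed

lemma Gamma1_subset: "Gamma1 N \<subseteq> SL2Z"
  by (auto simp: Gamma1_def)

lemma Gamma1_quotient:
  assumes A: "A \<in> SL2Z" and B: "B \<in> SL2Z"
    and c: "[ea A = ea B] (mod N)" "[eb A = eb B] (mod N)" "[ec A = ec B] (mod N)" "[ed A = ed B] (mod N)"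
  shows "A ** inv2 B \<in> Gamma1 N"
proof -
  have d: "ea B * ed B - eb B * ec B = 1" using B by (simp add: SL2Z_iff)
  have "[ea A * ed B - eb A * ec B = ea B * ed B - eb B * ec B] (mod N)"
    by (intro cong_diff cong_mult c cong_refl)
  moreover have "[ed A * ea B - ec A * eb B = ed B * ea B - ec B * eb B] (mod N)"
    by (intro cong_diff cong_mult c cong_refl)
  moreover have "[ec A * ed B - ed A * ec B = ec B * ed B - ed B * ec B] (mod N)"
    by (intro cong_diff cong_mult c cong_refl)
  ultimately show ?thesis
    using A B d by (simp add: Gamma1_def mult.commute)
qed

text \<open>Matrices congruent modulo \<open>N\<close> differ by an element of
  \<open>Gamma1 N\<close>. Hence it suffices to study a modular function composed with finitely many
  matrices.\<close>

lemma modular_cong: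
  assumes f: "\<And>A t. A \<in> Gamma1 N \<Longrightarrow> t \<in> HH \<Longrightarrow> f (act A t) = f t" and A: "A \<in> SL2Z" and B: "B \<in> SL2Z"
    and c: "[ea A = ea B] (mod N)" "[eb A = eb B] (mod N)" "[ec A = ec B] (mod N)" "[ed A = ed B] (mod N)"
    and t: "t \<in> HH"
  shows "f (act A t) = f (act B t)"
proof -
  have "f (act (A ** inv2 B) (act B t)) = f (act B t)"
    using f[OF Gamma1_quotient[OF A B c]] B t by simp
  then show ?thesis
    using A B t by (simp add: act_mult)
qed

lemma modular_periodic:
  assumes f: "\<And>A t. A \<in> Gamma1 (int N) \<Longrightarrow> t \<in> HH \<Longrightarrow> f (act A t) = f t" and A: "A \<in> SL2Z" and t: "t \<in> HH"
  shows "f (act A (t + of_nat N)) = f (act A t)"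
proof -
  have "f (act (A ** tmat N) t) = f (act A t)"
    by (rule modular_cong[OF f, where N = "int N"]) (use A t in \<open>auto simp: tmat_def cong_def\<close>)
  then show ?thesis
    using A t by (simp add: act_mult)
qed

text \<open>These representatives stand in for a list of coset representatives and cusps.\<close>

lemma finite_reps:
  assumes "N > (0::int)"
  obtains R where "finite R" "R \<subseteq> SL2Z" "\<And>A. A \<in> SL2Z \<Longrightarrow> \<exists>B\<in>R.
    [ea A = ea B] (mod N) \<and> [eb A = eb B] (mod N) \<and> [ec A = ec B] (mod N) \<and> [ed A = ed B] (mod N)"
proof -
  define \<phi> where "\<phi> = (\<lambda>A. (ea A mod N, eb A mod N, ec A mod N, ed A mod N))"
  have "\<phi> ` SL2Z \<subseteq> {0..<N} \<times> {0..<N} \<times> {0..<N} \<times> {0..<N}"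
    using assms by (auto simp: \<phi>_def)
  then have fin: "finite (\<phi> ` SL2Z)" by (rule finite_subset) auto
  define r where "r = (\<lambda>y. SOME A. A \<in> SL2Z \<and> \<phi> A = y)"
  have r: "r y \<in> SL2Z \<and> \<phi> (r y) = y" if "y \<in> \<phi> ` SL2Z" for y
    unfolding r_def by (rule someI_ex) (use that in auto)
  show ?thesis
  proof (rule that[of "r ` \<phi> ` SL2Z"])
    show "finite (r ` \<phi> ` SL2Z)" using fin by simp
    show "r ` \<phi> ` SL2Z \<subseteq> SL2Z" using r by blast
    fix A assume A: "A \<in> SL2Z"
    have "\<phi> (r (\<phi> A)) = \<phi> A" using r A by simp
    then have "[ea A = ea (r (\<phi> A))] (mod N) \<and> [eb A = eb (r (\<phi> A))] (mod N) \<and>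
        [ec A = ec (r (\<phi> A))] (mod N) \<and> [ed A = ed (r (\<phi> A))] (mod N)"
      by (simp add: \<phi>_def cong_def)
    then show "\<exists>B\<in>r ` \<phi> ` SL2Z. [ea A = ea B] (mod N) \<and> [eb A = eb B] (mod N) \<and> [ec A = ec B] (mod N) \<and> [ed A = ed B] (mod N)"
      using A by blast
  qed
qed

theorem constant_if_bounded_at_cusps:
  assumes f: "f \<in> modular_functions (Gamma1 (int N))" and N: "N > 0" and hol: "f holomorphic_on HH"
    and bdd: "\<And>A. A \<in> SL2Z \<Longrightarrow> \<exists>B. eventually (\<lambda>t. norm (f (act A t)) \<le> B) at_ii_inf"
  shows "\<exists>c. \<forall>t\<in>HH. f t = c"
proof -
  obtain R where R: "finite R" "R \<subseteq> SL2Z" "\<And>A. A \<in> SL2Z \<Longrightarrow> \<exists>B\<in>R.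
    [ea A = ea B] (mod int N) \<and> [eb A = eb B] (mod int N) \<and> [ec A = ec B] (mod int N) \<and> [ed A = ed B] (mod int N)"
    using finite_reps[of "int N"] N by auto
  have "\<exists>F. F holomorphic_on ball 0 1 \<and> (\<forall>t\<in>HH. f (act B t) = F (expi2 (t / of_nat N)))" if "B \<in> R" for B
  proof -
    have B: "B \<in> SL2Z" using that R by auto
    obtain M where M: "eventually (\<lambda>t. norm (f (act B t)) \<le> M) at_ii_inf" using bdd[OF B] by blast
    show ?thesis
      by (rule q_expansion[of "\<lambda>t. f (act B t)" N M, OF holomorphic_act[OF hol B] N _ M])
        (auto simp: modular_periodic[of N f, OF modular_functionsD(4)[OF f] B])
  qed
  then obtain F where F: "\<And>B. B \<in> R \<Longrightarrow> F B holomorphic_on ball 0 1"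
    "\<And>B t. B \<in> R \<Longrightarrow> t \<in> HH \<Longrightarrow> f (act B t) = F B (expi2 (t / of_nat N))"
    by metis
  have ne: "R \<noteq> {}" using R(3)[of "mat 1"] by auto
  have cover: "\<exists>B\<in>R. \<exists>w. Im w \<ge> 1/2 \<and> f z = f (act B w)" if z: "z \<in> HH" for z
  proof -
    obtain A where A: "A \<in> SL2Z" "Im (act A z) \<ge> 1/2" using reduction[OF z] by blast
    obtain B where B: "B \<in> R" "[ea (inv2 A) = ea B] (mod int N)" "[eb (inv2 A) = eb B] (mod int N)"
      "[ec (inv2 A) = ec B] (mod int N)" "[ed (inv2 A) = ed B] (mod int N)"
      using R(3)[of "inv2 A"] A by auto
    have "f (act (inv2 A) (act A z)) = f (act B (act A z))"
      by (rule modular_cong[of "int N" f, OF modular_functionsD(4)[OF f]]) (use A B R z in auto)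
    then show ?thesis using A B z by auto
  qed
  show ?thesis
    by (rule constant_if_bounded_at_cusps_aux[OF R(1) ne R(2) N cover F])
qed

section \<open>Growth at the cusps\<close>

text \<open>The leading term is c q^\<mu>. As c is nonzero, \<open>\<mu>\<close> is the exact order,
  and quotients can be formed; it is real because fractional orders occur at cusps of width greater
  than 1.\<close>

definition asym :: "(complex \<Rightarrow> complex) \<Rightarrow> real \<Rightarrow> bool" where
  "asym f \<mu> \<longleftrightarrow> (\<exists>c. c \<noteq> 0 \<and> ((\<lambda>t. f t * expi2 (- of_real \<mu> * t)) \<longlongrightarrow> c) at_ii_inf)"

lemma asym_cong:
  assumes "asym f \<mu>" "\<And>t. t \<in> HH \<Longrightarrow> f t = g t"
  shows "asym g \<mu>"
proof -
  obtain c where c: "c \<noteq> 0" "((\<lambda>t. f t * expi2 (- of_real \<mu> * t)) \<longlongrightarrow> c) at_ii_inf"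
    using assms(1) unfolding asym_def by blast
  have "eventually (\<lambda>t. f t * expi2 (- of_real \<mu> * t) = g t * expi2 (- of_real \<mu> * t)) at_ii_inf"
    unfolding eventually_at_ii_inf by (intro exI[of _ 0]) (auto simp: assms(2) in_upper_half_plane)
  from Lim_transform_eventually[OF c(2) this] c(1) show ?thesis
    unfolding asym_def by blast
qed

lemma asym_mult:
  assumes "asym f \<mu>" "asym g \<nu>"
  shows "asym (\<lambda>t. f t * g t) (\<mu> + \<nu>)"
proof -
  obtain c d where c: "c \<noteq> 0" "((\<lambda>t. f t * expi2 (- of_real \<mu> * t)) \<longlongrightarrow> c) at_ii_inf"
    and d: "d \<noteq> 0" "((\<lambda>t. g t * expi2 (- of_real \<nu> * t)) \<longlongrightarrow> d) at_ii_inf"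
    using assms unfolding asym_def by blast
  have e: "expi2 (- of_real (\<mu> + \<nu>) * t) = expi2 (- of_real \<mu> * t) * expi2 (- of_real \<nu> * t)" for t
    unfolding expi2_add [symmetric] by (simp add: algebra_simps)
  show ?thesis
    unfolding asym_def e using tendsto_mult[OF c(2) d(2)] c d
    by (intro exI[of _ "c * d"]) (simp add: mult_ac)
qed

lemma asym_inverse:
  assumes "asym f \<mu>"
  shows "asym (\<lambda>t. inverse (f t)) (- \<mu>)"
proof -
  obtain c where c: "c \<noteq> 0" "((\<lambda>t. f t * expi2 (- of_real \<mu> * t)) \<longlongrightarrow> c) at_ii_inf"
    using assms unfolding asym_def by blast
  have e: "expi2 (- of_real (- \<mu>) * t) = inverse (expi2 (- of_real \<mu> * t))" for t
    by (simp add: expi2_minus)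
  show ?thesis
    unfolding asym_def e using tendsto_inverse[OF c(2) c(1)] c(1)
    by (intro exI[of _ "inverse c"]) simp
qed

lemma asym_divide: "asym f \<mu> \<Longrightarrow> asym g \<nu> \<Longrightarrow> asym (\<lambda>t. f t / g t) (\<mu> - \<nu>)"
  using asym_mult[of f \<mu> "\<lambda>t. inverse (g t)" "- \<nu>"] asym_inverse[of g \<nu>] by (simp add: divide_inverse)

lemma asym_power: "asym f \<mu> \<Longrightarrow> asym (\<lambda>t. f t ^ n) (of_nat n * \<mu>)"
proof (induction n)
  case 0
  show ?case unfolding asym_def by (intro exI[of _ 1]) simp
next
  case (Suc n)
  then show ?case using asym_mult[of f \<mu> "\<lambda>t. f t ^ n" "of_nat n * \<mu>"] by (simp add: algebra_simps)
qed

lemma asym_affine: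
  assumes "asym f \<mu>" "x > 0"
  shows "asym (\<lambda>t. f (of_real x * t + of_real y)) (x * \<mu>)"
proof -
  obtain c where c: "c \<noteq> 0" "((\<lambda>t. f t * expi2 (- of_real \<mu> * t)) \<longlongrightarrow> c) at_ii_inf"
    using assms unfolding asym_def by blast
  have "filterlim (\<lambda>t. of_real x * t + of_real y) at_ii_inf at_ii_inf"
    unfolding filterlim_iff
  proof (intro allI impI)
    fix P assume "eventually P at_ii_inf"
    then obtain d where d: "\<And>t. Im t > d \<Longrightarrow> P t" unfolding eventually_at_ii_inf by blast
    show "eventually (\<lambda>t. P (of_real x * t + of_real y)) at_ii_inf"
      unfolding eventually_at_ii_inf
      using assms(2) by (intro exI[of _ "d / x"]) (auto intro!: d simp: field_simps)
  qed
  from filterlim_compose[OF c(2) this]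
  have "((\<lambda>t. f (of_real x * t + of_real y) * expi2 (- of_real \<mu> * (of_real x * t + of_real y)) * expi2 (of_real (\<mu> * y)))
      \<longlongrightarrow> c * expi2 (of_real (\<mu> * y))) at_ii_inf"
    by (intro tendsto_mult tendsto_const)
  moreover have "expi2 (- of_real \<mu> * (of_real x * t + of_real y)) * expi2 (of_real (\<mu> * y)) = expi2 (- of_real (x * \<mu>) * t)" for t
    unfolding expi2_add [symmetric] by (rule arg_cong[of _ _ expi2]) (simp add: algebra_simps)
  ultimately show ?thesis
    unfolding asym_def using c(1) by (intro exI[of _ "c * expi2 (of_real (\<mu> * y))"]) (simp add: mult.assoc)
qed

lemma asym_bounded_shift:
  assumes "asym f \<mu>" "\<mu> + m \<ge> 0"
  shows "\<exists>B. eventually (\<lambda>t. norm (f t * expi2 (of_real m * t)) \<le> B) at_ii_inf"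
proof -
  obtain c where c: "c \<noteq> 0" "((\<lambda>t. f t * expi2 (- of_real \<mu> * t)) \<longlongrightarrow> c) at_ii_inf"
    using assms unfolding asym_def by blast
  have "eventually (\<lambda>t. norm (f t * expi2 (- of_real \<mu> * t)) < norm c + 1) at_ii_inf"
    using order_tendstoD(2)[OF tendsto_norm[OF c(2)], of "norm c + 1"] by simp
  moreover have "eventually (\<lambda>t. Im t > 0) at_ii_inf"
    unfolding eventually_at_ii_inf by blast
  ultimately have "eventually (\<lambda>t. norm (f t * expi2 (of_real m * t)) \<le> norm c + 1) at_ii_inf"
  proof eventually_elim
    case (elim t)
    have e: "expi2 (of_real m * t) = expi2 (- of_real \<mu> * t) * expi2 (of_real (\<mu> + m) * t)"
      unfolding expi2_add [symmetric] by (rule arg_cong[of _ _ expi2]) (simp add: algebra_simps)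
    have "norm (expi2 (of_real (\<mu> + m) * t)) \<le> 1"
      using elim assms(2) by (simp add: norm_expi2)
    then have "norm (f t * expi2 (- of_real \<mu> * t)) * norm (expi2 (of_real (\<mu> + m) * t)) \<le> (norm c + 1) * 1"
      using elim by (intro mult_mono) auto
    then show ?case unfolding e by (simp add: norm_mult mult.assoc)
  qed
  then show ?thesis by blast
qed

lemma asym_bounded:
  assumes "asym f \<mu>" "\<mu> \<ge> 0"
  shows "\<exists>B. eventually (\<lambda>t. norm (f t) \<le> B) at_ii_inf"
  using asym_bounded_shift[of f \<mu> 0] assms by simp

lemma expansion_of_asym:
  assumes f: "f holomorphic_on HH" and h: "h > 0"
    and per: "\<And>t. t \<in> HH \<Longrightarrow> f (t + of_nat h) = f t"
    and bdd: "eventually (\<lambda>t. norm (f t * expi2 (of_real (of_nat m / of_nat h) * t)) \<le> B) at_ii_inf"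
  obtains F where "F holomorphic_on ball 0 1"
    "\<And>t. t \<in> HH \<Longrightarrow> f t = F (expi2 (t / of_nat h)) / expi2 (t / of_nat h) ^ m"
proof -
  define g where "g = (\<lambda>t. f t * expi2 (of_real (of_nat m / of_nat h) * t))"
  have e: "expi2 (of_real (of_nat m / of_nat h) * t) = expi2 (t / of_nat h) ^ m" for t
    by (simp add: expi2_power)
  have 1: "g holomorphic_on HH" unfolding g_def by (intro holomorphic_intros f)
  have 2: "g (t + of_nat h) = g t" if "t \<in> HH" for t
  proof -
    have "expi2 ((t + of_nat h) / of_nat h) = expi2 (t / of_nat h)"
      using h by (simp add: add_divide_distrib expi2_add)
    then show ?thesis
      unfolding g_def e per[OF that] by simp
  qed
  have 3: "eventually (\<lambda>t. norm (g t) \<le> B) at_ii_inf"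
    using bdd by (simp add: g_def)
  obtain F where F: "F holomorphic_on ball 0 1" "\<And>t. t \<in> HH \<Longrightarrow> g t = F (expi2 (t / of_nat h))"
    by (rule q_expansion[OF 1 h 2 3]) (assumption, (rule that; assumption))
  show ?thesis
  proof (rule that[OF F(1)])
    fix t assume "t \<in> HH"
    then show "f t = F (expi2 (t / of_nat h)) / expi2 (t / of_nat h) ^ m"
      using F(2)[of t] unfolding g_def e by (simp add: eq_divide_eq)
  qed
qed

lemma meromorphic_at_ii_inf_asym:
  assumes f: "f holomorphic_on HH" and h: "h > 0"
    and per: "\<And>t. t \<in> HH \<Longrightarrow> f (t + of_nat h) = f t" and as: "asym f \<mu>"
  shows "meromorphic_at_ii_inf f"
proof -
  \<comment> \<open>A power of the local parameter that cancels the pole: the order is rounded up to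
    a multiple of 1/h, with value 0 if there is no pole.\<close>
  define m where "m = nat \<lceil>- \<mu> * of_nat h\<rceil>"
  have "- \<mu> * of_nat h \<le> of_nat m"
    unfolding m_def by linarith
  then have "\<mu> + of_nat m / of_nat h \<ge> 0"
    using h by (simp add: field_simps)
  from asym_bounded_shift[OF as this] obtain B where
    B: "eventually (\<lambda>t. norm (f t * expi2 (of_real (of_nat m / of_nat h) * t)) \<le> B) at_ii_inf" by blast
  obtain F where F: "F holomorphic_on ball 0 1"
    "\<And>t. t \<in> HH \<Longrightarrow> f t = F (expi2 (t / of_nat h)) / expi2 (t / of_nat h) ^ m"
    using expansion_of_asym[OF f h per B] by blast
  show ?thesis
    unfolding meromorphic_at_ii_inf_def
  proof (intro exI conjI allI impI)
    show "h > 0" by fact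
    have "F analytic_on {0}"
      using F(1) by (meson centre_in_ball holomorphic_on_imp_analytic_at open_ball zero_less_one)
    then show "(\<lambda>x. F x / x ^ m) meromorphic_on {0}"
      by (intro meromorphic_intros analytic_on_imp_meromorphic_on)
    fix t :: complex assume "Im t > 0"
    then show "f t = F (exp (2 * of_real pi * \<i> * t / of_nat h)) / exp (2 * of_real pi * \<i> * t / of_nat h) ^ m"
      using F(2)[of t] by (simp add: in_upper_half_plane expi2_def)
  qed
qed

lemma modular_functions_asymI:
  assumes f: "f holomorphic_on HH" and out: "\<And>t. t \<notin> HH \<Longrightarrow> f t = 0" and N: "N > 0"
    and inv: "\<And>A t. A \<in> Gamma1 (int N) \<Longrightarrow> t \<in> HH \<Longrightarrow> f (act A t) = f t"
    and as: "\<And>A. A \<in> SL2Z \<Longrightarrow> \<exists>\<mu>. asym (\<lambda>t. f (act A t)) \<mu>"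
  shows "f \<in> modular_functions (Gamma1 (int N))"
  unfolding modular_functions_def
proof safe
  show "f nicely_meromorphic_on HH"
    using f by (intro analytic_on_imp_nicely_meromorphic_on) (simp add: analytic_on_open)
  show "meromorphic_at_ii_inf (\<lambda>t. f (act A t))" if A: "A \<in> SL2Z" for A
  proof -
    obtain \<mu> where "asym (\<lambda>t. f (act A t)) \<mu>" using as[OF A] by blast
    then show ?thesis
      by (rule meromorphic_at_ii_inf_asym[OF holomorphic_act[OF f A] N, rotated])
        (rule modular_periodic[of N f, OF inv A])
  qed
qed (use out inv in auto)

section \<open>Level 7 forms at an arbitrary cusp\<close>

text \<open>The matrix of determinant \<open>N\<close> that first applies \<open>A\<close> and then
  multiplies by \<open>N\<close> is factored as a unimodular matrix times an upper triangular one
  with rows (x, y) and (0, w), x w = N. The unimodular factor is then handled by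
  \<open>kl_modular\<close>, and the triangular one only rescales the order.\<close>

lemma scaled_act:
  assumes A: "A \<in> SL2Z" and N: "N > (0::int)"
  obtains a' b' c' d' x y w where "a' * d' - b' * c' = 1" "x > 0" "w > 0"
    "x = gcd (N * ea A) (ec A)" "N * ea A = a' * x"
    "\<And>t. t \<in> HH \<Longrightarrow> of_int N * act A t =
       (of_int a' * ((of_int x * t + of_int y) / of_int w) + of_int b') /
       (of_int c' * ((of_int x * t + of_int y) / of_int w) + of_int d')"
proof -
  define x where "x = gcd (N * ea A) (ec A)"
  have det: "ea A * ed A - eb A * ec A = 1" using A by (simp add: SL2Z_iff)
  have x: "x > 0"
  proof -
    have "N * ea A \<noteq> 0 \<or> ec A \<noteq> 0" using det N by auto
    then show ?thesis unfolding x_def by simp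
  qed
  define a' c' where "a' = N * ea A div x" "c' = ec A div x"
  have a: "N * ea A = a' * x" and c: "ec A = c' * x"
    unfolding a'_c'_def by (simp_all add: x_def)
  have "coprime a' c'"
    unfolding a'_c'_def x_def by (rule div_gcd_coprime) (use det N in auto)
  then obtain d' b0 where "d' * a' + b0 * c' = 1"
    using bezout_int[of a' c'] by (auto simp: coprime_iff_gcd_eq_1)
  then have det': "a' * d' - (- b0) * c' = 1" by (simp add: algebra_simps)
  define b' where "b' = - b0"
  have det': "a' * d' - b' * c' = 1" using det' by (simp add: b'_def)
  define w y where "w = a' * ed A - c' * N * eb A" "y = d' * N * eb A - b' * ed A"
  have "x * w = N * (ea A * ed A - eb A * ec A)"
    unfolding w_y_def using a c by (simp add: algebra_simps)
  then have xw: "x * w = N" using det by simp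
  have w: "w > 0"
    using xw x N by (metis zero_less_mult_pos)
  have 1: "a' * y + b' * w = (a' * d' - b' * c') * (N * eb A)"
    unfolding w_y_def by (simp add: algebra_simps)
  have 2: "c' * y + d' * w = (a' * d' - b' * c') * ed A"
    unfolding w_y_def by (simp add: algebra_simps)
  have "of_int N * act A t =
       (of_int a' * ((of_int x * t + of_int y) / of_int w) + of_int b') /
       (of_int c' * ((of_int x * t + of_int y) / of_int w) + of_int d')" if t: "t \<in> HH" for t
  proof -
    have w0: "complex_of_int w \<noteq> 0" using w by simp
    have "of_int a' * ((of_int x * t + of_int y) / of_int w) + of_int b' =
        (of_int (a' * x) * t + of_int (a' * y + b' * w)) / of_int w"
      using w0 by (simp add: field_simps)
    also have "\<dots> = of_int N * (of_int (ea A) * t + of_int (eb A)) / of_int w"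
      unfolding 1 det' a [symmetric] by (simp add: algebra_simps)
    finally have n: "of_int a' * ((of_int x * t + of_int y) / of_int w) + of_int b' = \<dots>" .
    have "of_int c' * ((of_int x * t + of_int y) / of_int w) + of_int d' =
        (of_int (c' * x) * t + of_int (c' * y + d' * w)) / of_int w"
      using w0 by (simp add: field_simps)
    also have "\<dots> = (of_int (ec A) * t + of_int (ed A)) / of_int w"
      unfolding 2 det' c [symmetric] by simp
    finally have d: "of_int c' * ((of_int x * t + of_int y) / of_int w) + of_int d' = \<dots>" .
    show ?thesis
      unfolding n d act_eq using w0 by simp
  qed
  then show ?thesis
    using that[OF det' x w x_def a] by blast
qed

text \<open>Applied with \<open>7 * N\<close>, since \<open>V\<close> is evaluated over the lattice
  of \<open>7 * t\<close>. The entries \<open>a'\<close> and \<open>b'\<close> cannot both be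
  divisible by 7, as the determinant is 1; so the forms that occur do not vanish. Again
  \<open>C\<close> is common to all \<open>j\<close>.\<close>

lemma V_scaled_act:
  assumes A: "A \<in> SL2Z" and N: "N > (0::int)"
  obtains a' b' x y w where "x > 0" "w > 0" "x = gcd (7 * N * ea A) (ec A)" "7 * N * ea A = a' * x"
    "\<And>j. \<not> 7 dvd j \<Longrightarrow> \<not> (of_int (j * a') / 7 \<in> (\<int> :: real set) \<and> of_int (j * b') / 7 \<in> (\<int> :: real set))"
    "\<And>t. t \<in> HH \<Longrightarrow> \<exists>C. C \<noteq> 0 \<and> (\<forall>j. V j (of_int N * act A t) =
       C * kl (of_int (j * a') / 7) (of_int (j * b') / 7) (of_real (of_int x / of_int w) * t + of_real (of_int y / of_int w)))"
proof -
  have N7: "7 * N > 0" using N by simp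
  obtain a' b' c' d' x y w where *: "a' * d' - b' * c' = 1" "x > 0" "w > 0"
    "x = gcd (7 * N * ea A) (ec A)" "7 * N * ea A = a' * x"
    "\<And>t. t \<in> HH \<Longrightarrow> of_int (7 * N) * act A t =
       (of_int a' * ((of_int x * t + of_int y) / of_int w) + of_int b') /
       (of_int c' * ((of_int x * t + of_int y) / of_int w) + of_int d')"
    by (rule scaled_act[OF A N7]) (rule that; assumption)
  show ?thesis
  proof (rule that[of x w a' b' y])
    fix j :: int assume j: "\<not> 7 dvd j"
    show "\<not> (of_int (j * a') / 7 \<in> (\<int> :: real set) \<and> of_int (j * b') / 7 \<in> (\<int> :: real set))"
    proof
      assume "of_int (j * a') / 7 \<in> (\<int> :: real set) \<and> of_int (j * b') / 7 \<in> (\<int> :: real set)"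
      then have "7 dvd j * a'" "7 dvd j * b'"
        using of_int_divide_in_Ints_iff[of 7 "j * a'"] of_int_divide_in_Ints_iff[of 7 "j * b'"] by simp_all
      moreover have "prime (7::int)" by simp
      ultimately have "7 dvd a'" "7 dvd b'" using j prime_dvd_mult_iff by blast+
      then have "7 dvd a' * d' - b' * c'" by simp
      then show False using *(1) by simp
    qed
  next
    fix t assume t: "t \<in> HH"
    define T where "T = (of_int x * t + of_int y) / of_int w"
    have T: "T = of_real (of_int x / of_int w) * t + of_real (of_int y / of_int w)"
      by (simp add: T_def add_divide_distrib)
    have "Im T > 0"
      unfolding T using t *(2,3) by (simp add: in_upper_half_plane)
    from kl_modular[OF this *(1)] obtain C where C: "C \<noteq> 0"
      "\<And>r s. kl r s ((of_int a' * T + of_int b') / (of_int c' * T + of_int d')) =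
       C * kl (r * of_int a' + s * of_int c') (r * of_int b' + s * of_int d') T" by blast
    have "V j (of_int N * act A t) = C * kl (of_int (j * a') / 7) (of_int (j * b') / 7) T" for j
      using C(2)[of "of_int j / 7" 0] *(6)[OF t] by (simp add: V_def T_def [symmetric] mult.assoc)
    then show "\<exists>C. C \<noteq> 0 \<and> (\<forall>j. V j (of_int N * act A t) =
       C * kl (of_int (j * a') / 7) (of_int (j * b') / 7) (of_real (of_int x / of_int w) * t + of_real (of_int y / of_int w)))"
      unfolding T using C(1) by blast
  qed (fact *)+
qed

lemma asym_kl:
  assumes "\<not> (r \<in> \<int> \<and> s \<in> \<int>)" "x > 0"
  shows "asym (\<lambda>t. kl r s (of_real x * t + of_real y)) (x * lam r)"
  using asym_affine[of "kl r s" "lam r" x y] kl_asymp[OF assms(1)] assms(2) by (simp add: asym_def)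

lemma lam_int_divide_7: "lam (of_int n / 7) = - of_int ((n mod 7) * (7 - n mod 7)) / 98"
proof -
  have "of_int n = 7 * of_int (n div 7) + (of_int (n mod 7) :: real)"
    by (metis mult_div_mod_eq of_int_add of_int_mult of_int_numeral)
  then have f: "frac (of_int n / 7 :: real) = of_int (n mod 7) / 7"
    using floor_divide_of_int_eq[of n 7, where ?'a = real] by (simp add: frac_def field_simps)
  show ?thesis
    unfolding lam_def f by (simp add: field_simps power2_eq_square)
qed

section \<open>Invariance of the two generators\<close>

text \<open>\<open>7 * act A t\<close> is the image of \<open>7 * t\<close> under the matrix with
  rows (a, 7 b) and (c / 7, d). It sends the point (j/7, 0) to itself plus an integral vector, so
  \<open>kl_shift\<close> leaves a sign and a 14th root of unity.\<close>

lemma V_Gamma1: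
  assumes A: "A \<in> Gamma1 7" and t: "t \<in> HH" and \<alpha>: "ea A = 1 + 7 * \<alpha>"
  obtains C where "C \<noteq> 0" "\<And>j. V j (act A t) =
    C * ((-1) powi (j * \<alpha> + j * eb A + j * \<alpha> * (j * eb A)) * expi2 (of_int (j * j * eb A) / 14)) * V j t"
proof -
  have det: "ea A * ed A - eb A * ec A = 1" using A by (simp add: Gamma1_def SL2Z_iff)
  have "7 dvd ec A" using A by (simp add: Gamma1_def cong_0_iff)
  then obtain c where c: "ec A = 7 * c" by blast
  have det': "ea A * ed A - (7 * eb A) * c = 1" using det c by simp
  have t7: "Im (7 * t) > 0" using t by (simp add: in_upper_half_plane)
  obtain C where C: "C \<noteq> 0"
    "\<And>r s. kl r s ((of_int (ea A) * (7 * t) + of_int (7 * eb A)) / (of_int c * (7 * t) + of_int (ed A))) =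
       C * kl (r * of_int (ea A) + s * of_int c) (r * of_int (7 * eb A) + s * of_int (ed A)) (7 * t)"
    using kl_modular[OF t7 det'] by blast
  have arg: "7 * act A t = (of_int (ea A) * (7 * t) + of_int (7 * eb A)) / (of_int c * (7 * t) + of_int (ed A))"
    unfolding act_eq c by (simp add: algebra_simps)
  have "V j (act A t) =
    C * ((-1) powi (j * \<alpha> + j * eb A + j * \<alpha> * (j * eb A)) * expi2 (of_int (j * j * eb A) / 14)) * V j t" for j
  proof -
    have "V j (act A t) = C * kl (of_int j / 7 * of_int (ea A) + 0 * of_int c) (of_int j / 7 * of_int (7 * eb A) + 0 * of_int (ed A)) (7 * t)"
      unfolding V_def arg C(2) ..
    also have "of_int j / 7 * of_int (ea A) + 0 * of_int c = of_int j / 7 + real_of_int (j * \<alpha>)"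
      by (simp add: \<alpha> field_simps)
    also have "of_int j / 7 * of_int (7 * eb A) + 0 * of_int (ed A) = 0 + real_of_int (j * eb A)"
      by simp
    also have "kl (of_int j / 7 + of_int (j * \<alpha>)) (0 + of_int (j * eb A)) (7 * t) =
      (-1) powi (j * \<alpha> + j * eb A + j * \<alpha> * (j * eb A)) * expi2 (of_real (of_int j / 7 * of_int (j * eb A) - of_int (j * \<alpha>) * 0) / 2) * V j t"
      unfolding V_def by (rule kl_shift[OF t7])
    also have "complex_of_real (of_int j / 7 * of_int (j * eb A) - of_int (j * \<alpha>) * 0) / 2 = of_int (j * j * eb A) / 14"
      by simp
    finally show ?thesis by (simp only: mult_ac)
  qed
  with C(1) that show ?thesis by blast
qed

text \<open>The root of unity in \<open>V j\<close> has exponent j^2, and 2 * 4 + 9 - 3 * 1 = 14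
  makes the total trivial. The sign occurs for odd \<open>j\<close> only, with exponent 1 - 3 =
  -2.\<close>

lemma upsilon_invariant:
  assumes A: "A \<in> Gamma1 7" and t: "t \<in> HH"
  shows "upsilon (act A t) = upsilon t"
proof -
  have S: "A \<in> SL2Z" using A by (simp add: Gamma1_def)
  have "7 dvd ea A - 1" using A by (simp add: Gamma1_def cong_iff_dvd_diff)
  then obtain \<alpha> where \<alpha>: "ea A = 1 + 7 * \<alpha>" by (metis add.commute diff_add_cancel dvdE)
  obtain C where C: "C \<noteq> 0" "\<And>j. V j (act A t) =
    C * ((-1) powi (j * \<alpha> + j * eb A + j * \<alpha> * (j * eb A)) * expi2 (of_int (j * j * eb A) / 14)) * V j t"
    using V_Gamma1[OF A t \<alpha>] by blast
  define b where "b = eb A"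
  define E where "E = expi2 (of_int b / 14)"
  have e: "expi2 (of_int (j * j * eb A) / 14) = E ^ nat (j * j)" if "j \<ge> 0" for j
    unfolding E_def expi2_power b_def using that by (simp add: mult_ac)
  define s :: complex where "s = (-1) powi (\<alpha> + b + \<alpha> * b)"
  have s2: "s * s = 1" by (simp add: s_def minus_one_powi_parity)
  have E14: "E ^ 14 = 1" by (simp add: E_def expi2_power)
  have V1: "V 1 (act A t) = C * (s * E) * V 1 t" using C(2)[of 1] e[of 1] by (simp add: s_def b_def)
  have V2: "V 2 (act A t) = C * E ^ 4 * V 2 t" using C(2)[of 2] e[of 2] by (simp add: minus_one_powi_parity)
  have V3: "V 3 (act A t) = C * (s * E ^ 9) * V 3 t"
    using C(2)[of 3] e[of 3] by (simp add: s_def b_def minus_one_powi_parity)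
  have EE: "E \<noteq> 0" "s \<noteq> 0" using s2 by (auto simp: E_def)
  have It: "Im t > 0" "Im (act A t) > 0" using t act_in_upper_half_plane[OF S t] by (simp_all add: in_upper_half_plane)
  have "upsilon (act A t) = (C * E ^ 4 * V 2 t)\<^sup>2 * (C * (s * E ^ 9) * V 3 t) / (C * (s * E) * V 1 t) ^ 3"
    unfolding upsilon_eq[OF It(2)] V1 V2 V3 ..
  also have "\<dots> = E ^ 14 * ((V 2 t)\<^sup>2 * V 3 t / (V 1 t) ^ 3) / (s * s)"
    using C(1) EE V_nonzero[OF It(1), of 1] by (simp add: field_simps eval_nat_numeral)
  also have "\<dots> = upsilon t"
    unfolding upsilon_eq[OF It(1)] E14 s2 by simp
  finally show ?thesis .
qed

lemma V_quotient_Gamma1: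
  assumes A: "A \<in> Gamma1 7" and t: "t \<in> HH" and \<alpha>: "ea A = 1 + 7 * \<alpha>"
  shows "V 3 (act A t) / V 2 (act A t) =
    (-1) powi (\<alpha> + eb A + \<alpha> * eb A) * expi2 (5 * of_int (eb A) / 14) * (V 3 t / V 2 t)"
proof -
  obtain C where C: "C \<noteq> 0" "\<And>j. V j (act A t) =
    C * ((-1) powi (j * \<alpha> + j * eb A + j * \<alpha> * (j * eb A)) * expi2 (of_int (j * j * eb A) / 14)) * V j t"
    using V_Gamma1[OF A t \<alpha>] by blast
  have V2: "V 2 (act A t) = C * expi2 (4 * of_int (eb A) / 14) * V 2 t"
    using C(2)[of 2] by (simp add: minus_one_powi_parity)
  have "9 * of_int (eb A) / 14 = 5 * of_int (eb A) / 14 + 4 * of_int (eb A) / (14 :: complex)" by simp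
  then have "expi2 (9 * of_int (eb A) / 14) = expi2 (5 * of_int (eb A) / 14) * expi2 (4 * of_int (eb A) / 14)"
    by (simp only: expi2_add)
  then have V3: "V 3 (act A t) = C * ((-1) powi (\<alpha> + eb A + \<alpha> * eb A) * (expi2 (5 * of_int (eb A) / 14) * expi2 (4 * of_int (eb A) / 14))) * V 3 t"
    using C(2)[of 3] by (simp add: minus_one_powi_parity)
  show ?thesis
    unfolding V2 V3 using C(1) by simp
qed

text \<open>\<open>phi1\<close> picks up a character that depends on the upper right entry; doubling
  the argument doubles this entry and so squares the root of unity. This is why the square of
  \<open>phi1\<close> is divided by its value at \<open>2 * t\<close>.\<close>

lemma g1_invariant:
  assumes A: "A \<in> Gamma1 14" and t: "t \<in> HH"
  shows "g1 (act A t) = g1 t"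
proof -
  have S: "A \<in> SL2Z" using A by (simp add: Gamma1_def)
  have det: "ea A * ed A - eb A * ec A = 1" using S by (simp add: SL2Z_iff)
  have "14 dvd ea A - 1" using A by (simp add: Gamma1_def cong_iff_dvd_diff)
  then obtain \<beta> where \<beta>: "ea A = 1 + 14 * \<beta>" by (metis add.commute diff_add_cancel dvdE)
  have "14 dvd ec A" using A by (simp add: Gamma1_def cong_0_iff)
  then obtain c where c: "ec A = 14 * c" by blast
  have d: "14 dvd ed A - 1" using A by (simp add: Gamma1_def cong_iff_dvd_diff)
  have d7: "7 dvd ed A - 1" using d dvd_trans[of 7 14] by auto
  have A7: "A \<in> Gamma1 7"
    using S d7 by (simp add: Gamma1_def cong_iff_dvd_diff \<beta> c cong_0_iff)
  \<comment> \<open>The conjugate of \<open>A\<close> by the doubling map. Its lower left entry is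
    an integer divisible by 7 because that of \<open>A\<close> is divisible by 14.\<close>
  define B where "B = mat2 (ea A) (2 * eb A) (7 * c) (ed A)"
  have B: "B \<in> Gamma1 7"
    using det d7 by (simp add: Gamma1_def B_def cong_iff_dvd_diff \<beta> c cong_0_iff algebra_simps)
  have t2: "2 * t \<in> HH" using t by (simp add: in_upper_half_plane)
  have act: "2 * act A t = act B (2 * t)"
    unfolding act_eq B_def by (simp add: c algebra_simps)
  have q1: "V 3 (act A t) / V 2 (act A t) =
    (-1) powi (2 * \<beta> + eb A + 2 * \<beta> * eb A) * expi2 (5 * of_int (eb A) / 14) * (V 3 t / V 2 t)"
    using V_quotient_Gamma1[OF A7 t, of "2 * \<beta>"] \<beta> by simp
  have q2: "V 3 (act B (2 * t)) / V 2 (act B (2 * t)) =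
    expi2 (5 * of_int (2 * eb A) / 14) * (V 3 (2 * t) / V 2 (2 * t))"
    using V_quotient_Gamma1[OF B t2, of "2 * \<beta>"] \<beta> by (simp add: B_def minus_one_powi_parity)
  have e: "(expi2 (5 * of_int (eb A) / 14))\<^sup>2 = expi2 (5 * of_int (2 * eb A) / 14)"
    by (simp add: expi2_power)
  have s: "((-1) powi n :: complex)\<^sup>2 = 1" for n by (simp add: minus_one_powi_parity)
  have It: "Im t > 0" "Im (act A t) > 0" using t act_in_upper_half_plane[OF S t] by (simp_all add: in_upper_half_plane)
  show ?thesis
    unfolding g1_eq[OF It(2)] g1_eq[OF It(1)] act q1 q2 power_mult_distrib e s by simp
qed

section \<open>Orders of the two generators at the cusps\<close>

lemma asym_V_quotient:
  assumes A: "A \<in> SL2Z" and N: "N > (0::int)"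
  shows "\<exists>\<mu>. asym (\<lambda>t. V 3 (of_int N * act A t) / V 2 (of_int N * act A t)) \<mu>"
proof -
  obtain a' b' x y w where *: "x > 0" "w > 0"
    "\<And>j. \<not> 7 dvd j \<Longrightarrow> \<not> (of_int (j * a') / 7 \<in> (\<int> :: real set) \<and> of_int (j * b') / 7 \<in> (\<int> :: real set))"
    "\<And>t. t \<in> HH \<Longrightarrow> \<exists>C. C \<noteq> 0 \<and> (\<forall>j. V j (of_int N * act A t) =
       C * kl (of_int (j * a') / 7) (of_int (j * b') / 7) (of_real (of_int x / of_int w) * t + of_real (of_int y / of_int w)))"
    by (rule V_scaled_act[OF A N]) (rule that; assumption)
  define T where "T = (\<lambda>t. of_real (of_int x / of_int w) * t + complex_of_real (of_int y / of_int w))"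
  define k where "k = (\<lambda>j t. kl (of_int (j * a') / 7) (of_int (j * b') / 7) (T t))"
  have as: "asym (k j) (of_int x / of_int w * lam (of_int (j * a') / 7))" if "\<not> 7 dvd j" for j
    unfolding k_def T_def using *(1,2) by (intro asym_kl *(3) that) auto
  have "asym (\<lambda>t. k 3 t / k 2 t) (of_int x / of_int w * lam (of_int (3 * a') / 7) - of_int x / of_int w * lam (of_int (2 * a') / 7))"
    by (intro asym_divide as) auto
  then have "asym (\<lambda>t. V 3 (of_int N * act A t) / V 2 (of_int N * act A t))
    (of_int x / of_int w * lam (of_int (3 * a') / 7) - of_int x / of_int w * lam (of_int (2 * a') / 7))"
  proof (rule asym_cong)
    fix t assume "t \<in> HH"
    then obtain C where "C \<noteq> 0" "\<And>j. V j (of_int N * act A t) = C * k j t"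
      using *(4) unfolding k_def T_def by blast
    then show "k 3 t / k 2 t = V 3 (of_int N * act A t) / V 2 (of_int N * act A t)" by simp
  qed
  then show ?thesis by blast
qed

lemma g1_asym:
  assumes A: "A \<in> SL2Z"
  shows "\<exists>\<mu>. asym (\<lambda>t. g1 (act A t)) \<mu>"
proof -
  obtain \<mu> \<nu> where "asym (\<lambda>t. V 3 (act A t) / V 2 (act A t)) \<mu>"
    "asym (\<lambda>t. V 3 (2 * act A t) / V 2 (2 * act A t)) \<nu>"
    using asym_V_quotient[OF A, of 1] asym_V_quotient[OF A, of 2] by auto
  then have "asym (\<lambda>t. (V 3 (act A t) / V 2 (act A t)) ^ 2 / (V 3 (2 * act A t) / V 2 (2 * act A t))) (of_nat 2 * \<mu> - \<nu>)"
    by (intro asym_divide[OF asym_power])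
  then have "asym (\<lambda>t. g1 (act A t)) (of_nat 2 * \<mu> - \<nu>)"
  proof (rule asym_cong)
    fix t assume "t \<in> HH"
    then have "Im (act A t) > 0" using act_in_upper_half_plane[OF A] by (simp add: in_upper_half_plane)
    then show "(V 3 (act A t) / V 2 (act A t)) ^ 2 / (V 3 (2 * act A t) / V 2 (2 * act A t)) = g1 (act A t)"
      by (simp only: g1_eq)
  qed
  then show ?thesis by blast
qed

text \<open>The factor x/w is positive, so the sign of the order is determined by \<open>a'\<close>
  modulo 7.\<close>

lemma upsilon_asym:
  assumes A: "A \<in> SL2Z"
  obtains a' x w where "x > 0" "w > 0" "x = gcd (7 * ea A) (ec A)" "7 * ea A = a' * x"
    "asym (\<lambda>t. upsilon (act A t)) (of_int x / of_int w *
       (2 * lam (of_int (2 * a') / 7) + lam (of_int (3 * a') / 7) - 3 * lam (of_int a' / 7)))"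
proof -
  obtain a' b' x y w where *: "x > 0" "w > 0" "x = gcd (7 * 1 * ea A) (ec A)" "7 * 1 * ea A = a' * x"
    "\<And>j. \<not> 7 dvd j \<Longrightarrow> \<not> (of_int (j * a') / 7 \<in> (\<int> :: real set) \<and> of_int (j * b') / 7 \<in> (\<int> :: real set))"
    "\<And>t. t \<in> HH \<Longrightarrow> \<exists>C. C \<noteq> 0 \<and> (\<forall>j. V j (of_int 1 * act A t) =
       C * kl (of_int (j * a') / 7) (of_int (j * b') / 7) (of_real (of_int x / of_int w) * t + of_real (of_int y / of_int w)))"
    by (rule V_scaled_act[OF A zero_less_one]) (rule that; assumption)
  define T where "T = (\<lambda>t. of_real (of_int x / of_int w) * t + complex_of_real (of_int y / of_int w))"
  define k where "k = (\<lambda>j t. kl (of_int (j * a') / 7) (of_int (j * b') / 7) (T t))"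
  have as: "asym (k j) (of_int x / of_int w * lam (of_int (j * a') / 7))" if "\<not> 7 dvd j" for j
    unfolding k_def T_def using *(1,2) by (intro asym_kl *(5) that) auto
  have "asym (\<lambda>t. k 2 t ^ 2 * k 3 t / k 1 t ^ 3)
    (of_nat 2 * (of_int x / of_int w * lam (of_int (2 * a') / 7)) + of_int x / of_int w * lam (of_int (3 * a') / 7) -
     of_nat 3 * (of_int x / of_int w * lam (of_int (1 * a') / 7)))"
    by (intro asym_divide asym_mult asym_power as) auto
  moreover have "of_nat 2 * (of_int x / of_int w * lam (of_int (2 * a') / 7)) + of_int x / of_int w * lam (of_int (3 * a') / 7) -
     of_nat 3 * (of_int x / of_int w * lam (of_int (1 * a') / 7)) =
     of_int x / of_int w * (2 * lam (of_int (2 * a') / 7) + lam (of_int (3 * a') / 7) - 3 * lam (of_int a' / 7))"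
    by (simp add: algebra_simps)
  ultimately have "asym (\<lambda>t. k 2 t ^ 2 * k 3 t / k 1 t ^ 3) (of_int x / of_int w * (2 * lam (of_int (2 * a') / 7) + lam (of_int (3 * a') / 7) - 3 * lam (of_int a' / 7)))"
    by simp
  then have "asym (\<lambda>t. upsilon (act A t)) (of_int x / of_int w * (2 * lam (of_int (2 * a') / 7) + lam (of_int (3 * a') / 7) - 3 * lam (of_int a' / 7)))"
  proof (rule asym_cong)
    fix t assume t: "t \<in> HH"
    obtain C where C: "C \<noteq> 0" "\<And>j. V j (act A t) = C * k j t"
      using *(6)[OF t] unfolding k_def T_def by auto
    have "Im (act A t) > 0" using act_in_upper_half_plane[OF A t] by (simp add: in_upper_half_plane)
    then show "k 2 t ^ 2 * k 3 t / k 1 t ^ 3 = upsilon (act A t)"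
      unfolding upsilon_eq[OF \<open>Im (act A t) > 0\<close>] C(2) using C(1) by (simp add: field_simps eval_nat_numeral)
  qed
  moreover have "x = gcd (7 * ea A) (ec A)" "7 * ea A = a' * x"
    using *(3,4) by (simp_all only: mult_1_right)
  ultimately show ?thesis
    using that[OF *(1,2)] by blast
qed

text \<open>The bracket in the order of \<open>upsilon\<close> equals 0, 0, 1/7 for
  \<open>a'\<close> congruent to 0, +-2, +-3 modulo 7, and -1/7 for +-1. The last case is that of
  the cusp at infinity, up to sign of the matrix.\<close>

lemma upsilon_cusps:
  assumes A: "A \<in> SL2Z"
  shows "(\<exists>\<mu>\<ge>0. asym (\<lambda>t. upsilon (act A t)) \<mu>) \<or> A \<in> Gamma1 7 \<or> - A \<in> Gamma1 7"
proof -
  obtain a' x w where *: "x > 0" "w > 0" "x = gcd (7 * ea A) (ec A)" "7 * ea A = a' * x"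
    "asym (\<lambda>t. upsilon (act A t)) (of_int x / of_int w *
       (2 * lam (of_int (2 * a') / 7) + lam (of_int (3 * a') / 7) - 3 * lam (of_int a' / 7)))"
    by (rule upsilon_asym[OF A]) (rule that; assumption)
  have det: "ea A * ed A - eb A * ec A = 1" using A by (simp add: SL2Z_iff)
  have p7: "prime (7::int)" by simp
  have lam: "2 * lam (of_int (2 * a') / 7) + lam (of_int (3 * a') / 7) - 3 * lam (of_int a' / 7) \<ge> 0"
    if nm: "a' mod 7 \<notin> {1, 6}"
  proof -
    have "a' mod 7 = 0 \<or> a' mod 7 = 2 \<or> a' mod 7 = 3 \<or> a' mod 7 = 4 \<or> a' mod 7 = 5"
      using nm unfolding insert_iff empty_iff by presburger
    moreover have "2 * a' mod 7 = (2 * (a' mod 7)) mod 7" "3 * a' mod 7 = (3 * (a' mod 7)) mod 7"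
      by (simp_all only: mod_mult_right_eq)
    ultimately show ?thesis
      unfolding lam_int_divide_7 by (elim disjE) simp_all
  qed
  show ?thesis
  proof (cases "a' mod 7 \<in> {1, 6}")
    case False
    have "of_int x / of_int w * (2 * lam (of_int (2 * a') / 7) + lam (of_int (3 * a') / 7) - 3 * lam (of_int a' / 7)) \<ge> 0"
      using lam[OF False] *(1,2) by simp
    with *(5) show ?thesis by blast
  next
    case True
    \<comment> \<open>Now \<open>7 * ea A = a' * x\<close> forces 7 to divide \<open>x\<close>,
      hence \<open>ec A\<close>. The cofactor \<open>x'\<close> divides both \<open>ea A\<close> and
      \<open>ec A\<close> and so is 1 by the determinant, which leaves
      \<open>ea A = a'\<close>.\<close>
    then have "\<not> 7 dvd a'" by auto
    then have "7 dvd x" using *(4) p7 by (metis dvd_triv_left prime_dvd_mult_iff)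
    then have c: "7 dvd ec A" using *(3) by (metis dvd_trans gcd_dvd2)
    obtain x' where x': "x = 7 * x'" using \<open>7 dvd x\<close> by blast
    have "x' dvd ec A" using x' *(3) by (metis dvd_triv_right dvd_trans gcd_dvd2)
    moreover have ax: "ea A = a' * x'" using *(4) x' by simp
    ultimately have "x' dvd ea A * ed A - eb A * ec A" by simp
    then have "x' dvd 1" using det by simp
    then have "x' = 1" using *(1) x' by (simp add: zdvd1_eq)
    then have a: "ea A mod 7 \<in> {1, 6}" using True ax by simp
    obtain c' where c': "ec A = 7 * c'" using c by blast
    have ad: "ea A * ed A mod 7 = 1"
    proof -
      have "ea A * ed A = 1 + 7 * (eb A * c')" using det c' by simp
      then show ?thesis by simp
    qed
    have "(ea A mod 7) * (ed A mod 7) mod 7 = 1" using ad by (simp add: mod_mult_eq)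
    moreover have "ea A mod 7 = 1 \<or> ea A mod 7 = 6" using a by simp
    ultimately have "ea A mod 7 = 1 \<and> ed A mod 7 = 1 \<or> ea A mod 7 = 6 \<and> ed A mod 7 = 6"
    proof (elim disjE)
      assume *: "(ea A mod 7) * (ed A mod 7) mod 7 = 1" "ea A mod 7 = 6"
      then have "6 * (ed A mod 7) mod 7 = 1" by simp
      then have "ed A mod 7 = 6" by presburger
      with * show ?thesis by simp
    qed simp
    then show ?thesis
    proof
      assume "ea A mod 7 = 1 \<and> ed A mod 7 = 1"
      then have "A \<in> Gamma1 7" using A c by (simp add: Gamma1_def cong_def)
      then show ?thesis by blast
    next
      assume "ea A mod 7 = 6 \<and> ed A mod 7 = 6"
      then have "- ea A mod 7 = 1" "- ed A mod 7 = 1" by presburger+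
      moreover have "- A \<in> SL2Z" using A by (simp add: SL2Z_iff)
      ultimately have "- A \<in> Gamma1 7" using c by (simp add: Gamma1_def cong_def)
      then show ?thesis by blast
    qed
  qed
qed

lemma asym_V: "\<not> 7 dvd j \<Longrightarrow> asym (V j) (7 * lam (of_int j / 7))"
  using asym_kl[of "of_int j / 7" 0 7 0] of_int_divide_in_Ints_iff[of 7 j] by (simp add: V_def[abs_def])

lemma upsilon_asym_inf: "asym upsilon (- 1)"
proof -
  have "asym (\<lambda>t. V 2 t ^ 2 * V 3 t / V 1 t ^ 3)
    (of_nat 2 * (7 * lam (of_int 2 / 7)) + 7 * lam (of_int 3 / 7) - of_nat 3 * (7 * lam (of_int 1 / 7)))"
    by (intro asym_divide asym_mult asym_power asym_V) auto
  then have "asym (\<lambda>t. V 2 t ^ 2 * V 3 t / V 1 t ^ 3) (- 1)"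
    unfolding lam_int_divide_7 by simp
  then show ?thesis
    by (rule asym_cong) (simp add: upsilon_eq in_upper_half_plane)
qed

lemma upsilon_outside: "t \<notin> HH \<Longrightarrow> upsilon t = 0"
  by (simp add: upsilon_def)

lemma g1_outside: "t \<notin> HH \<Longrightarrow> g1 t = 0"
  by (simp add: g1_def)

lemma upsilon_modular: "upsilon \<in> modular_functions (Gamma1 7)"
proof -
  have "\<exists>\<mu>. asym (\<lambda>t. upsilon (act A t)) \<mu>" if "A \<in> SL2Z" for A
    by (rule upsilon_asym[OF that]) blast
  then show ?thesis
    using modular_functions_asymI[of upsilon 7, OF upsilon_holomorphic upsilon_outside] upsilon_invariant
    by simp
qed

lemma g1_modular: "g1 \<in> modular_functions (Gamma1 14)"
  using modular_functions_asymI[of g1 14, OF g1_holomorphic g1_outside] g1_invariant g1_asym by simp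

section \<open>The function field of $X_1(7)$\<close>

text \<open>Weaker than a nonnegative order in the sense of \<open>asym\<close>, but stable under
  sums and satisfied by the zero function.\<close>

definition bdd_inf :: "(complex \<Rightarrow> complex) \<Rightarrow> bool" where
  "bdd_inf f \<longleftrightarrow> (\<exists>B. eventually (\<lambda>t. norm (f t) \<le> B) at_ii_inf)"

lemma bdd_inf_const: "bdd_inf (\<lambda>_. c)"
  unfolding bdd_inf_def by (intro exI[of _ "norm c"]) simp

lemma bdd_inf_add:
  assumes "bdd_inf f" "bdd_inf g"
  shows "bdd_inf (\<lambda>t. f t + g t)"
proof -
  obtain B C where B: "eventually (\<lambda>t. norm (f t) \<le> B) at_ii_inf" and C: "eventually (\<lambda>t. norm (g t) \<le> C) at_ii_inf"
    using assms unfolding bdd_inf_def by blast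
  from B C have "eventually (\<lambda>t. norm (f t + g t) \<le> B + C) at_ii_inf"
    by eventually_elim (rule norm_triangle_mono)
  then show ?thesis unfolding bdd_inf_def by blast
qed

lemma bdd_inf_mult:
  assumes "bdd_inf f" "bdd_inf g"
  shows "bdd_inf (\<lambda>t. f t * g t)"
proof -
  obtain B C where B: "eventually (\<lambda>t. norm (f t) \<le> B) at_ii_inf" and C: "eventually (\<lambda>t. norm (g t) \<le> C) at_ii_inf"
    using assms unfolding bdd_inf_def by blast
  from B C have "eventually (\<lambda>t. norm (f t * g t) \<le> B * C) at_ii_inf"
  proof eventually_elim
    case (elim t)
    then have "norm (f t) * norm (g t) \<le> B * C"
      by (intro mult_mono) (auto intro: order_trans[OF norm_ge_zero])
    then show ?case by (simp add: norm_mult)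
  qed
  then show ?thesis unfolding bdd_inf_def by blast
qed

lemma bdd_inf_power: "bdd_inf f \<Longrightarrow> bdd_inf (\<lambda>t. f t ^ n)"
  by (induction n) (auto intro: bdd_inf_const bdd_inf_mult)

lemma bdd_inf_poly: "bdd_inf f \<Longrightarrow> bdd_inf (\<lambda>t. poly p (f t))"
  by (induction p) (auto intro: bdd_inf_const bdd_inf_mult bdd_inf_add)

lemma bdd_inf_cong:
  assumes "bdd_inf f" "\<And>t. t \<in> HH \<Longrightarrow> f t = g t"
  shows "bdd_inf g"
proof -
  obtain B where B: "eventually (\<lambda>t. norm (f t) \<le> B) at_ii_inf"
    using assms unfolding bdd_inf_def by blast
  moreover have "eventually (\<lambda>t. t \<in> HH) at_ii_inf"
    unfolding eventually_at_ii_inf by (auto simp: in_upper_half_plane)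
  ultimately have "eventually (\<lambda>t. norm (g t) \<le> B) at_ii_inf"
    by eventually_elim (simp add: assms(2))
  then show ?thesis unfolding bdd_inf_def by blast
qed

lemma bdd_inf_holomorphic:
  assumes "F holomorphic_on ball 0 1" "h > 0"
  shows "bdd_inf (\<lambda>t. F (expi2 (t / of_nat h)))"
proof -
  have "isCont F 0"
    using holomorphic_on_imp_continuous_on[OF assms(1)] by (simp add: continuous_on_eq_continuous_at)
  moreover have "((\<lambda>t. expi2 (t / of_nat h)) \<longlongrightarrow> 0) at_ii_inf"
    using expi2_tendsto_0[of "1 / of_nat h" 0] assms(2) by simp
  ultimately have "((\<lambda>t. F (expi2 (t / of_nat h))) \<longlongrightarrow> F 0) at_ii_inf"
    by (rule isCont_tendsto_compose)
  then have "((\<lambda>t. norm (F (expi2 (t / of_nat h)))) \<longlongrightarrow> norm (F 0)) at_ii_inf"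
    by (rule tendsto_norm)
  then have "eventually (\<lambda>t. norm (F (expi2 (t / of_nat h))) < norm (F 0) + 1) at_ii_inf"
    by (rule order_tendstoD(2)) simp
  then have "eventually (\<lambda>t. norm (F (expi2 (t / of_nat h))) \<le> norm (F 0) + 1) at_ii_inf"
    by eventually_elim simp
  then show ?thesis unfolding bdd_inf_def by blast
qed

lemma holomorphic_divide_out:
  assumes "F holomorphic_on ball 0 1" "F 0 = 0"
  obtains G where "G holomorphic_on ball 0 1" "\<And>x. F x = x * G x"
proof -
  define G where "G = (\<lambda>z. if z = 0 then deriv F 0 else (F z - F 0) / (z - 0))"
  have "G holomorphic_on ball 0 1"
    unfolding G_def by (rule pole_lemma_open[OF assms(1) open_ball])
  moreover have "F x = x * G x" for x
    using assms(2) by (simp add: G_def)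
  ultimately show ?thesis using that by blast
qed

text \<open>The negative of the identity acts trivially but is not in \<open>Gamma1 7\<close>; this
  bridges the two.\<close>

lemma mer_pm_invariant:
  assumes f: "f \<in> modular_functions (Gamma1 7)" and A: "A \<in> Gamma1 7 \<or> - A \<in> Gamma1 7" and t: "t \<in> HH"
  shows "f (act A t) = f t"
proof -
  have "act (- A) t = act A t" for A
  proof -
    have "act (- A) t = (- (of_int (ea A) * t + of_int (eb A))) / (- (of_int (ec A) * t + of_int (ed A)))"
      unfolding act_eq by simp
    moreover have "(- a) / (- b) = a / b" for a b :: complex by simp
    ultimately show ?thesis unfolding act_eq by metis
  qed
  then show ?thesis
    using A modular_functionsD(4)[OF f _ t] by metis
qed

lemma modular_functions_poly_combination:
  assumes f: "f \<in> modular_functions (Gamma1 7)"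
  shows "mer (\<lambda>t. poly p (upsilon t) * f t) \<in> modular_functions (Gamma1 7)"
    "mer (\<lambda>t. f t - poly p (upsilon t)) \<in> modular_functions (Gamma1 7)"
proof -
  note cu = modular_functionsD(2)[OF upsilon_modular] and cf = modular_functionsD(2)[OF f]
  show "mer (\<lambda>t. poly p (upsilon t) * f t) \<in> modular_functions (Gamma1 7)"
  proof (rule modular_functions_mer[OF _ Gamma1_subset])
    show "cusp_meromorphic (\<lambda>t. poly p (upsilon t) * f t)" by (intro cusp_intros cu cf)
    fix A :: "int ^ 2 ^ 2" assume A: "A \<in> Gamma1 7"
    from modular_functions_ae[OF f A] modular_functions_ae[OF upsilon_modular A]
    show "\<forall>\<^sub>\<approx>t\<in>HH. poly p (upsilon (act A t)) * f (act A t) = poly p (upsilon t) * f t"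
      by eventually_elim simp
  qed
  show "mer (\<lambda>t. f t - poly p (upsilon t)) \<in> modular_functions (Gamma1 7)"
  proof (rule modular_functions_mer[OF _ Gamma1_subset])
    show "cusp_meromorphic (\<lambda>t. f t - poly p (upsilon t))" by (intro cusp_intros cu cf)
    fix A :: "int ^ 2 ^ 2" assume A: "A \<in> Gamma1 7"
    from modular_functions_ae[OF f A] modular_functions_ae[OF upsilon_modular A]
    show "\<forall>\<^sub>\<approx>t\<in>HH. f (act A t) - poly p (upsilon (act A t)) = f t - poly p (upsilon t)"
      by eventually_elim simp
  qed
qed

lemma upsilon_period: "t \<in> HH \<Longrightarrow> upsilon (t + 1) = upsilon t"
  using upsilon_invariant[of "tmat 1" t] by (simp add: Gamma1_def) (simp add: tmat_def)

lemma upsilon_expansion: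
  obtains U where "U holomorphic_on ball 0 1" "U 0 \<noteq> 0" "\<And>t. t \<in> HH \<Longrightarrow> upsilon t = U (expi2 t) / expi2 t"
proof -
  obtain B where "eventually (\<lambda>t. norm (upsilon t * expi2 (of_real 1 * t)) \<le> B) at_ii_inf"
    using asym_bounded_shift[OF upsilon_asym_inf, of 1] by auto
  then have B: "eventually (\<lambda>t. norm (upsilon t * expi2 (of_real (of_nat 1 / of_nat 1) * t)) \<le> B) at_ii_inf"
    by simp
  have per: "upsilon (t + of_nat 1) = upsilon t" if "t \<in> HH" for t
    using upsilon_period[OF that] by simp
  obtain U where U: "U holomorphic_on ball 0 1"
    "\<And>t. t \<in> HH \<Longrightarrow> upsilon t = U (expi2 (t / of_nat 1)) / expi2 (t / of_nat 1) ^ 1"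
    by (rule expansion_of_asym[OF upsilon_holomorphic zero_less_one per B]) (assumption, (rule that; assumption))
  have U2: "upsilon t = U (expi2 t) / expi2 t" if "t \<in> HH" for t
    using U(2)[OF that] by simp
  obtain c where c: "c \<noteq> 0" "((\<lambda>t. upsilon t * expi2 (- of_real (- 1) * t)) \<longlongrightarrow> c) at_ii_inf"
    using upsilon_asym_inf unfolding asym_def by blast
  have "eventually (\<lambda>t. upsilon t * expi2 (- of_real (- 1) * t) = U (expi2 t)) at_ii_inf"
    unfolding eventually_at_ii_inf by (intro exI[of _ 0]) (auto simp: U2 in_upper_half_plane)
  from Lim_transform_eventually[OF c(2) this] have "((\<lambda>t. U (expi2 t)) \<longlongrightarrow> c) at_ii_inf" .
  moreover have "((\<lambda>t. U (expi2 t)) \<longlongrightarrow> U 0) at_ii_inf"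
  proof -
    have "isCont U 0"
      using holomorphic_on_imp_continuous_on[OF U(1)] by (simp add: continuous_on_eq_continuous_at)
    moreover have "((\<lambda>t. expi2 t) \<longlongrightarrow> 0) at_ii_inf"
      using expi2_tendsto_0[of 1 0] by simp
    ultimately show ?thesis by (rule isCont_tendsto_compose)
  qed
  ultimately have "U 0 = c" by (rule tendsto_unique[OF at_ii_inf_neq_bot, rotated])
  with c(1) U(1) U2 that show ?thesis by blast
qed

text \<open>Induction on a bound \<open>m\<close> for the pole order at infinity. Subtracting a
  multiple of a power of \<open>upsilon\<close> lowers it and preserves boundedness at the other
  cusps, where \<open>upsilon\<close> is bounded. For \<open>m = 0\<close> the function is bounded
  at all cusps, hence constant.\<close>

lemma polynomial_in_upsilon:
  assumes f: "f \<in> modular_functions (Gamma1 7)" and hol: "f holomorphic_on HH"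
    and bdd: "\<And>A. A \<in> SL2Z \<Longrightarrow> A \<notin> Gamma1 7 \<Longrightarrow> - A \<notin> Gamma1 7 \<Longrightarrow> bdd_inf (\<lambda>t. f (act A t))"
    and G: "G holomorphic_on ball 0 1" "\<And>t. t \<in> HH \<Longrightarrow> f t = G (expi2 t) / expi2 t ^ m"
  shows "\<exists>p. \<forall>t\<in>HH. f t = poly p (upsilon t)"
  using assms
proof (induction m arbitrary: f G)
  case 0
  have "bdd_inf (\<lambda>t. G (expi2 (t / of_nat 1)))"
    by (rule bdd_inf_holomorphic[OF "0.prems"(4)]) simp
  then have b0: "bdd_inf f"
    by (rule bdd_inf_cong) (simp add: "0.prems"(5))
  have "bdd_inf (\<lambda>t. f (act A t))" if A: "A \<in> SL2Z" for A
  proof (cases "A \<in> Gamma1 7 \<or> - A \<in> Gamma1 7")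
    case True
    show ?thesis
      by (rule bdd_inf_cong[OF b0]) (simp add: mer_pm_invariant[OF "0.prems"(1) True])
  next
    case False
    then show ?thesis using "0.prems"(3)[OF A] by blast
  qed
  then have "\<exists>c. \<forall>t\<in>HH. f t = c"
    using "0.prems"(1,2) unfolding bdd_inf_def
    by (intro constant_if_bounded_at_cusps[of f 7]) auto
  then obtain c where "\<forall>t\<in>HH. f t = c" by blast
  then show ?case by (intro exI[of _ "[:c:]"]) simp
next
  case (Suc m)
  obtain U where U: "U holomorphic_on ball 0 1" "U 0 \<noteq> 0" "\<And>t. t \<in> HH \<Longrightarrow> upsilon t = U (expi2 t) / expi2 t"
    by (rule upsilon_expansion) (rule that; assumption)
  \<comment> \<open>The quotient of the leading coefficients; it makes the numerator
    \<open>N\<close> of the difference vanish at 0.\<close>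
  define c where "c = G 0 / U 0 ^ Suc m"
  define p where "p = Polynomial.monom c (Suc m)"
  define f' where "f' = mer (\<lambda>t. f t - poly p (upsilon t))"
  have f': "f' \<in> modular_functions (Gamma1 7)"
    unfolding f'_def by (rule modular_functions_poly_combination(2)[OF Suc.prems(1)])
  have hol': "(\<lambda>t. f t - poly p (upsilon t)) holomorphic_on HH"
    unfolding p_def poly_monom by (intro holomorphic_intros Suc.prems upsilon_holomorphic)
  have eq: "f' t = f t - poly p (upsilon t)" if "t \<in> HH" for t
    unfolding f'_def by (rule mer_eq_holomorphic[OF hol' refl that])
  have H1: "f' holomorphic_on HH"
    by (rule holomorphic_transform[OF hol']) (simp add: eq)
  have H2: "bdd_inf (\<lambda>t. f' (act A t))" if A: "A \<in> SL2Z" "A \<notin> Gamma1 7" "- A \<notin> Gamma1 7" for A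
  proof -
    obtain \<mu> where "\<mu> \<ge> 0" "asym (\<lambda>t. upsilon (act A t)) \<mu>" using upsilon_cusps[OF A(1)] A by blast
    then have "bdd_inf (\<lambda>t. upsilon (act A t))" unfolding bdd_inf_def using asym_bounded by blast
    then have "bdd_inf (\<lambda>t. f (act A t) + (- 1) * poly p (upsilon (act A t)))"
      by (intro bdd_inf_add bdd_inf_mult bdd_inf_const bdd_inf_poly Suc.prems(3)[OF A])
    then show ?thesis
      by (rule bdd_inf_cong) (use A in \<open>simp add: eq\<close>)
  qed
  define N where "N = (\<lambda>x. G x - c * U x ^ Suc m)"
  have "N holomorphic_on ball 0 1" unfolding N_def by (intro holomorphic_intros Suc.prems U)
  moreover have "N 0 = 0" using U(2) by (simp add: N_def c_def)
  ultimately obtain G1 where G1: "G1 holomorphic_on ball 0 1" "\<And>x. N x = x * G1 x"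
    using holomorphic_divide_out by metis
  have H3: "f' t = G1 (expi2 t) / expi2 t ^ m" if t: "t \<in> HH" for t
  proof -
    have "f' t = N (expi2 t) / expi2 t ^ Suc m"
      using t by (simp add: eq Suc.prems(5) U(3) p_def poly_monom N_def power_divide diff_divide_distrib)
    also have "\<dots> = G1 (expi2 t) / expi2 t ^ m" by (simp add: G1)
    finally show ?thesis .
  qed
  obtain r where r: "\<forall>t\<in>HH. f' t = poly r (upsilon t)"
    using Suc.IH[OF f' H1 H2 G1(1) H3] by blast
  then have "\<forall>t\<in>HH. f t = poly (r + p) (upsilon t)"
    using eq by (auto simp: algebra_simps)
  then show ?case by blast
qed

section \<open>Removing poles by polynomials in upsilon\<close>

lemma meromorphic_bounded_mult_power:
  assumes "f meromorphic_on {z}"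
  obtains m B where "eventually (\<lambda>w. norm (f w * (w - z) ^ m) \<le> B) (at z)"
proof -
  have iso: "isolated_singularity_at f z" and ne: "not_essential f z"
    using assms by (auto simp: meromorphic_at_iff)
  have bounded_lim: "\<exists>B. eventually (\<lambda>w. norm (g w) \<le> B) (at z)" if "g \<midarrow>z\<rightarrow> l" for g :: "complex \<Rightarrow> complex" and l
  proof -
    have "eventually (\<lambda>w. norm (g w) < norm l + 1) (at z)"
      by (rule order_tendstoD(2)[OF tendsto_norm[OF that]]) simp
    then have "eventually (\<lambda>w. norm (g w) \<le> norm l + 1) (at z)" by eventually_elim simp
    then show ?thesis by blast
  qed
  show ?thesis
  proof (cases "is_pole f z")
    case False
    then obtain l where "f \<midarrow>z\<rightarrow> l" using ne by (auto simp: not_essential_def)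
    then obtain B where "eventually (\<lambda>w. norm (f w) \<le> B) (at z)" using bounded_lim by blast
    then show ?thesis using that[of 0 B] by simp
  next
    case True
    obtain r where r: "r > 0" "f analytic_on ball z r - {z}" using iso by (auto simp: isolated_singularity_at_def)
    have "f holomorphic_on ball z r - {z}" using r by (simp add: analytic_imp_holomorphic)
    from zorder_exist_pole[OF this _ _ True] r obtain r' where r': "r' > 0" "zor_poly f z holomorphic_on cball z r'"
      "\<forall>w\<in>cball z r' - {z}. f w = zor_poly f z w / (w - z) ^ nat (- zorder f z)" by auto
    define m where "m = nat (- zorder f z)"
    have "continuous_on (cball z r') (zor_poly f z)"
      using r' by (intro holomorphic_on_imp_continuous_on)
    then have "isCont (zor_poly f z) z"
      using r'(1) by (intro continuous_on_interior) auto
    then have "zor_poly f z \<midarrow>z\<rightarrow> zor_poly f z z" by (simp add: isCont_def)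
    moreover have "eventually (\<lambda>w. w \<in> ball z r' - {z}) (at z)"
      using r' by (intro eventually_at_in_open) auto
    then have "eventually (\<lambda>w. zor_poly f z w = f w * (w - z) ^ m) (at z)"
      by eventually_elim (use r'(3) in \<open>auto simp: m_def\<close>)
    ultimately have "(\<lambda>w. f w * (w - z) ^ m) \<midarrow>z\<rightarrow> zor_poly f z z"
      by (rule Lim_transform_eventually)
    then show ?thesis using bounded_lim that by blast
  qed
qed

text \<open>The power (\<open>upsilon\<close> - \<open>upsilon z\<close>)^m vanishes at
  \<open>z\<close> to order at least \<open>m\<close>, because the difference quotient of
  \<open>upsilon\<close> is bounded near \<open>z\<close>.\<close>

lemma pole_killing_polynomial:
  assumes f: "f meromorphic_on HH" and z: "z \<in> HH"
  obtains p B where "p \<noteq> 0" "eventually (\<lambda>w. norm (poly p (upsilon w) * f w) \<le> B) (at z)"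
proof -
  have "f meromorphic_on {z}" using f z by (auto intro: meromorphic_on_subset)
  then obtain m B where B: "eventually (\<lambda>w. norm (f w * (w - z) ^ m) \<le> B) (at z)"
    using meromorphic_bounded_mult_power by blast
  define d where "d = deriv upsilon z"
  have "(upsilon has_field_derivative d) (at z)"
    unfolding d_def using holomorphic_derivI[OF upsilon_holomorphic _ z] by auto
  then have "(\<lambda>w. (upsilon w - upsilon z) / (w - z)) \<midarrow>z\<rightarrow> d" by (simp add: has_field_derivative_iff)
  then have "((\<lambda>w. norm ((upsilon w - upsilon z) / (w - z))) \<longlongrightarrow> norm d) (at z)" by (rule tendsto_norm)
  then have D: "eventually (\<lambda>w. norm ((upsilon w - upsilon z) / (w - z)) < norm d + 1) (at z)"
    by (rule order_tendstoD(2)) simp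
  have nz: "eventually (\<lambda>w. w \<noteq> z) (at z)" by (simp add: eventually_at_filter)
  define p where "p = [:- upsilon z, 1:] ^ m"
  have "eventually (\<lambda>w. norm (poly p (upsilon w) * f w) \<le> (norm d + 1) ^ m * B) (at z)"
    using B D nz
  proof eventually_elim
    case (elim w)
    have "poly p (upsilon w) * f w = ((upsilon w - upsilon z) / (w - z)) ^ m * (f w * (w - z) ^ m)"
      using elim(3) by (simp add: p_def poly_power power_divide)
    also have "norm \<dots> = norm ((upsilon w - upsilon z) / (w - z)) ^ m * norm (f w * (w - z) ^ m)"
      by (simp add: norm_mult norm_power)
    also have "\<dots> \<le> (norm d + 1) ^ m * B"
      using elim by (intro mult_mono power_mono) auto
    finally show ?case .
  qed
  then show ?thesis by (rule that[rotated]) (simp add: p_def)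
qed

lemma mer_analytic:
  assumes "f analytic_on {z}" "z \<in> HH"
  shows "mer f analytic_on {z}"
proof -
  have "remove_sings f analytic_on {z}" by (rule remove_sings_analytic_on[OF assms(1)])
  moreover have "eventually (\<lambda>w. remove_sings f w = mer f w) (nhds z)"
    using eventually_nhds_in_open[OF open_upper_half_plane assms(2)] by eventually_elim (simp add: mer_def)
  ultimately show ?thesis using analytic_at_cong by blast
qed

lemma mer_analytic_bounded:
  assumes f: "f meromorphic_on HH" and z: "z \<in> HH" and B: "eventually (\<lambda>w. norm (f w) \<le> B) (at z)"
  shows "mer f analytic_on {z}"
proof -
  have iso: "isolated_singularity_at f z" and ne: "not_essential f z"
    using f z by (auto simp: meromorphic_on_altdef)
  have "\<not> is_pole f z"
  proof
    assume "is_pole f z"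
    then have "eventually (\<lambda>w. norm (f w) > B) (at z)"
      unfolding is_pole_def
      by (intro filterlim_at_top_dense[THEN iffD1, rule_format] filterlim_at_infinity_imp_norm_at_top)
    with B have "eventually (\<lambda>w. False) (at z)" by eventually_elim simp
    then show False by simp
  qed
  then obtain l where "f \<midarrow>z\<rightarrow> l" using ne by (auto simp: not_essential_def)
  then have "remove_sings f analytic_on {z}" by (rule remove_sings_analytic_at[OF iso])
  moreover have "eventually (\<lambda>w. remove_sings f w = mer f w) (nhds z)"
    using eventually_nhds_in_open[OF open_upper_half_plane z] by eventually_elim (simp add: mer_def)
  ultimately show ?thesis using analytic_at_cong by blast
qed

lemma poly_upsilon_analytic: "z \<in> HH \<Longrightarrow> (\<lambda>t. poly p (upsilon t)) analytic_on {z}"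
  using holomorphic_on_imp_analytic_at[OF upsilon_holomorphic open_upper_half_plane]
  by (induction p) (auto intro!: analytic_intros)

lemma poly_upsilon_holomorphic: "(\<lambda>t. poly p (upsilon t)) holomorphic_on HH"
  by (rule analytic_imp_holomorphic) (subst analytic_on_analytic_at, blast intro: poly_upsilon_analytic)

lemma poly_upsilon_meromorphic: "(\<lambda>t. poly p (upsilon t)) meromorphic_on HH"
  by (rule analytic_on_imp_meromorphic_on) (subst analytic_on_analytic_at, blast intro: poly_upsilon_analytic)

text \<open>The poles in the upper half-plane form finitely many orbits: up to
  \<open>Gamma1 7\<close> each point lies in an image under some \<open>B\<close> in
  \<open>R\<close> either of a half-plane free of poles or of the compact box \<open>K\<close>. A
  product over the poles in the compact part suffices, and invariance of the product function
  carries analyticity to all other points.\<close>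

lemma kill_poles:
  assumes f: "f \<in> modular_functions (Gamma1 7)"
  obtains p where "p \<noteq> 0" "mer (\<lambda>t. poly p (upsilon t) * f t) holomorphic_on HH"
proof -
  have cf: "cusp_meromorphic f" by (rule modular_functionsD(2)[OF f])
  then have fm: "f meromorphic_on HH" by (simp add: cusp_meromorphic_def)
  obtain R where R: "finite R" "R \<subseteq> SL2Z" "\<And>A. A \<in> SL2Z \<Longrightarrow> \<exists>B\<in>R.
    [ea A = ea B] (mod 7) \<and> [eb A = eb B] (mod 7) \<and> [ec A = ec B] (mod 7) \<and> [ed A = ed B] (mod 7)"
    by (rule finite_reps[of 7]) (simp, (rule that; assumption))
  have "eventually (\<lambda>t. \<forall>B\<in>R. (\<lambda>t. f (act B t)) analytic_on {t}) at_ii_inf"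
    using R cf by (intro eventually_ball_finite ballI meromorphic_at_ii_inf_analytic) (auto simp: cusp_meromorphic_def)
  then obtain c where c: "\<And>t B. Im t > c \<Longrightarrow> B \<in> R \<Longrightarrow> (\<lambda>t. f (act B t)) analytic_on {t}"
    unfolding eventually_at_ii_inf by blast
  \<comment> \<open>The part of the strip from \<open>reduction\<close> that lies below the height
    \<open>c\<close>, above which there are no poles.\<close>
  define K where "K = cbox (Complex (-1/2) (1/2)) (Complex (1/2) c)"
  have KH: "K \<subseteq> HH" by (auto simp: K_def in_upper_half_plane in_cbox_complex_iff)
  define Q where "Q = (\<Union>B\<in>R. act B ` K)"
  have "compact (act B ` K)" if "B \<in> R" for B
  proof (rule compact_continuous_image)
    show "compact K" unfolding K_def by (rule compact_cbox)
    have "B \<in> SL2Z" using that R by blast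
    then show "continuous_on K (act B)"
      using holomorphic_on_imp_continuous_on[OF act_holomorphic] KH continuous_on_subset by blast
  qed
  then have Q: "compact Q" unfolding Q_def using R(1) by (intro compact_UN)
  have QH: "Q \<subseteq> HH" unfolding Q_def using KH R(2) act_in_upper_half_plane by blast
  define P where "P = Q \<inter> {z. \<not> f analytic_on {z}}"
  have "{z. \<not> f analytic_on {z}} sparse_in HH"
    using meromorphic_on_imp_analytic_cosparse[OF fm] by (simp add: eventually_cosparse)
  then have "finite P"
    unfolding P_def using Q QH by (meson sparse_in_compact_finite sparse_in_subset)
  have "\<exists>p B. p \<noteq> 0 \<and> eventually (\<lambda>w. norm (poly p (upsilon w) * f w) \<le> B) (at z)" if "z \<in> P" for z
  proof -
    have "z \<in> HH" using that QH by (auto simp: P_def)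
    then show ?thesis using pole_killing_polynomial[OF fm] by metis
  qed
  then obtain pz Bz where pz: "\<And>z. z \<in> P \<Longrightarrow> pz z \<noteq> 0"
    "\<And>z. z \<in> P \<Longrightarrow> eventually (\<lambda>w. norm (poly (pz z) (upsilon w) * f w) \<le> Bz z) (at z)"
    by metis
  define p where "p = (\<Prod>z\<in>P. pz z)"
  have p0: "p \<noteq> 0" unfolding p_def using pz(1) \<open>finite P\<close> by simp
  define F where "F = (\<lambda>t. poly p (upsilon t) * f t)"
  define g where "g = mer F"
  have gm: "g \<in> modular_functions (Gamma1 7)"
    unfolding g_def F_def by (rule modular_functions_poly_combination(1)[OF f])
  have Fm: "F meromorphic_on HH"
    unfolding F_def by (rule meromorphic_on_mult[OF poly_upsilon_meromorphic fm])
  have 1: "g analytic_on {z}" if "z \<in> HH" "f analytic_on {z}" for z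
    unfolding g_def F_def using that by (intro mer_analytic analytic_intros poly_upsilon_analytic) auto
  have 2: "g analytic_on {z}" if z: "z \<in> P" for z
  proof -
    have zH: "z \<in> HH" using z QH by (auto simp: P_def)
    define r where "r = (\<Prod>y\<in>P - {z}. pz y)"
    have p: "p = r * pz z" unfolding p_def r_def using prod.remove[OF \<open>finite P\<close> z, of pz] by (simp add: mult.commute)
    have "isCont (\<lambda>t. poly r (upsilon t)) z"
      using poly_upsilon_analytic[OF zH] by (rule analytic_at_imp_isCont)
    then have "((\<lambda>t. norm (poly r (upsilon t))) \<longlongrightarrow> norm (poly r (upsilon z))) (at z)"
      by (intro tendsto_norm) (simp add: isCont_def)
    then have "eventually (\<lambda>t. norm (poly r (upsilon t)) < norm (poly r (upsilon z)) + 1) (at z)"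
      by (rule order_tendstoD(2)) simp
    with pz(2)[OF z] have "eventually (\<lambda>t. norm (F t) \<le> (norm (poly r (upsilon z)) + 1) * Bz z) (at z)"
    proof eventually_elim
      case (elim t)
      have "norm (F t) = norm (poly r (upsilon t)) * norm (poly (pz z) (upsilon t) * f t)"
        by (simp add: F_def p norm_mult mult.assoc)
      also have "\<dots> \<le> (norm (poly r (upsilon z)) + 1) * Bz z"
        using elim by (intro mult_mono) auto
      finally show ?case .
    qed
    then show ?thesis unfolding g_def by (rule mer_analytic_bounded[OF Fm zH])
  qed
  have "g analytic_on {z}" if z: "z \<in> HH" for z
  proof -
    obtain A where A: "A \<in> SL2Z" "Im (act A z) \<ge> 1/2" "\<bar>Re (act A z)\<bar> \<le> 1/2" using reduction[OF z] by blast
    define w where "w = act A z"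
    have w: "w \<in> HH" "act (inv2 A) w = z" using A z by (auto simp: w_def)
    obtain B where B: "B \<in> R" "[ea (inv2 A) = ea B] (mod 7)" "[eb (inv2 A) = eb B] (mod 7)"
      "[ec (inv2 A) = ec B] (mod 7)" "[ed (inv2 A) = ed B] (mod 7)"
      using R(3)[OF inv2_SL2Z[OF A(1)]] by blast
    have BS: "B \<in> SL2Z" using B R by blast
    have "g (act (inv2 A) s) = g (act B s)" if "s \<in> HH" for s
      by (rule modular_cong[of 7 g, OF modular_functionsD(4)[OF gm]]) (use A BS B that in auto)
    then have "eventually (\<lambda>s. g (act (inv2 A) s) = g (act B s)) (nhds w)"
      using eventually_nhds_in_open[OF open_upper_half_plane w(1)] by (auto elim: eventually_mono)
    then have "(\<lambda>s. g (act (inv2 A) s)) analytic_on {w} \<longleftrightarrow> (\<lambda>s. g (act B s)) analytic_on {w}"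
      by (rule analytic_at_cong) simp
    then have *: "g analytic_on {z} \<longleftrightarrow> g analytic_on {act B w}"
      using analytic_act_iff[OF inv2_SL2Z[OF A(1)] w(1), of g] analytic_act_iff[OF BS w(1), of g] w(2) by simp
    have BH: "act B w \<in> HH" using BS w by simp
    have "f analytic_on {act B w} \<or> act B w \<in> P"
    proof (cases "Im w > c")
      case True
      then show ?thesis using c[OF True B(1)] analytic_act_iff[OF BS w(1), of f] by simp
    next
      case False
      then have "w \<in> K" using A by (auto simp: K_def w_def in_cbox_complex_iff)
      then have "act B w \<in> Q" using B(1) by (auto simp: Q_def)
      then show ?thesis by (auto simp: P_def)
    qed
    then show ?thesis using * 1[OF BH] 2 by blast
  qed
  then have "g analytic_on HH" by (subst analytic_on_analytic_at) blast
  then have "g holomorphic_on HH" by (rule analytic_imp_holomorphic)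
  then show ?thesis using that[OF p0] by (simp add: g_def F_def)
qed

lemma meromorphic_at_ii_inf_bound:
  assumes "meromorphic_at_ii_inf f"
  obtains m where "bdd_inf (\<lambda>t. f t * expi2 t ^ m)"
proof -
  obtain h F c where h: "h > (0::nat)" "F meromorphic_on {0}"
    "\<And>t. Im t > c \<Longrightarrow> f t = F (exp (2 * of_real pi * \<i> * t / of_nat h))"
    using assms unfolding meromorphic_at_ii_inf_def by blast
  obtain m B where B: "eventually (\<lambda>x. norm (F x * (x - 0) ^ m) \<le> B) (at 0)"
    using meromorphic_bounded_mult_power[OF h(2)] by blast
  have E: "exp (2 * of_real pi * \<i> * t / of_nat h) = expi2 (t / of_nat h)" for t
    by (simp add: expi2_def)
  have "filterlim (\<lambda>t. expi2 (t / of_nat h)) (at 0) at_ii_inf"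
    using expi2_tendsto_0[of "1 / of_nat h" 0] h(1) by (simp add: filterlim_at)
  from eventually_compose_filterlim[OF B this]
  have "eventually (\<lambda>t. norm (F (expi2 (t / of_nat h)) * expi2 (t / of_nat h) ^ m) \<le> B) at_ii_inf" by simp
  moreover have "eventually (\<lambda>t. Im t > max 0 c) at_ii_inf"
    unfolding eventually_at_ii_inf by blast
  ultimately have "eventually (\<lambda>t. norm (f t * expi2 t ^ m) \<le> B) at_ii_inf"
  proof eventually_elim
    case (elim t)
    have "norm (expi2 t) \<le> norm (expi2 (t / of_nat h))"
    proof -
      have "Im t / real h \<le> Im t / 1" using elim h(1) by (intro divide_left_mono) auto
      then have "2 * pi * (Im t / real h) \<le> 2 * pi * (Im t / 1)" by (rule mult_left_mono) simp
      then show ?thesis by (simp add: norm_expi2)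
    qed
    then have "norm (f t * expi2 t ^ m) \<le> norm (F (expi2 (t / of_nat h)) * expi2 (t / of_nat h) ^ m)"
      using h(3)[of t] elim unfolding E by (auto simp: norm_mult norm_power intro!: mult_left_mono power_mono)
    with elim show ?case by simp
  qed
  then show ?thesis using that unfolding bdd_inf_def by blast
qed

text \<open>The counterpart of \<open>pole_killing_polynomial\<close> at a cusp:
  \<open>upsilon\<close> has the finite value \<open>U 0\<close> there, and its difference from this
  value is divisible by the local parameter.\<close>

lemma cusp_killing_polynomial:
  assumes f: "f \<in> modular_functions (Gamma1 7)" and A: "A \<in> SL2Z" "A \<notin> Gamma1 7" "- A \<notin> Gamma1 7"
  obtains p where "p \<noteq> 0" "bdd_inf (\<lambda>t. poly p (upsilon (act A t)) * f (act A t))"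
proof -
  obtain \<mu> where "\<mu> \<ge> 0" "asym (\<lambda>t. upsilon (act A t)) \<mu>" using upsilon_cusps[OF A(1)] A by blast
  then obtain B where B: "eventually (\<lambda>t. norm (upsilon (act A t)) \<le> B) at_ii_inf" using asym_bounded by blast
  have per: "upsilon (act A (t + of_nat 7)) = upsilon (act A t)" if "t \<in> HH" for t
    using modular_periodic[of 7 upsilon A t] upsilon_invariant A that by simp
  obtain U where U: "U holomorphic_on ball 0 1" "\<And>t. t \<in> HH \<Longrightarrow> upsilon (act A t) = U (expi2 (t / of_nat 7))"
    by (rule q_expansion[of "\<lambda>t. upsilon (act A t)" 7 B, OF holomorphic_act[OF upsilon_holomorphic A(1)] _ per B])
      (simp, assumption, (rule that; assumption))
  have "(\<lambda>x. U x - U 0) holomorphic_on ball 0 1" by (intro holomorphic_intros U)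
  then obtain U1 where U1: "U1 holomorphic_on ball 0 1" "\<And>x. U x - U 0 = x * U1 x"
    using holomorphic_divide_out[of "\<lambda>x. U x - U 0"] by auto
  have "meromorphic_at_ii_inf (\<lambda>t. f (act A t))"
    using modular_functionsD(2)[OF f] A by (simp add: cusp_meromorphic_def)
  then obtain m where m: "bdd_inf (\<lambda>t. f (act A t) * expi2 t ^ m)"
    using meromorphic_at_ii_inf_bound by blast
  \<comment> \<open>The local parameter is the seventh root of \<open>expi2 t\<close>, so cancelling
    the \<open>m\<close>th power of \<open>expi2 t\<close> takes \<open>7 * m\<close>
    factors.\<close>
  define p where "p = [:- U 0, 1:] ^ (7 * m)"
  have "bdd_inf (\<lambda>t. U1 (expi2 (t / of_nat 7)) ^ (7 * m) * (f (act A t) * expi2 t ^ m))"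
    by (intro bdd_inf_mult bdd_inf_power bdd_inf_holomorphic U1 m) simp
  then have "bdd_inf (\<lambda>t. poly p (upsilon (act A t)) * f (act A t))"
  proof (rule bdd_inf_cong)
    fix t assume t: "t \<in> HH"
    have e: "expi2 t ^ m = expi2 (t / of_nat 7) ^ (7 * m)"
      by (simp add: expi2_power)
    have "poly p (upsilon (act A t)) = (expi2 (t / of_nat 7) * U1 (expi2 (t / of_nat 7))) ^ (7 * m)"
      using U(2)[OF t] U1(2)[of "expi2 (t / of_nat 7)"] by (simp add: p_def poly_power)
    then show "U1 (expi2 (t / of_nat 7)) ^ (7 * m) * (f (act A t) * expi2 t ^ m) = poly p (upsilon (act A t)) * f (act A t)"
      unfolding e by (simp add: power_mult_distrib)
  qed
  then show ?thesis by (rule that[rotated]) (simp add: p_def)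
qed

lemma kill_cusps:
  assumes f: "f \<in> modular_functions (Gamma1 7)"
  obtains p where "p \<noteq> 0"
    "\<And>A. A \<in> SL2Z \<Longrightarrow> A \<notin> Gamma1 7 \<Longrightarrow> - A \<notin> Gamma1 7 \<Longrightarrow> bdd_inf (\<lambda>t. poly p (upsilon (act A t)) * f (act A t))"
proof -
  obtain R where R: "finite R" "R \<subseteq> SL2Z" "\<And>A. A \<in> SL2Z \<Longrightarrow> \<exists>B\<in>R.
    [ea A = ea B] (mod 7) \<and> [eb A = eb B] (mod 7) \<and> [ec A = ec B] (mod 7) \<and> [ed A = ed B] (mod 7)"
    by (rule finite_reps[of 7]) (simp, (rule that; assumption))
  define bad where "bad = (\<lambda>A. A \<in> Gamma1 7 \<or> - A \<in> Gamma1 7)"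
  have "\<exists>p. p \<noteq> 0 \<and> (bad B \<or> bdd_inf (\<lambda>t. poly p (upsilon (act B t)) * f (act B t)))" if "B \<in> R" for B
  proof (cases "bad B")
    case True
    then show ?thesis by (intro exI[of _ 1]) simp
  next
    case False
    then show ?thesis using cusp_killing_polynomial[OF f, of B] R that unfolding bad_def by (metis subsetD)
  qed
  then obtain pB where pB: "\<And>B. B \<in> R \<Longrightarrow> pB B \<noteq> 0"
    "\<And>B. B \<in> R \<Longrightarrow> bad B \<or> bdd_inf (\<lambda>t. poly (pB B) (upsilon (act B t)) * f (act B t))" by metis
  define p where "p = (\<Prod>B\<in>R. pB B)"
  have p0: "p \<noteq> 0" unfolding p_def using pB(1) R(1) by simp
  have "bdd_inf (\<lambda>t. poly p (upsilon (act A t)) * f (act A t))" if A: "A \<in> SL2Z" "A \<notin> Gamma1 7" "- A \<notin> Gamma1 7" for A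
  proof -
    obtain B where B: "B \<in> R" "[ea A = ea B] (mod 7)" "[eb A = eb B] (mod 7)"
      "[ec A = ec B] (mod 7)" "[ed A = ed B] (mod 7)" using R(3)[OF A(1)] by blast
    have BS: "B \<in> SL2Z" using B R by blast
    have nb: "\<not> bad B"
    proof
      assume "bad B"
      then have "bad A"
        unfolding bad_def
      proof (elim disjE)
        assume "B \<in> Gamma1 7"
        then have "A \<in> Gamma1 7" using A(1) B by (auto simp: Gamma1_def cong_def)
        then show "A \<in> Gamma1 7 \<or> - A \<in> Gamma1 7" ..
      next
        assume "- B \<in> Gamma1 7"
        then have "[ea (- B) = 1] (mod 7)" "[ed (- B) = 1] (mod 7)" "[ec (- B) = 0] (mod 7)"
          by (auto simp: Gamma1_def)
        moreover have "[ea (- A) = ea (- B)] (mod 7)" "[ed (- A) = ed (- B)] (mod 7)" "[ec (- A) = ec (- B)] (mod 7)"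
          using B by (simp_all add: cong_minus_minus_iff)
        ultimately have "- A \<in> Gamma1 7"
          using A(1) by (auto simp: Gamma1_def SL2Z_iff intro: cong_trans)
        then show "A \<in> Gamma1 7 \<or> - A \<in> Gamma1 7" ..
      qed
      with A show False by (simp add: bad_def)
    qed
    have eq: "f (act A t) = f (act B t)" "upsilon (act A t) = upsilon (act B t)" if t: "t \<in> HH" for t
      using modular_cong[of 7 f, OF modular_functionsD(4)[OF f] A(1) BS B(2-5) t]
        modular_cong[of 7 upsilon, OF upsilon_invariant A(1) BS B(2-5) t] by blast+
    define r where "r = (\<Prod>y\<in>R - {B}. pB y)"
    have p: "p = r * pB B" unfolding p_def r_def using prod.remove[OF R(1) B(1), of pB] by (simp add: mult.commute)
    obtain \<mu> where "\<mu> \<ge> 0" "asym (\<lambda>t. upsilon (act B t)) \<mu>" using upsilon_cusps[OF BS] nb unfolding bad_def by blast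
    then have "bdd_inf (\<lambda>t. upsilon (act B t))" unfolding bdd_inf_def using asym_bounded by blast
    then have "bdd_inf (\<lambda>t. poly r (upsilon (act B t)) * (poly (pB B) (upsilon (act B t)) * f (act B t)))"
      by (rule bdd_inf_mult[OF bdd_inf_poly]) (use pB(2)[OF B(1)] nb in blast)
    then show ?thesis
      by (rule bdd_inf_cong) (simp add: eq p mult.assoc)
  qed
  then show ?thesis using that[OF p0] by blast
qed

text \<open>If a nonzero polynomial vanished identically on the values of \<open>upsilon\<close>,
  these would be finite in number and so bounded, against the pole at infinity.\<close>

lemma poly_upsilon_nonzero_ae:
  assumes "r \<noteq> 0"
  shows "\<forall>\<^sub>\<approx>t\<in>HH. poly r (upsilon t) \<noteq> 0"
proof -
  have "(\<lambda>t. poly r (upsilon t)) nicely_meromorphic_on HH"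
    by (rule analytic_on_imp_nicely_meromorphic_on) (subst analytic_on_analytic_at, blast intro: poly_upsilon_analytic)
  then have "(\<forall>t\<in>HH. poly r (upsilon t) = 0) \<or> (\<forall>\<^sub>\<approx>t\<in>HH. poly r (upsilon t) \<noteq> 0)"
    by (rule nicely_meromorphic_imp_constant_or_avoid) auto
  moreover have "\<not> (\<forall>t\<in>HH. poly r (upsilon t) = 0)"
  proof
    assume "\<forall>t\<in>HH. poly r (upsilon t) = 0"
    then have "upsilon ` HH \<subseteq> {x. poly r x = 0}" by auto
    then have "finite (upsilon ` HH)" using poly_roots_finite[OF assms] finite_subset by blast
    then have "bounded (upsilon ` HH)" by (rule finite_imp_bounded)
    then obtain M where M: "\<And>t. t \<in> HH \<Longrightarrow> norm (upsilon t) \<le> M" by (auto simp: bounded_iff)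
    obtain c where c: "c \<noteq> 0" "((\<lambda>t. upsilon t * expi2 (- of_real (- 1) * t)) \<longlongrightarrow> c) at_ii_inf"
      using upsilon_asym_inf unfolding asym_def by blast
    have e0: "((\<lambda>t. M * norm (expi2 t)) \<longlongrightarrow> M * norm (0::complex)) at_ii_inf"
      using expi2_tendsto_0[of 1 0] by (intro tendsto_intros) simp
    have "((\<lambda>t. upsilon t * expi2 (- of_real (- 1) * t)) \<longlongrightarrow> 0) at_ii_inf"
    proof (rule Lim_null_comparison)
      show "eventually (\<lambda>t. norm (upsilon t * expi2 (- of_real (- 1) * t)) \<le> M * norm (expi2 t)) at_ii_inf"
        unfolding eventually_at_ii_inf
        by (intro exI[of _ 0]) (auto simp: norm_mult in_upper_half_plane intro!: mult_right_mono M)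
      show "((\<lambda>t. M * norm (expi2 t)) \<longlongrightarrow> 0) at_ii_inf" using e0 by simp
    qed
    from tendsto_unique[OF at_ii_inf_neq_bot c(2) this] c(1) show False by simp
  qed
  ultimately show ?thesis by blast
qed

theorem modular_functions_Gamma1_7:
  assumes f: "f \<in> modular_functions (Gamma1 7)"
  obtains p r where "r \<noteq> 0" "\<forall>\<^sub>\<approx>t\<in>HH. f t = poly p (upsilon t) / poly r (upsilon t)"
proof -
  obtain p1 where p1: "p1 \<noteq> 0" "mer (\<lambda>t. poly p1 (upsilon t) * f t) holomorphic_on HH"
    using kill_poles[OF f] by blast
  define f1 where "f1 = mer (\<lambda>t. poly p1 (upsilon t) * f t)"
  have f1: "f1 \<in> modular_functions (Gamma1 7)" "f1 holomorphic_on HH"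
    unfolding f1_def using p1 modular_functions_poly_combination(1)[OF f] by auto
  have fm: "f meromorphic_on HH" using modular_functionsD(2)[OF f] by (simp add: cusp_meromorphic_def)
  have ae1: "\<forall>\<^sub>\<approx>t\<in>HH. f1 t = poly p1 (upsilon t) * f t"
    unfolding f1_def by (intro mer_ae meromorphic_on_mult poly_upsilon_meromorphic fm)
  obtain p2 where p2: "p2 \<noteq> 0"
    "\<And>A. A \<in> SL2Z \<Longrightarrow> A \<notin> Gamma1 7 \<Longrightarrow> - A \<notin> Gamma1 7 \<Longrightarrow> bdd_inf (\<lambda>t. poly p2 (upsilon (act A t)) * f1 (act A t))"
    by (rule kill_cusps[OF f1(1)]) (rule that; assumption)
  define f2 where "f2 = mer (\<lambda>t. poly p2 (upsilon t) * f1 t)"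
  have hol2: "(\<lambda>t. poly p2 (upsilon t) * f1 t) holomorphic_on HH"
    by (rule holomorphic_on_mult[OF poly_upsilon_holomorphic f1(2)])
  have eq2: "f2 t = poly p2 (upsilon t) * f1 t" if "t \<in> HH" for t
    unfolding f2_def by (rule mer_eq_holomorphic[OF hol2 refl that])
  have f2: "f2 \<in> modular_functions (Gamma1 7)"
    unfolding f2_def by (rule modular_functions_poly_combination(1)[OF f1(1)])
  have f2h: "f2 holomorphic_on HH" by (rule holomorphic_transform[OF hol2]) (simp add: eq2)
  have f2b: "bdd_inf (\<lambda>t. f2 (act A t))" if A: "A \<in> SL2Z" "A \<notin> Gamma1 7" "- A \<notin> Gamma1 7" for A
    by (rule bdd_inf_cong[OF p2(2)[OF A]]) (use A in \<open>simp add: eq2\<close>)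
  have "meromorphic_at_ii_inf (\<lambda>t. f2 (act (mat 1) t))"
    using modular_functionsD(2)[OF f2] by (simp only: cusp_meromorphic_def one_in_SL2Z)
  then have "meromorphic_at_ii_inf f2" by simp
  then obtain m where m: "bdd_inf (\<lambda>t. f2 t * expi2 t ^ m)" using meromorphic_at_ii_inf_bound by blast
  then obtain B where B: "eventually (\<lambda>t. norm (f2 t * expi2 (of_real (of_nat m / of_nat 1) * t)) \<le> B) at_ii_inf"
    unfolding bdd_inf_def by (auto simp: expi2_power)
  have per: "f2 (t + of_nat 1) = f2 t" if "t \<in> HH" for t
  proof -
    have "tmat 1 \<in> Gamma1 7" by (simp add: Gamma1_def) (simp add: tmat_def)
    then show ?thesis using modular_functionsD(4)[OF f2 _ that] by fastforce
  qed
  obtain G where G: "G holomorphic_on ball 0 1"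
    "\<And>t. t \<in> HH \<Longrightarrow> f2 t = G (expi2 (t / of_nat 1)) / expi2 (t / of_nat 1) ^ m"
    by (rule expansion_of_asym[OF f2h zero_less_one per B]) (assumption, (rule that; assumption))
  have G2: "f2 t = G (expi2 t) / expi2 t ^ m" if "t \<in> HH" for t
    using G(2)[OF that] by simp
  obtain p3 where p3: "\<forall>t\<in>HH. f2 t = poly p3 (upsilon t)"
    using polynomial_in_upsilon[OF f2 f2h f2b G(1) G2] by blast
  have inH: "\<forall>\<^sub>\<approx>t\<in>HH. t \<in> HH" by (rule eventually_in_cosparse) auto
  have "p2 * p1 \<noteq> 0" using p1 p2 by simp
  moreover from poly_upsilon_nonzero_ae[OF this] ae1 inH
  have "\<forall>\<^sub>\<approx>t\<in>HH. f t = poly p3 (upsilon t) / poly (p2 * p1) (upsilon t)"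
  proof eventually_elim
    case (elim t)
    then have "poly p3 (upsilon t) = poly p2 (upsilon t) * (poly p1 (upsilon t) * f t)"
      using p3 eq2 by metis
    with elim show ?case by (simp add: field_simps)
  qed
  ultimately show ?thesis by (rule that)
qed

section \<open>The function field of $X_1(14)$\<close>

text \<open>With the identity, \<open>trmat\<close> and \<open>trmat'\<close> represent the three
  cosets of \<open>Gamma1 14\<close> in \<open>Gamma1 7\<close>: modulo 2 their bottom rows are (0,
  1), (1, 1) and (1, 0).\<close>

definition trmat :: "int ^ 2 ^ 2" where "trmat = mat2 1 0 7 1"

definition trmat' :: "int ^ 2 ^ 2" where "trmat' = mat2 1 1 7 8"

lemma trmat_Gamma1: "trmat \<in> Gamma1 7" "trmat' \<in> Gamma1 7"
  by (simp_all add: trmat_def trmat'_def Gamma1_def cong_def)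

lemma trmat_SL2Z [simp]: "trmat \<in> SL2Z" "trmat' \<in> SL2Z"
  by (simp_all add: trmat_def trmat'_def)

lemma act_trmat': "t \<in> HH \<Longrightarrow> act trmat' t = act trmat (t + 1)"
proof -
  assume t: "t \<in> HH"
  have "trmat' = trmat ** tmat 1"
    by (simp add: mat2_eq_iff) (simp add: trmat_def trmat'_def tmat_def)
  moreover have "act (trmat ** tmat 1) t = act trmat (act (tmat 1) t)"
    by (rule act_mult) (use t in auto)
  ultimately show ?thesis by simp
qed

lemma Gamma1_7_iff: "A \<in> Gamma1 7 \<longleftrightarrow> A \<in> SL2Z \<and> 7 dvd ea A - 1 \<and> 7 dvd ed A - 1 \<and> 7 dvd ec A"
  by (simp add: Gamma1_def cong_iff_dvd_diff)

text \<open>At the prime 2 the conditions on the diagonal are automatic: an even lower left entry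
  and determinant 1 force both diagonal entries to be odd.\<close>

lemma Gamma1_14_iff: "A \<in> Gamma1 14 \<longleftrightarrow> A \<in> Gamma1 7 \<and> even (ec A)"
proof
  assume A: "A \<in> Gamma1 14"
  then have "14 dvd ea A - 1" "14 dvd ed A - 1" "14 dvd ec A" "A \<in> SL2Z"
    by (simp_all add: Gamma1_def cong_iff_dvd_diff)
  then have "7 dvd ea A - 1" "7 dvd ed A - 1" "7 dvd ec A" "even (ec A)"
    by presburger+
  then show "A \<in> Gamma1 7 \<and> even (ec A)" using \<open>A \<in> SL2Z\<close> by (simp add: Gamma1_7_iff)
next
  assume A: "A \<in> Gamma1 7 \<and> even (ec A)"
  then have det: "ea A * ed A - eb A * ec A = 1" by (simp add: Gamma1_7_iff SL2Z_iff)
  then have "ea A * ed A = 1 + eb A * ec A" by simp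
  moreover have "odd (1 + eb A * ec A)" using A by simp
  ultimately have "odd (ea A * ed A)" by metis
  then have "odd (ea A)" "odd (ed A)" by simp_all
  moreover have "7 dvd ea A - 1" "7 dvd ed A - 1" "7 dvd ec A" using A by (simp_all add: Gamma1_7_iff)
  moreover have "even (ec A)" using A by simp
  ultimately have "14 dvd ea A - 1" "14 dvd ed A - 1" "14 dvd ec A" by presburger+
  then show "A \<in> Gamma1 14" using A by (simp add: Gamma1_def cong_iff_dvd_diff)
qed

lemma modular_functions_antimono: "\<Gamma> \<subseteq> \<Gamma>' \<Longrightarrow> modular_functions \<Gamma>' \<subseteq> modular_functions \<Gamma>"
  by (auto simp: modular_functions_def)

lemma upsilon_modular_14: "upsilon \<in> modular_functions (Gamma1 14)"
  using modular_functions_antimono[of "Gamma1 14" "Gamma1 7"] upsilon_modular Gamma1_14_iff by blast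

lemma Gamma1_7_mult: "A \<in> Gamma1 7 \<Longrightarrow> B \<in> Gamma1 7 \<Longrightarrow> A ** B \<in> Gamma1 7"
proof -
  assume A: "A \<in> Gamma1 7" and B: "B \<in> Gamma1 7"
  have A': "[ea A = 1] (mod 7)" "[ed A = 1] (mod 7)" "[ec A = 0] (mod 7)" "A \<in> SL2Z"
    and B': "[ea B = 1] (mod 7)" "[ed B = 1] (mod 7)" "[ec B = 0] (mod 7)" "B \<in> SL2Z"
    using A B by (auto simp: Gamma1_def)
  have "[ea A * ea B + eb A * ec B = 1 * 1 + eb A * 0] (mod 7)"
    "[ec A * ea B + ed A * ec B = 0 * 1 + 1 * 0] (mod 7)"
    "[ec A * eb B + ed A * ed B = 0 * eb B + 1 * 1] (mod 7)"
    by (intro cong_add cong_mult A' B' cong_refl)+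
  then show ?thesis using A' B' by (simp add: Gamma1_def)
qed

lemma Gamma1_7_inv: "A \<in> Gamma1 7 \<Longrightarrow> inv2 A \<in> Gamma1 7"
  by (simp add: Gamma1_7_iff)

text \<open>The coset of a matrix is determined by its bottom row modulo 2, because the lower left
  entry of \<open>B ** inv2 A\<close> is the determinant formed from the two bottom rows.\<close>

lemma coset_value:
  assumes h: "\<And>A t. A \<in> Gamma1 14 \<Longrightarrow> t \<in> HH \<Longrightarrow> h (act A t) = h t"
    and B: "B \<in> Gamma1 7" and t: "t \<in> HH"
  shows "h (act B t) = (if even (ec B) then h t else if odd (ed B) then h (act trmat t) else h (act trmat' t))"
proof -
  have BS: "B \<in> SL2Z" using B by (simp add: Gamma1_7_iff)
  have *: "h (act B t) = h (act A t)" if A: "A \<in> Gamma1 7" "even (ec B * ed A - ed B * ec A)" for A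
  proof -
    have AS: "A \<in> SL2Z" using A by (simp add: Gamma1_7_iff)
    have "B ** inv2 A \<in> Gamma1 14"
      unfolding Gamma1_14_iff using Gamma1_7_mult[OF B Gamma1_7_inv[OF A(1)]] A(2) by simp
    then have "h (act (B ** inv2 A) (act A t)) = h (act A t)" using h AS t by simp
    then show ?thesis using AS BS t by (simp add: act_mult)
  qed
  show ?thesis
  proof (cases "even (ec B)")
    case True
    then show ?thesis using h[of B t] B t by (simp add: Gamma1_14_iff)
  next
    case False
    then show ?thesis
      using *[OF trmat_Gamma1(1)] *[OF trmat_Gamma1(2)] by (auto simp: trmat_def trmat'_def)
  qed
qed

definition tr :: "(complex \<Rightarrow> complex) \<Rightarrow> complex \<Rightarrow> complex" where
  "tr h t = h t + h (act trmat t) + h (act trmat' t)"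

text \<open>The bottom rows of \<open>B\<close>, \<open>trmat ** B\<close> and \<open>trmat' ** B\<close> are the three nonzero vectors modulo 2.\<close>

lemma tr_invariant:
  assumes h: "\<And>A t. A \<in> Gamma1 14 \<Longrightarrow> t \<in> HH \<Longrightarrow> h (act A t) = h t"
    and B: "B \<in> Gamma1 7" and t: "t \<in> HH"
  shows "tr h (act B t) = tr h t"
proof -
  have BS: "B \<in> SL2Z" and det: "ea B * ed B - eb B * ec B = 1" using B by (simp_all add: Gamma1_7_iff SL2Z_iff)
  have "tr h (act B t) = h (act B t) + h (act (trmat ** B) t) + h (act (trmat' ** B) t)"
    using BS t by (simp add: tr_def act_mult)
  also have "h (act B t) = (if even (ec B) then h t else if odd (ed B) then h (act trmat t) else h (act trmat' t))"
    by (rule coset_value[of h, OF h B t])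
  also have "h (act (trmat ** B) t) = (if even (7 * ea B + ec B) then h t else if odd (7 * eb B + ed B) then h (act trmat t) else h (act trmat' t))"
    using coset_value[of h, OF h Gamma1_7_mult[OF trmat_Gamma1(1) B] t] by (simp add: trmat_def)
  also have "h (act (trmat' ** B) t) = (if even (7 * ea B + 8 * ec B) then h t else if odd (7 * eb B + 8 * ed B) then h (act trmat t) else h (act trmat' t))"
    using coset_value[of h, OF h Gamma1_7_mult[OF trmat_Gamma1(2) B] t] by (simp add: trmat'_def)
  finally have eq: "tr h (act B t) = (if even (ec B) then h t else if odd (ed B) then h (act trmat t) else h (act trmat' t)) +
     (if even (7 * ea B + ec B) then h t else if odd (7 * eb B + ed B) then h (act trmat t) else h (act trmat' t)) +
     (if even (7 * ea B + 8 * ec B) then h t else if odd (7 * eb B + 8 * ed B) then h (act trmat t) else h (act trmat' t))" .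
  \<comment> \<open>Only the six parity patterns of an invertible matrix modulo 2 remain, and each
    of them permutes the three summands.\<close>
  have "odd (ea B * ed B - eb B * ec B)" unfolding det by simp
  then show ?thesis
    unfolding eq unfolding tr_def
    by (cases "even (ea B)"; cases "even (eb B)"; cases "even (ec B)"; cases "even (ed B)") (simp_all add: ac_simps)
qed

lemma tr_modular:
  assumes c: "cusp_meromorphic h" and h: "\<And>A t. A \<in> Gamma1 14 \<Longrightarrow> t \<in> HH \<Longrightarrow> h (act A t) = h t"
  shows "mer (tr h) \<in> modular_functions (Gamma1 7)" "tr h meromorphic_on HH"
proof -
  have ct: "cusp_meromorphic (tr h)"
    unfolding tr_def[abs_def] by (intro cusp_intros c) auto
  then show "tr h meromorphic_on HH" by (simp add: cusp_meromorphic_def)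
  show "mer (tr h) \<in> modular_functions (Gamma1 7)"
  proof (rule modular_functions_mer[OF ct Gamma1_subset])
    fix A :: "int ^ 2 ^ 2" assume A: "A \<in> Gamma1 7"
    have "\<forall>\<^sub>\<approx>t\<in>HH. t \<in> HH" by (rule eventually_in_cosparse) auto
    then show "\<forall>\<^sub>\<approx>t\<in>HH. tr h (act A t) = tr h t"
      by eventually_elim (rule tr_invariant[of h, OF h A])
  qed
qed

lemma tr_rational_in_upsilon:
  assumes c: "cusp_meromorphic h" and h: "\<And>A t. A \<in> Gamma1 14 \<Longrightarrow> t \<in> HH \<Longrightarrow> h (act A t) = h t"
  obtains p r where "r \<noteq> 0" "\<forall>\<^sub>\<approx>t\<in>HH. tr h t = poly p (upsilon t) / poly r (upsilon t)"
proof -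
  have m: "mer (tr h) \<in> modular_functions (Gamma1 7)" "tr h meromorphic_on HH"
    by (rule tr_modular[of h, OF c h]; assumption)+
  obtain p r where pr: "r \<noteq> 0" "\<forall>\<^sub>\<approx>t\<in>HH. mer (tr h) t = poly p (upsilon t) / poly r (upsilon t)"
    by (rule modular_functions_Gamma1_7[OF m(1)]) (rule that; assumption)
  from pr(2) mer_ae[OF m(2)] have "\<forall>\<^sub>\<approx>t\<in>HH. tr h t = poly p (upsilon t) / poly r (upsilon t)"
    by eventually_elim simp
  with pr(1) show ?thesis by (rule that)
qed

text \<open>Near \<open>\<i>\<infinity>\<close> the three conjugates of \<open>g1\<close> behave like a constant and \<open>\<plusminus>c q\<^sup>-\<^sup>1\<^sup>/\<^sup>2\<close>, so they are distinct.\<close>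

lemma g1_asym_inf: "asym g1 0"
proof -
  have v: "asym (\<lambda>t. V j (2 * t)) (14 * lam (of_int j / 7))" if "\<not> 7 dvd j" for j
    using asym_kl[of "of_int j / 7" 0 14 0] of_int_divide_in_Ints_iff[of 7 j] that by (simp add: V_def)
  have "asym (\<lambda>t. (V 3 t / V 2 t) ^ 2 / (V 3 (2 * t) / V 2 (2 * t)))
    (of_nat 2 * (7 * lam (of_int 3 / 7) - 7 * lam (of_int 2 / 7)) - (14 * lam (of_int 3 / 7) - 14 * lam (of_int 2 / 7)))"
    by (intro asym_divide asym_power asym_V v) auto
  then have "asym (\<lambda>t. (V 3 t / V 2 t) ^ 2 / (V 3 (2 * t) / V 2 (2 * t))) 0" by simp
  then show ?thesis
    by (rule asym_cong) (simp add: g1_eq in_upper_half_plane)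
qed

text \<open>The numerator of \<open>g1\<close> keeps its expansion because \<open>trmat\<close> is
  in \<open>Gamma1 7\<close>. The denominator is moved to another cusp of \<open>X_1(7)\<close> and
  supplies the different exponent.\<close>

lemma g1_asym_trmat: "asym (\<lambda>t. g1 (act trmat t)) (- 1 / 2)"
proof -
  \<comment> \<open>With T = 7 (t + 1) / 2 one has 14 t / (7 t + 1) = (2 T - 7) / (T - 3), and this
    matrix has determinant 1.\<close>
  define T where "T = (\<lambda>t::complex. of_real (7/2) * t + of_real (7/2))"
  define k where "k = (\<lambda>j::int. \<lambda>t. kl (of_int (2 * j) / 7) (of_int (- j)) (T t))"
  have k: "asym (k j) (7/2 * lam (of_int (2 * j) / 7))" if "\<not> 7 dvd 2 * j" for j
    unfolding k_def T_def using of_int_divide_in_Ints_iff[of 7 "2 * j"] that by (intro asym_kl) auto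
  have "asym (\<lambda>t. (V 3 t / V 2 t) ^ 2 / (k 3 t / k 2 t))
    (of_nat 2 * (7 * lam (of_int 3 / 7) - 7 * lam (of_int 2 / 7)) - (7/2 * lam (of_int (2 * 3) / 7) - 7/2 * lam (of_int (2 * 2) / 7)))"
    by (intro asym_divide asym_power asym_V k) auto
  then have "asym (\<lambda>t. (V 3 t / V 2 t) ^ 2 / (k 3 t / k 2 t)) (- 1 / 2)"
    unfolding lam_int_divide_7 by simp
  then show ?thesis
  proof (rule asym_cong)
    fix t assume t: "t \<in> HH"
    then have It: "Im (T t) > 0" by (simp add: T_def in_upper_half_plane)
    have I: "Im (act trmat t) > 0" using act_in_upper_half_plane[of trmat t] t by (simp add: in_upper_half_plane)
    have q: "V 3 (act trmat t) / V 2 (act trmat t) = V 3 t / V 2 t"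
      using V_quotient_Gamma1[OF trmat_Gamma1(1) t, of 0] by (simp add: trmat_def)
    have det: "2 * (- 3) - (- 7) * 1 = (1::int)" by simp
    obtain C where C: "C \<noteq> 0" "\<And>r s. kl r s ((of_int 2 * T t + of_int (-7)) / (of_int 1 * T t + of_int (-3))) =
       C * kl (r * of_int 2 + s * of_int 1) (r * of_int (-7) + s * of_int (-3)) (T t)"
      using kl_modular[OF It det] by blast
    have den: "7 * t + 1 \<noteq> 0" using t by (auto simp: complex_eq_iff in_upper_half_plane)
    have T2: "of_int 1 * T t + of_int (-3) = (7 * t + 1) / 2" "of_int 2 * T t + of_int (-7) = 7 * t"
      by (simp_all add: T_def field_simps)
    have "14 * act trmat t = (of_int 2 * T t + of_int (-7)) / (of_int 1 * T t + of_int (-3))"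
      unfolding T2 by (simp add: act_eq trmat_def)
    then have V: "V j (2 * act trmat t) = C * k j t" for j
      using C(2)[of "of_int j / 7" 0] by (simp add: V_def k_def mult.commute)
    show "(V 3 t / V 2 t) ^ 2 / (k 3 t / k 2 t) = g1 (act trmat t)"
      unfolding g1_eq[OF I] q V using C(1) by simp
  qed
qed

lemma not_asym_bounded:
  assumes "asym f \<mu>" "\<mu> < 0" "bdd_inf f"
  shows False
proof -
  obtain c where c: "c \<noteq> 0" "((\<lambda>t. f t * expi2 (- of_real \<mu> * t)) \<longlongrightarrow> c) at_ii_inf"
    using assms(1) unfolding asym_def by blast
  obtain M where M: "eventually (\<lambda>t. norm (f t) \<le> M) at_ii_inf" using assms(3) unfolding bdd_inf_def by blast
  have e0: "((\<lambda>t. M * norm (expi2 (- of_real \<mu> * t))) \<longlongrightarrow> M * norm (0::complex)) at_ii_inf"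
    using expi2_tendsto_0[of "- \<mu>" 0] assms(2) by (intro tendsto_intros) simp
  have "((\<lambda>t. f t * expi2 (- of_real \<mu> * t)) \<longlongrightarrow> 0) at_ii_inf"
  proof (rule Lim_null_comparison)
    show "eventually (\<lambda>t. norm (f t * expi2 (- of_real \<mu> * t)) \<le> M * norm (expi2 (- of_real \<mu> * t))) at_ii_inf"
      using M by eventually_elim (simp add: norm_mult mult_right_mono)
    show "((\<lambda>t. M * norm (expi2 (- of_real \<mu> * t))) \<longlongrightarrow> 0) at_ii_inf" using e0 by simp
  qed
  from tendsto_unique[OF at_ii_inf_neq_bot c(2) this] c(1) show False by simp
qed

lemma holomorphic_ae_neq:
  assumes "f holomorphic_on HH" "g holomorphic_on HH" "\<not> (\<forall>t\<in>HH. f t = g t)"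
  shows "\<forall>\<^sub>\<approx>t\<in>HH. f t \<noteq> g t"
proof -
  have "(\<lambda>t. f t - g t) analytic_on HH"
    using assms by (simp add: analytic_on_open holomorphic_on_diff)
  then have "(\<lambda>t. f t - g t) nicely_meromorphic_on HH" by (rule analytic_on_imp_nicely_meromorphic_on)
  then have "(\<forall>t\<in>HH. f t - g t = 0) \<or> (\<forall>\<^sub>\<approx>t\<in>HH. f t - g t \<noteq> 0)"
    by (rule nicely_meromorphic_imp_constant_or_avoid) auto
  with assms(3) show ?thesis by auto
qed

lemma g1_conjugates_distinct:
  "\<forall>\<^sub>\<approx>t\<in>HH. g1 t \<noteq> g1 (act trmat t)" "\<forall>\<^sub>\<approx>t\<in>HH. g1 t \<noteq> g1 (act trmat' t)"
  "\<forall>\<^sub>\<approx>t\<in>HH. g1 (act trmat t) \<noteq> g1 (act trmat' t)"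
proof -
  have h: "(\<lambda>t. g1 (act trmat t)) holomorphic_on HH" "(\<lambda>t. g1 (act trmat' t)) holomorphic_on HH"
    by (intro holomorphic_act g1_holomorphic; simp)+
  have b: "bdd_inf g1" unfolding bdd_inf_def using asym_bounded[OF g1_asym_inf] by simp
  have "asym (\<lambda>t. g1 (act trmat (of_real 1 * t + of_real 1))) (1 * (- 1 / 2))"
    by (rule asym_affine[OF g1_asym_trmat]) simp
  then have "asym (\<lambda>t. g1 (act trmat' t)) (1 * (- 1 / 2))"
    by (rule asym_cong) (simp add: act_trmat')
  then have a': "asym (\<lambda>t. g1 (act trmat' t)) (- 1 / 2)"
    by simp
  show "\<forall>\<^sub>\<approx>t\<in>HH. g1 t \<noteq> g1 (act trmat t)"
  proof (rule holomorphic_ae_neq[OF g1_holomorphic h(1)], rule notI)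
    assume "\<forall>t\<in>HH. g1 t = g1 (act trmat t)"
    then have "bdd_inf (\<lambda>t. g1 (act trmat t))" by (intro bdd_inf_cong[OF b]) auto
    with not_asym_bounded[OF g1_asym_trmat] show False by simp
  qed
  show "\<forall>\<^sub>\<approx>t\<in>HH. g1 t \<noteq> g1 (act trmat' t)"
  proof (rule holomorphic_ae_neq[OF g1_holomorphic h(2)], rule notI)
    assume "\<forall>t\<in>HH. g1 t = g1 (act trmat' t)"
    then have "bdd_inf (\<lambda>t. g1 (act trmat' t))" by (intro bdd_inf_cong[OF b]) auto
    with not_asym_bounded[OF a'] show False by simp
  qed
  show "\<forall>\<^sub>\<approx>t\<in>HH. g1 (act trmat t) \<noteq> g1 (act trmat' t)"
  proof (rule holomorphic_ae_neq[OF h], rule notI)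
    \<comment> \<open>The translation by 1 takes one conjugate to the other and changes the sign of
      the parameter \<open>expi2 (t / 2)\<close>, so equality would make the leading coefficient its
      own negative.\<close>
    assume *: "\<forall>t\<in>HH. g1 (act trmat t) = g1 (act trmat' t)"
    obtain c where c: "c \<noteq> 0" "((\<lambda>t. g1 (act trmat t) * expi2 (- of_real (- 1 / 2) * t)) \<longlongrightarrow> c) at_ii_inf"
      using g1_asym_trmat unfolding asym_def by blast
    have fl: "filterlim (\<lambda>t. t + 1) at_ii_inf at_ii_inf"
      unfolding filterlim_iff
    proof (intro allI impI)
      fix P assume "eventually P at_ii_inf"
      then obtain d where "\<And>t. Im t > d \<Longrightarrow> P t" unfolding eventually_at_ii_inf by blast
      then show "eventually (\<lambda>t. P (t + 1)) at_ii_inf"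
        unfolding eventually_at_ii_inf by (intro exI[of _ d]) simp
    qed
    have "((\<lambda>t. g1 (act trmat (t + 1)) * expi2 (- of_real (- 1 / 2) * (t + 1))) \<longlongrightarrow> c) at_ii_inf"
      using filterlim_compose[OF c(2) fl] .
    moreover have "eventually (\<lambda>t. g1 (act trmat (t + 1)) * expi2 (- of_real (- 1 / 2) * (t + 1)) =
        - (g1 (act trmat t) * expi2 (- of_real (- 1 / 2) * t))) at_ii_inf"
      unfolding eventually_at_ii_inf
    proof (intro exI[of _ 0] allI impI)
      fix t :: complex assume "Im t > 0"
      then have t: "t \<in> HH" by (simp add: in_upper_half_plane)
      have "expi2 (- of_real (- 1 / 2) * (t + 1)) = expi2 (- of_real (- 1 / 2) * t) * expi2 (1 / 2)"
        unfolding expi2_add [symmetric] by (rule arg_cong[of _ _ expi2]) (simp add: field_simps)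
      then have e: "expi2 (- of_real (- 1 / 2) * (t + 1)) = - expi2 (- of_real (- 1 / 2) * t)"
        unfolding expi2_half by simp
      have "g1 (act trmat (t + 1)) = g1 (act trmat t)"
        using * t act_trmat'[OF t] by metis
      then show "g1 (act trmat (t + 1)) * expi2 (- of_real (- 1 / 2) * (t + 1)) =
        - (g1 (act trmat t) * expi2 (- of_real (- 1 / 2) * t))"
        unfolding e by simp
    qed
    ultimately have "((\<lambda>t. - (g1 (act trmat t) * expi2 (- of_real (- 1 / 2) * t))) \<longlongrightarrow> c) at_ii_inf"
      by (rule Lim_transform_eventually)
    from tendsto_unique[OF at_ii_inf_neq_bot this tendsto_minus[OF c(2)]] have "c = - c" .
    with c(1) show False by simp
  qed
qed

text \<open>
  Lagrange interpolation at the roots of the cubic, with \<open>D\<close> its derivative. The cofactor of the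
  root \<open>g\<close> is \<open>x\<^sup>2 + (g + 1) x + (g\<^sup>2 + g - s)\<close>.
\<close>

lemma cubic_interpolation:
  fixes g0 g1 g2 f0 f1 f2 s q :: complex
  assumes r: "g0 ^ 3 + g0\<^sup>2 - s * g0 + q = 0" "g1 ^ 3 + g1\<^sup>2 - s * g1 + q = 0" "g2 ^ 3 + g2\<^sup>2 - s * g2 + q = 0"
    and d: "g0 \<noteq> g1" "g0 \<noteq> g2" "g1 \<noteq> g2"
  defines "D \<equiv> \<lambda>g. 3 * g\<^sup>2 + 2 * g - s"
  shows "f0 = (f0 / D g0 * (g0\<^sup>2 + g0 - s) + f1 / D g1 * (g1\<^sup>2 + g1 - s) + f2 / D g2 * (g2\<^sup>2 + g2 - s)) +
     (f0 / D g0 * (g0 + 1) + f1 / D g1 * (g1 + 1) + f2 / D g2 * (g2 + 1)) * g0 +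
     (f0 / D g0 + f1 / D g1 + f2 / D g2) * g0\<^sup>2"
proof -
  have q: "g0\<^sup>2 + (g + 1) * g0 + (g\<^sup>2 + g - s) = 0" if "g0 \<noteq> g" "g ^ 3 + g\<^sup>2 - s * g + q = 0" for g
  proof -
    have "(g0 - g) * (g0\<^sup>2 + (g + 1) * g0 + (g\<^sup>2 + g - s)) =
        (g0 ^ 3 + g0\<^sup>2 - s * g0 + q) - (g ^ 3 + g\<^sup>2 - s * g + q)"
      by (simp add: algebra_simps power2_eq_square power3_eq_cube)
    then show ?thesis using that r(1) by simp
  qed
  have q1: "g0\<^sup>2 + (g1 + 1) * g0 + (g1\<^sup>2 + g1 - s) = 0" and q2: "g0\<^sup>2 + (g2 + 1) * g0 + (g2\<^sup>2 + g2 - s) = 0"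
    using q d r by blast+
  \<comment> \<open>Two cofactors vanish at \<open>g0\<close>; their difference shows that the roots
    have sum -1.\<close>
  have "(g1 - g2) * (g0 + g1 + g2 + 1) = (g0\<^sup>2 + (g1 + 1) * g0 + (g1\<^sup>2 + g1 - s)) - (g0\<^sup>2 + (g2 + 1) * g0 + (g2\<^sup>2 + g2 - s))"
    by (simp add: algebra_simps power2_eq_square)
  then have "(g1 - g2) * (g0 + g1 + g2 + 1) = 0" unfolding q1 q2 by simp
  then have "g0 + g1 + g2 + 1 = 0" using d(3) by simp
  then have sum: "g2 = - g0 - g1 - 1" by (simp add: algebra_simps eq_neg_iff_add_eq_0)
  \<comment> \<open>The derivative at a root is the product of the differences to the other
    roots.\<close>
  have "D g0 = (g0 - g1) * (2 * g0 + g1 + 1) + (g0\<^sup>2 + (g1 + 1) * g0 + (g1\<^sup>2 + g1 - s))"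
    by (simp add: D_def algebra_simps power2_eq_square)
  also have "\<dots> = (g0 - g1) * (g0 - g2)" unfolding q1 sum by (simp add: algebra_simps)
  finally have D0: "D g0 \<noteq> 0" using d by simp
  have "(f0 / D g0 * (g0\<^sup>2 + g0 - s) + f1 / D g1 * (g1\<^sup>2 + g1 - s) + f2 / D g2 * (g2\<^sup>2 + g2 - s)) +
     (f0 / D g0 * (g0 + 1) + f1 / D g1 * (g1 + 1) + f2 / D g2 * (g2 + 1)) * g0 +
     (f0 / D g0 + f1 / D g1 + f2 / D g2) * g0\<^sup>2 =
     f0 / D g0 * D g0 + f1 / D g1 * (g0\<^sup>2 + (g1 + 1) * g0 + (g1\<^sup>2 + g1 - s)) +
     f2 / D g2 * (g0\<^sup>2 + (g2 + 1) * g0 + (g2\<^sup>2 + g2 - s))"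
  proof -
    \<comment> \<open>The quotients by \<open>D\<close> are replaced by variables to obtain a
      polynomial identity.\<close>
    have "x0 * (g0\<^sup>2 + g0 - s) + x1 * (g1\<^sup>2 + g1 - s) + x2 * (g2\<^sup>2 + g2 - s) +
     (x0 * (g0 + 1) + x1 * (g1 + 1) + x2 * (g2 + 1)) * g0 + (x0 + x1 + x2) * g0\<^sup>2 =
     x0 * (3 * g0\<^sup>2 + 2 * g0 - s) + x1 * (g0\<^sup>2 + (g1 + 1) * g0 + (g1\<^sup>2 + g1 - s)) +
     x2 * (g0\<^sup>2 + (g2 + 1) * g0 + (g2\<^sup>2 + g2 - s))" for x0 x1 x2
      by (simp add: algebra_simps power2_eq_square)
    then show ?thesis unfolding D_def by blast
  qed
  also have "\<dots> = f0" unfolding q1 q2 using D0 by simp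
  finally show ?thesis by simp
qed

theorem modular_functions_Gamma1_14:
  assumes f: "f \<in> modular_functions (Gamma1 14)"
  obtains p0 r0 p1 r1 p2 r2 where "\<forall>\<^sub>\<approx>t\<in>HH. f t = poly p0 (upsilon t) / poly r0 (upsilon t) +
     poly p1 (upsilon t) / poly r1 (upsilon t) * g1 t + poly p2 (upsilon t) / poly r2 (upsilon t) * (g1 t)\<^sup>2"
proof -
  define s where "s = (\<lambda>t. ((upsilon t)\<^sup>2 - 1) / upsilon t)"
  define D where "D = (\<lambda>t. 3 * (g1 t)\<^sup>2 + 2 * g1 t - s t)"
  note cu = modular_functionsD(2)[OF upsilon_modular] and cf = modular_functionsD(2)[OF f]
    and cg = modular_functionsD(2)[OF g1_modular]
  note inv = modular_functionsD(4)[OF upsilon_modular_14] modular_functionsD(4)[OF f] modular_functionsD(4)[OF g1_modular]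
  \<comment> \<open>The cofactor coefficients divided by \<open>D\<close> form the basis dual to 1,
    \<open>g1\<close>, \<open>g1\<close>^2 under the trace. So the traces of \<open>h0\<close>,
    \<open>h1\<close>, \<open>h2\<close> are the coefficients of \<open>f\<close>.\<close>
  define h0 where "h0 = (\<lambda>t. f t / D t * ((g1 t)\<^sup>2 + g1 t - s t))"
  define h1 where "h1 = (\<lambda>t. f t / D t * (g1 t + 1))"
  define h2 where "h2 = (\<lambda>t. f t / D t)"
  have c: "cusp_meromorphic h0" "cusp_meromorphic h1" "cusp_meromorphic h2"
    unfolding h0_def h1_def h2_def D_def s_def by (intro cusp_intros cu cf cg)+
  have i0: "h0 (act A t) = h0 t" and i1: "h1 (act A t) = h1 t" and i2: "h2 (act A t) = h2 t"
    if "A \<in> Gamma1 14" "t \<in> HH" for A t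
    using inv that by (simp_all add: h0_def h1_def h2_def D_def s_def)
  obtain p0 r0 where 0: "\<forall>\<^sub>\<approx>t\<in>HH. tr h0 t = poly p0 (upsilon t) / poly r0 (upsilon t)"
    using tr_rational_in_upsilon[of h0, OF c(1) i0] by blast
  obtain p1 r1 where 1: "\<forall>\<^sub>\<approx>t\<in>HH. tr h1 t = poly p1 (upsilon t) / poly r1 (upsilon t)"
    using tr_rational_in_upsilon[of h1, OF c(2) i1] by blast
  obtain p2 r2 where 2: "\<forall>\<^sub>\<approx>t\<in>HH. tr h2 t = poly p2 (upsilon t) / poly r2 (upsilon t)"
    using tr_rational_in_upsilon[of h2, OF c(3) i2] by blast
  have inH: "\<forall>\<^sub>\<approx>t\<in>HH. t \<in> HH" by (rule eventually_in_cosparse) auto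
  have "\<forall>\<^sub>\<approx>t\<in>HH. f t = tr h0 t + tr h1 t * g1 t + tr h2 t * (g1 t)\<^sup>2"
    using g1_conjugates_distinct inH
  proof eventually_elim
    case (elim t)
    define q where "q = (upsilon t - 1)\<^sup>2 / upsilon t"
    have ui: "upsilon (act trmat t) = upsilon t" "upsilon (act trmat' t) = upsilon t"
      using upsilon_invariant trmat_Gamma1 elim(4) by blast+
    have rel: "g1 w ^ 3 + (g1 w)\<^sup>2 - s t * g1 w + q = 0" if w: "w \<in> HH" "upsilon w = upsilon t" for w
    proof -
      have "upsilon t \<noteq> 0" using upsilon_nonzero elim(4) by (simp add: in_upper_half_plane)
      moreover have "upsilon t * g1 w ^ 3 + upsilon t * (g1 w)\<^sup>2 - ((upsilon t)\<^sup>2 - 1) * g1 w + (upsilon t - 1)\<^sup>2 = 0"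
        using upsilon_g1_relation[of w] w by (simp add: in_upper_half_plane)
      moreover have "g1 w ^ 3 + (g1 w)\<^sup>2 - s t * g1 w + q =
        (upsilon t * g1 w ^ 3 + upsilon t * (g1 w)\<^sup>2 - ((upsilon t)\<^sup>2 - 1) * g1 w + (upsilon t - 1)\<^sup>2) / upsilon t"
        using calculation(1) by (simp add: s_def q_def field_simps)
      ultimately show ?thesis by simp
    qed
    have ss: "s (act trmat t) = s t" "s (act trmat' t) = s t" by (simp_all add: s_def ui)
    have H: "act trmat t \<in> HH" "act trmat' t \<in> HH" using elim(4) by simp_all
    show ?case
      unfolding tr_def h0_def h1_def h2_def D_def ss
      by (rule cubic_interpolation[OF rel[OF elim(4) refl] rel[OF H(1) ui(1)] rel[OF H(2) ui(2)] elim(1-3)])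
  qed
  with 0 1 2 have "\<forall>\<^sub>\<approx>t\<in>HH. f t = poly p0 (upsilon t) / poly r0 (upsilon t) +
     poly p1 (upsilon t) / poly r1 (upsilon t) * g1 t + poly p2 (upsilon t) / poly r2 (upsilon t) * (g1 t)\<^sup>2"
    by eventually_elim simp
  then show ?thesis by (rule that)
qed

section \<open>The generated subfield\<close>

text \<open>Membership up to normalisation: rational expressions can be written pointwise instead of
  with the operations of the field.\<close>

definition rat_gen :: "(complex \<Rightarrow> complex) set \<Rightarrow> (complex \<Rightarrow> complex) \<Rightarrow> bool" where
  "rat_gen S F \<longleftrightarrow> F meromorphic_on HH \<and>
     mer F \<in> generate_field (modular_function_field (Gamma1 14)) (range (\<lambda>c. mer (\<lambda>_. c)) \<union> S)"

context
  fixes S :: "(complex \<Rightarrow> complex) set"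
  assumes S: "S \<subseteq> modular_functions (Gamma1 14)"
begin

lemma rat_gen_in_modular_functions:
  assumes "rat_gen S F"
  shows "mer F \<in> modular_functions (Gamma1 14)"
proof -
  interpret field "modular_function_field (Gamma1 14)"
    by (rule field_modular_function_field[OF Gamma1_subset])
  have "range (\<lambda>c. mer (\<lambda>_. c)) \<union> S \<subseteq> carrier (modular_function_field (Gamma1 14))"
    using S modular_functions_const[OF Gamma1_subset] by (auto simp: modular_function_field_def)
  from generate_field_in_carrier[OF this] assms show ?thesis
    by (simp add: rat_gen_def modular_function_field_def)
qed

lemma rat_gen_cong:
  assumes "rat_gen S F" "\<forall>\<^sub>\<approx>t\<in>HH. F t = G t"
  shows "rat_gen S G"
proof -
  have "G meromorphic_on HH"
    using assms meromorphic_on_cong'[OF assms(2) refl] by (simp add: rat_gen_def)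
  then show ?thesis
    using assms mer_cong[OF assms(2)] by (simp add: rat_gen_def)
qed

lemma rat_gen_const: "rat_gen S (\<lambda>_. c)"
  unfolding rat_gen_def by (auto intro: generate_field.incl)

lemma rat_gen_base:
  assumes "s \<in> S"
  shows "rat_gen S s"
proof -
  have s: "s \<in> modular_functions (Gamma1 14)" using assms S by blast
  then show ?thesis
    unfolding rat_gen_def using mer_meromorphicD[OF Gamma1_subset s] modular_functionsD(3)[OF s] assms
    by (auto intro: generate_field.incl)
qed

lemma rat_gen_add:
  assumes "rat_gen S F" "rat_gen S G"
  shows "rat_gen S (\<lambda>t. F t + G t)"
proof -
  have m: "F meromorphic_on HH" "G meromorphic_on HH" using assms by (auto simp: rat_gen_def)
  from mer_ae[OF m(1)] mer_ae[OF m(2)] have "\<forall>\<^sub>\<approx>t\<in>HH. mer F t + mer G t = F t + G t"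
    by eventually_elim simp
  then have "mer (\<lambda>t. mer F t + mer G t) = mer (\<lambda>t. F t + G t)" by (rule mer_cong)
  then have "mer (\<lambda>t. F t + G t) = mer F \<oplus>\<^bsub>modular_function_field (Gamma1 14)\<^esub> mer G"
    by (simp add: modular_function_field_def)
  then show ?thesis
    using assms m unfolding rat_gen_def by (auto intro: generate_field.eng_add meromorphic_on_add)
qed

lemma rat_gen_mult:
  assumes "rat_gen S F" "rat_gen S G"
  shows "rat_gen S (\<lambda>t. F t * G t)"
proof -
  have m: "F meromorphic_on HH" "G meromorphic_on HH" using assms by (auto simp: rat_gen_def)
  from mer_ae[OF m(1)] mer_ae[OF m(2)] have "\<forall>\<^sub>\<approx>t\<in>HH. mer F t * mer G t = F t * G t"
    by eventually_elim simp
  then have "mer (\<lambda>t. mer F t * mer G t) = mer (\<lambda>t. F t * G t)" by (rule mer_cong)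
  then have "mer (\<lambda>t. F t * G t) = mer F \<otimes>\<^bsub>modular_function_field (Gamma1 14)\<^esub> mer G"
    by (simp add: modular_function_field_def)
  then show ?thesis
    using assms m unfolding rat_gen_def by (auto intro: generate_field.eng_mult meromorphic_on_mult)
qed

lemma rat_gen_inverse:
  assumes F: "rat_gen S F"
  shows "rat_gen S (\<lambda>t. inverse (F t))"
proof -
  let ?K = "modular_function_field (Gamma1 14)"
  interpret K: field ?K by (rule field_modular_function_field[OF Gamma1_subset])
  have m: "F meromorphic_on HH" using assms by (auto simp: rat_gen_def)
  define y where "y = mer F"
  have y: "y \<in> modular_functions (Gamma1 14)" unfolding y_def by (rule rat_gen_in_modular_functions[OF F])
  show ?thesis
  proof (cases "\<forall>t\<in>HH. y t = 0")
    \<comment> \<open>As \<open>inverse 0 = 0\<close>, the pointwise inverse of the zero function is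
      again the zero function, and closure under inverses and quotients holds without
      exception.\<close>
    case True
    have inH: "\<forall>\<^sub>\<approx>t\<in>HH. t \<in> HH" by (rule eventually_in_cosparse) auto
    from inH mer_ae[OF m] have "\<forall>\<^sub>\<approx>t\<in>HH. 0 = inverse (F t)"
      by eventually_elim (use True in \<open>simp add: y_def\<close>)
    then show ?thesis by (rule rat_gen_cong[OF rat_gen_const])
  next
    case False
    then have nz: "\<forall>\<^sub>\<approx>t\<in>HH. y t \<noteq> 0"
      using nicely_meromorphic_imp_constant_or_avoid[OF modular_functionsD(1)[OF y]] by blast
    define z where "z = mer (\<lambda>t. inverse (F t))"
    have im: "(\<lambda>t. inverse (F t)) meromorphic_on HH" using m by (intro meromorphic_intros)
    have zK: "z \<in> modular_functions (Gamma1 14)"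
    proof -
      have "mer (\<lambda>t. mer (\<lambda>_. 1) t / y t) \<in> modular_functions (Gamma1 14)"
        by (intro modular_functions_divide[OF Gamma1_subset] modular_functions_const[OF Gamma1_subset] y)
      moreover have "\<forall>\<^sub>\<approx>t\<in>HH. mer (\<lambda>_. 1) t = 1" by (intro mer_ae) auto
      with mer_ae[OF m] have "\<forall>\<^sub>\<approx>t\<in>HH. mer (\<lambda>_. 1) t / y t = inverse (F t)"
        by eventually_elim (simp add: y_def divide_inverse)
      then have "mer (\<lambda>t. mer (\<lambda>_. 1) t / y t) = z" unfolding z_def by (rule mer_cong)
      ultimately show ?thesis by simp
    qed
    from nz mer_ae[OF m] mer_ae[OF im] have "\<forall>\<^sub>\<approx>t\<in>HH. y t * z t = 1"
      by eventually_elim (simp add: y_def z_def)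
    then have "mer (\<lambda>t. y t * z t) = mer (\<lambda>_. 1)" by (rule mer_cong)
    then have "y \<otimes>\<^bsub>?K\<^esub> z = \<one>\<^bsub>?K\<^esub>" by (simp add: modular_function_field_def)
    moreover have "y \<in> carrier ?K" "z \<in> carrier ?K" using y zK by (simp_all add: modular_function_field_def)
    ultimately have "inv\<^bsub>?K\<^esub> y = z" by (intro K.comm_inv_char)
    moreover have "y \<noteq> \<zero>\<^bsub>?K\<^esub>"
    proof
      assume "y = \<zero>\<^bsub>?K\<^esub>"
      then have "y = mer (\<lambda>_. 0)" by (simp add: modular_function_field_def)
      with False show False by (auto simp: mer_def)
    qed
    ultimately show ?thesis
      using F im unfolding rat_gen_def y_def [symmetric] z_def [symmetric]
      by (metis generate_field.m_inv)
  qed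
qed

lemma rat_gen_divide: "rat_gen S F \<Longrightarrow> rat_gen S G \<Longrightarrow> rat_gen S (\<lambda>t. F t / G t)"
  using rat_gen_mult[of F "\<lambda>t. inverse (G t)"] rat_gen_inverse[of G] by (simp add: divide_inverse)

lemma rat_gen_power: "rat_gen S F \<Longrightarrow> rat_gen S (\<lambda>t. F t ^ n)"
  by (induction n) (auto intro: rat_gen_const rat_gen_mult)

lemma rat_gen_poly: "rat_gen S F \<Longrightarrow> rat_gen S (\<lambda>t. poly p (F t))"
  by (induction p) (auto intro: rat_gen_const rat_gen_mult rat_gen_add)

lemma generated_over_CI:
  assumes u: "rat_gen S upsilon" and g: "rat_gen S g1"
  shows "generated_over_C (modular_function_field (Gamma1 14)) S"
  unfolding generated_over_C_def
proof
  let ?K = "modular_function_field (Gamma1 14)"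
  interpret K: field ?K by (rule field_modular_function_field[OF Gamma1_subset])
  have "range (\<lambda>c. mer (\<lambda>_. c)) \<union> S \<subseteq> carrier ?K"
    using S modular_functions_const[OF Gamma1_subset] by (auto simp: modular_function_field_def)
  then show "generate_field ?K (range (\<lambda>c. mer (\<lambda>_. c)) \<union> S) \<subseteq> carrier ?K"
    by (rule K.generate_field_incl)
  show "carrier ?K \<subseteq> generate_field ?K (range (\<lambda>c. mer (\<lambda>_. c)) \<union> S)"
  proof
    fix f assume "f \<in> carrier ?K"
    then have f: "f \<in> modular_functions (Gamma1 14)" by (simp add: modular_function_field_def)
    obtain p0 r0 p1 r1 p2 r2 where eq: "\<forall>\<^sub>\<approx>t\<in>HH. f t = poly p0 (upsilon t) / poly r0 (upsilon t) +
     poly p1 (upsilon t) / poly r1 (upsilon t) * g1 t + poly p2 (upsilon t) / poly r2 (upsilon t) * (g1 t)\<^sup>2"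
      by (rule modular_functions_Gamma1_14[OF f]) (rule that; assumption)
    have "rat_gen S (\<lambda>t. poly p0 (upsilon t) / poly r0 (upsilon t) +
     poly p1 (upsilon t) / poly r1 (upsilon t) * g1 t + poly p2 (upsilon t) / poly r2 (upsilon t) * (g1 t)\<^sup>2)"
      by (intro rat_gen_add rat_gen_mult rat_gen_divide rat_gen_poly rat_gen_power u g)
    then have "rat_gen S f"
      by (rule rat_gen_cong) (use eq in \<open>auto elim: eventually_mono\<close>)
    then show "f \<in> generate_field ?K (range (\<lambda>c. mer (\<lambda>_. c)) \<union> S)"
      using modular_functionsD(3)[OF f] by (simp add: rat_gen_def)
  qed
qed

end

section \<open>The coordinate functions\<close>

lemma X0_eq: "t \<in> HH \<Longrightarrow> X0 t = - 1 / g1 t"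
  unfolding X0_def
  by (rule mer_eq_holomorphic[of "\<lambda>t. - 1 / g1 t"])
    (auto intro!: holomorphic_intros g1_holomorphic simp: g1_nonzero in_upper_half_plane)

lemma Y0_eq: "t \<in> HH \<Longrightarrow> Y0 t = (g1 t - 1) * (- (g1 t)\<^sup>2 + upsilon t - g1 t - 1) / (g1 t) ^ 3"
  unfolding Y0_def
  by (rule mer_eq_holomorphic[of "\<lambda>t. (g1 t - 1) * (- (g1 t)\<^sup>2 + upsilon t - g1 t - 1) / (g1 t) ^ 3"])
    (auto intro!: holomorphic_intros g1_holomorphic upsilon_holomorphic simp: g1_nonzero in_upper_half_plane)

lemma X0_holomorphic: "X0 holomorphic_on HH"
  by (rule holomorphic_transform[of "\<lambda>t. - 1 / g1 t"])
    (auto intro!: holomorphic_intros g1_holomorphic simp: X0_eq g1_nonzero in_upper_half_plane)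

lemma Y0_holomorphic: "Y0 holomorphic_on HH"
  by (rule holomorphic_transform[of "\<lambda>t. (g1 t - 1) * (- (g1 t)\<^sup>2 + upsilon t - g1 t - 1) / (g1 t) ^ 3"])
    (auto intro!: holomorphic_intros g1_holomorphic upsilon_holomorphic simp: Y0_eq g1_nonzero in_upper_half_plane)

lemma X0_modular: "X0 \<in> modular_functions (Gamma1 14)" and Y0_modular: "Y0 \<in> modular_functions (Gamma1 14)"
proof -
  note cu = modular_functionsD(2)[OF upsilon_modular] and cg = modular_functionsD(2)[OF g1_modular]
  show "X0 \<in> modular_functions (Gamma1 14)"
    unfolding X0_def
  proof (rule modular_functions_mer[OF _ Gamma1_subset])
    show "cusp_meromorphic (\<lambda>t. - 1 / g1 t)" by (intro cusp_intros cg)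
    fix A :: "int ^ 2 ^ 2" assume A: "A \<in> Gamma1 14"
    from modular_functions_ae[OF g1_modular A] show "\<forall>\<^sub>\<approx>t\<in>HH. - 1 / g1 (act A t) = - 1 / g1 t"
      by eventually_elim simp
  qed
  show "Y0 \<in> modular_functions (Gamma1 14)"
    unfolding Y0_def
  proof (rule modular_functions_mer[OF _ Gamma1_subset])
    show "cusp_meromorphic (\<lambda>t. (g1 t - 1) * (- (g1 t)\<^sup>2 + upsilon t - g1 t - 1) / (g1 t) ^ 3)"
      by (intro cusp_intros cg cu)
    fix A :: "int ^ 2 ^ 2" assume A: "A \<in> Gamma1 14"
    from modular_functions_ae[OF g1_modular A] modular_functions_ae[OF upsilon_modular_14 A]
    show "\<forall>\<^sub>\<approx>t\<in>HH. (g1 (act A t) - 1) * (- (g1 (act A t))\<^sup>2 + upsilon (act A t) - g1 (act A t) - 1) / (g1 (act A t)) ^ 3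
        = (g1 t - 1) * (- (g1 t)\<^sup>2 + upsilon t - g1 t - 1) / (g1 t) ^ 3"
      by eventually_elim simp
  qed
qed

lemma X0_Y0_relation:
  assumes t: "t \<in> HH"
  shows "(Y0 t)\<^sup>2 + X0 t * Y0 t + Y0 t = X0 t ^ 3 - X0 t"
proof -
  define u g where "u = upsilon t" "g = g1 t"
  have g: "g \<noteq> 0" using g1_nonzero t by (simp add: u_g_def in_upper_half_plane)
  have "u * g ^ 3 + u * g\<^sup>2 - (u\<^sup>2 - 1) * g + (u - 1)\<^sup>2 = 0"
    unfolding u_g_def using upsilon_g1_relation t by (simp add: in_upper_half_plane)
  moreover have "u * g ^ 3 + u * g\<^sup>2 - (u\<^sup>2 - 1) * g + (u - 1)\<^sup>2 =
      (g + 1) * g ^ 3 - (g - 1) * ((u - g - 1 - g\<^sup>2) * (u - g - 1))"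
    by (simp add: algebra_simps eval_nat_numeral)
  ultimately have rel: "(g - 1) * ((u - g - 1 - g\<^sup>2) * (u - g - 1)) = (g + 1) * g ^ 3" by simp
  have Y: "Y0 t = (g - 1) * (u - g - 1 - g\<^sup>2) / g ^ 3" and X: "X0 t = - 1 / g"
    using Y0_eq[OF t] X0_eq[OF t] by (simp_all add: u_g_def algebra_simps)
  \<comment> \<open>The left side of the equation is \<open>Y0\<close> times this factor; both
    contain one of the units appearing in the factored cubic \<open>rel\<close>.\<close>
  have Y': "Y0 t + X0 t + 1 = (g - 1) * (u - g - 1) / g ^ 3"
    unfolding X Y using g by (simp add: field_simps eval_nat_numeral)
  have "(Y0 t)\<^sup>2 + X0 t * Y0 t + Y0 t = Y0 t * (Y0 t + X0 t + 1)"
    by (simp add: algebra_simps power2_eq_square)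
  also have "\<dots> = (g - 1) * ((g - 1) * ((u - g - 1 - g\<^sup>2) * (u - g - 1))) / g ^ 6"
    unfolding Y' unfolding Y using g by (simp add: field_simps eval_nat_numeral)
  also have "\<dots> = (g - 1) * ((g + 1) * g ^ 3) / g ^ 6" unfolding rel ..
  also have "\<dots> = X0 t ^ 3 - X0 t"
    unfolding X using g by (simp add: field_simps eval_nat_numeral)
  finally show ?thesis .
qed

text \<open>\<open>g1\<close> has a pole at the cusp \<open>trmat\<close> sends infinity to. This is
  how nonconstancy of \<open>g1\<close> and transcendence of \<open>X0\<close> are seen.\<close>

lemma g1_not_bounded: "\<not> bounded (g1 ` HH)"
proof
  assume "bounded (g1 ` HH)"
  then obtain M where M: "\<And>t. t \<in> HH \<Longrightarrow> norm (g1 t) \<le> M" by (auto simp: bounded_iff)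
  have "bdd_inf (\<lambda>t. g1 (act trmat t))"
    unfolding bdd_inf_def eventually_at_ii_inf
    by (intro exI[of _ M] exI[of _ 0]) (auto intro!: M act_in_upper_half_plane simp: in_upper_half_plane)
  with not_asym_bounded[OF g1_asym_trmat] show False by simp
qed

lemma generated_by_upsilon_g1:
  "generated_over_C (modular_function_field (Gamma1 14)) {upsilon, g1}"
proof -
  have S: "{upsilon, g1} \<subseteq> modular_functions (Gamma1 14)" using upsilon_modular_14 g1_modular by simp
  show ?thesis by (intro generated_over_CI[OF S] rat_gen_base[OF S]) auto
qed

lemma generated_by_X0_Y0:
  "generated_over_C (modular_function_field (Gamma1 14)) {X0, Y0}"
proof -
  have S: "{X0, Y0} \<subseteq> modular_functions (Gamma1 14)" using X0_modular Y0_modular by simp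
  have X: "rat_gen {X0, Y0} X0" and Y: "rat_gen {X0, Y0} Y0" by (auto intro!: rat_gen_base[OF S])
  have inH: "\<forall>\<^sub>\<approx>t\<in>HH. t \<in> HH" by (rule eventually_in_cosparse) auto
  have "rat_gen {X0, Y0} (\<lambda>t. - 1 / X0 t)"
    by (intro rat_gen_divide[OF S] rat_gen_const[OF S] X)
  moreover from inH have "\<forall>\<^sub>\<approx>t\<in>HH. - 1 / X0 t = g1 t"
    by eventually_elim (simp add: X0_eq)
  ultimately have g: "rat_gen {X0, Y0} g1" by (rule rat_gen_cong[OF S])
  have "\<not> (\<forall>t\<in>HH. g1 t = 1)"
  proof
    assume "\<forall>t\<in>HH. g1 t = 1"
    then have "g1 ` HH \<subseteq> {1}" by auto
    then have "bounded (g1 ` HH)" by (meson bounded_subset finite_imp_bounded finite.emptyI finite.insertI)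
    with g1_not_bounded show False ..
  qed
  then have g1: "\<forall>\<^sub>\<approx>t\<in>HH. g1 t \<noteq> 1"
    by (intro holomorphic_ae_neq[OF g1_holomorphic]) auto
  \<comment> \<open>\<open>Y0\<close> is affine in \<open>upsilon\<close> over the rational
    functions of \<open>g1\<close>; this is the solution of that equation. The form
    \<open>+ - 1\<close> makes the denominator a sum.\<close>
  have "rat_gen {X0, Y0} (\<lambda>t. Y0 t * g1 t ^ 3 / (g1 t + - 1) + (g1 t ^ 2 + g1 t + 1))"
    by (intro rat_gen_add[OF S] rat_gen_divide[OF S] rat_gen_mult[OF S] rat_gen_power[OF S] rat_gen_const[OF S] g Y)
  moreover from inH g1 have "\<forall>\<^sub>\<approx>t\<in>HH. Y0 t * g1 t ^ 3 / (g1 t + - 1) + (g1 t ^ 2 + g1 t + 1) = upsilon t"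
  proof eventually_elim
    case (elim t)
    then have "g1 t \<noteq> 0" using g1_nonzero by (simp add: in_upper_half_plane)
    then have "Y0 t * g1 t ^ 3 = (g1 t - 1) * (- (g1 t)\<^sup>2 + upsilon t - g1 t - 1)"
      using Y0_eq[OF elim(1)] by simp
    then have "Y0 t * g1 t ^ 3 / (g1 t + - 1) = - (g1 t)\<^sup>2 + upsilon t - g1 t - 1"
      using elim(2) by simp
    then show ?case by simp
  qed
  ultimately have "rat_gen {X0, Y0} upsilon" by (rule rat_gen_cong[OF S])
  then show ?thesis using g by (intro generated_over_CI[OF S])
qed

lemma X0_transcendental:
  assumes "\<And>t. t \<in> HH \<Longrightarrow> poly N (X0 t) = 0"
  shows "N = 0"
proof (rule ccontr)
  assume "N \<noteq> 0"
  then have "finite {x. poly N x = 0}" by (rule poly_roots_finite)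
  moreover have "X0 ` HH \<subseteq> {x. poly N x = 0}" using assms by auto
  ultimately have "finite (X0 ` HH)" by (rule finite_subset[rotated])
  then have "finite ((\<lambda>x. - 1 / x) ` X0 ` HH)" by simp
  moreover have "(\<lambda>x. - 1 / x) ` X0 ` HH = g1 ` HH"
    unfolding image_image by (intro image_cong refl) (simp add: X0_eq)
  ultimately have "bounded (g1 ` HH)" by (simp add: finite_imp_bounded)
  with g1_not_bounded show False ..
qed

section \<open>The Weierstrass model\<close>

lemma eval_xy_0 [simp]: "eval_xy 0 x y = 0"
  by (simp add: eval_xy_def)

lemma eval_xy_pCons: "eval_xy (pCons a P) x y = poly a x + y * eval_xy P x y"
  by (simp add: eval_xy_def)

lemma eval_xy_mult: "eval_xy (P * Q) x y = eval_xy P x y * eval_xy Q x y"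
  by (simp add: eval_xy_def)

lemma eval_xy_add: "eval_xy (P + Q) x y = eval_xy P x y + eval_xy Q x y"
  by (simp add: eval_xy_def)

lemma holomorphic_poly: "f holomorphic_on A \<Longrightarrow> (\<lambda>t. poly p (f t)) holomorphic_on A"
  by (induction p) (auto intro!: holomorphic_intros)

lemma holomorphic_eval_xy: "(\<lambda>t. eval_xy P (X0 t) (Y0 t)) holomorphic_on HH"
proof (induction P)
  case (pCons a P)
  then show ?case unfolding eval_xy_pCons
    by (intro holomorphic_intros holomorphic_poly X0_holomorphic Y0_holomorphic)
qed simp

text \<open>\<open>N\<close> is the norm of A + B Y, where the conjugate of Y is - Y - X - 1.
  Completing the square turns \<open>N = 0\<close> into an equality of a square with the cubic 4 x^3
  + x^2 - 2 x + 1 times a square; the degrees have different parity unless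
  \<open>B = 0\<close>.\<close>

lemma X0_Y0_linear_independent:
  assumes "\<And>t. t \<in> HH \<Longrightarrow> poly A (X0 t) + Y0 t * poly B (X0 t) = 0"
  shows "A = 0 \<and> B = 0"
proof -
  define N where "N = A\<^sup>2 - [:1, 1:] * A * B - [:0, -1, 0, 1:] * B\<^sup>2"
  have "poly N (X0 t) = 0" if t: "t \<in> HH" for t
  proof -
    have A: "poly A (X0 t) = - (Y0 t * poly B (X0 t))" using assms[OF t] by (simp add: eq_neg_iff_add_eq_0)
    have "poly N (X0 t) = (poly B (X0 t))\<^sup>2 * ((Y0 t)\<^sup>2 + X0 t * Y0 t + Y0 t - (X0 t ^ 3 - X0 t))"
      unfolding N_def by (simp add: A power_mult_distrib algebra_simps eval_nat_numeral)
    also have "\<dots> = 0" using X0_Y0_relation[OF t] by simp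
    finally show ?thesis .
  qed
  then have N: "N = 0" by (rule X0_transcendental)
  have "(2 * A - [:1, 1:] * B)\<^sup>2 - 4 * N = ([:1, 1:]\<^sup>2 + 4 * [:0, -1, 0, 1:]) * B\<^sup>2"
    unfolding N_def by (simp only: power2_eq_square algebra_simps) simp
  also have "[:1, 1:]\<^sup>2 + 4 * [:0, -1, 0, 1:] = ([:1, -2, 1, 4:] :: complex poly)"
    by (simp add: power2_eq_square numeral_poly)
  finally have eq: "(2 * A - [:1, 1:] * B)\<^sup>2 = [:1, -2, 1, 4:] * B\<^sup>2" using N by simp
  have "B = 0"
  proof (rule ccontr)
    assume B: "B \<noteq> 0"
    have "[:1, -2, 1, 4 :: complex:] \<noteq> 0" by simp
    with B have "[:1, -2, 1, 4 :: complex:] * B\<^sup>2 \<noteq> 0" by (simp only: mult_eq_0_iff power_eq_0_iff) simp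
    then have nz: "2 * A - [:1, 1:] * B \<noteq> 0" unfolding eq [symmetric] by (simp only: power_eq_0_iff) simp
    have "degree ((2 * A - [:1, 1:] * B)\<^sup>2) = 2 * degree (2 * A - [:1, 1:] * B)"
      by (rule degree_power_eq[OF nz])
    moreover have "degree ([:1, -2, 1, 4 :: complex:] * B\<^sup>2) = 3 + 2 * degree B"
      using B by (subst degree_mult_eq) (auto simp: degree_power_eq)
    ultimately have "2 * degree (2 * A - [:1, 1:] * B) = 3 + 2 * degree B" unfolding eq by simp
    then show False by presburger
  qed
  moreover from this have "A = 0" using N by (simp add: N_def)
  ultimately show ?thesis by simp
qed

lemma kernel_eq:
  defines "Wp \<equiv> weierstrass_poly (Weierstrass 1 0 1 (- 1) 0)"
  shows "mer (\<lambda>t. eval_xy P (X0 t) (Y0 t)) = mer (\<lambda>_. 0) \<longleftrightarrow> Wp dvd P"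
proof -
  have W: "eval_xy Wp (X0 t) (Y0 t) = 0" if "t \<in> HH" for t
  proof -
    have "eval_xy Wp (X0 t) (Y0 t) = (Y0 t)\<^sup>2 + X0 t * Y0 t + Y0 t - (X0 t ^ 3 - X0 t)"
      unfolding Wp_def weierstrass_poly_def eval_xy_def by (simp add: algebra_simps eval_nat_numeral)
    then show ?thesis using X0_Y0_relation[OF that] by simp
  qed
  show ?thesis
  proof
    assume "Wp dvd P"
    then obtain Q where P: "P = Wp * Q" by blast
    have inH: "\<forall>\<^sub>\<approx>t\<in>HH. t \<in> HH" by (rule eventually_in_cosparse) auto
    then have "\<forall>\<^sub>\<approx>t\<in>HH. eval_xy P (X0 t) (Y0 t) = 0"
      by eventually_elim (simp add: P eval_xy_mult W)
    then show "mer (\<lambda>t. eval_xy P (X0 t) (Y0 t)) = mer (\<lambda>_. 0)" by (rule mer_cong)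
  next
    assume *: "mer (\<lambda>t. eval_xy P (X0 t) (Y0 t)) = mer (\<lambda>_. 0)"
    have zero: "eval_xy P (X0 t) (Y0 t) = 0" if t: "t \<in> HH" for t
    proof -
      have "eval_xy P (X0 t) (Y0 t) = mer (\<lambda>t. eval_xy P (X0 t) (Y0 t)) t"
        by (rule mer_eq_holomorphic[OF holomorphic_eval_xy refl t, symmetric])
      also have "\<dots> = mer (\<lambda>_. 0) t" unfolding * ..
      also have "\<dots> = 0" by (rule mer_eq_holomorphic[of "\<lambda>_. 0"]) (use t in auto)
      finally show ?thesis .
    qed
    have deg: "degree Wp = 2" and lc: "Polynomial.coeff Wp 2 = 1" and W0: "Wp \<noteq> 0"
      unfolding Wp_def weierstrass_poly_def by (auto simp: eval_nat_numeral)
    \<comment> \<open>As \<open>Wp\<close> is monic in y, pseudo-division is true division with a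
      remainder linear in y.\<close>
    obtain Q R where QR: "pseudo_divmod P Wp = (Q, R)" by fastforce
    have "Polynomial.smult (Polynomial.coeff Wp (degree Wp) ^ (Suc (degree P) - degree Wp)) P = Wp * Q + R \<and> (R = 0 \<or> degree R < degree Wp)"
      using pseudo_divmod[OF W0 QR] by simp
    then have P: "P = Wp * Q + R" and R: "R = 0 \<or> degree R < 2" by (auto simp: deg lc)
    define A B where "A = Polynomial.coeff R 0" "B = Polynomial.coeff R 1"
    have R': "R = [:A, B:]"
    proof (rule poly_eqI)
      fix n show "Polynomial.coeff R n = Polynomial.coeff [:A, B:] n"
        using R coeff_eq_0[of R n] by (cases n; cases "n - 1") (auto simp: A_B_def)
    qed
    have "poly A (X0 t) + Y0 t * poly B (X0 t) = 0" if t: "t \<in> HH" for t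
      using zero[OF t] W[OF t] by (simp add: P R' eval_xy_add eval_xy_mult eval_xy_pCons)
    then have "A = 0 \<and> B = 0" by (rule X0_Y0_linear_independent)
    then have "R = 0" using R' by simp
    then show "Wp dvd P" using P by simp
  qed
qed

lemma X0_Y0_weierstrass_model:
  "weierstrass_model (Weierstrass 1 0 1 (- 1) 0) X0 Y0 (modular_function_field (Gamma1 14))"
  unfolding weierstrass_model_def
proof (intro conjI allI)
  show "weierstrass_disc (Weierstrass 1 0 1 (- 1) 0 :: complex weierstrass) \<noteq> 0"
    by (simp add: weierstrass_disc_def)
  show "X0 \<in> carrier (modular_function_field (Gamma1 14))" "Y0 \<in> carrier (modular_function_field (Gamma1 14))"
    using X0_modular Y0_modular by (simp_all add: modular_function_field_def)
  show "generated_over_C (modular_function_field (Gamma1 14)) {X0, Y0}" by (rule generated_by_X0_Y0)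
  fix P
  show "mer (\<lambda>\<tau>. eval_xy P (X0 \<tau>) (Y0 \<tau>)) = \<zero>\<^bsub>modular_function_field (Gamma1 14)\<^esub> \<longleftrightarrow>
      weierstrass_poly (Weierstrass 1 0 1 (- 1) 0) dvd P"
    using kernel_eq[of P] by (simp add: modular_function_field_def)
qed

section \<open>Minimality\<close>

text \<open>The quantities b2, b4, b6, b8 of the translated equation depend on \<open>r\<close>
  only; the scaling by \<open>u\<close> has weights 2, 4, 6 and 8, hence 12 for the
  discriminant.\<close>

lemma weierstrass_disc_change_vars:
  fixes u r s t :: rat
  assumes "u \<noteq> 0"
  shows "weierstrass_disc (change_vars u r s t (Weierstrass 1 0 1 (- 1) 0)) = - 28 / u ^ 12"
proof -
  define a1 a2 a3 a4 a6 where "a1 = 1 + 2 * s" "a2 = - s + 3 * r - s\<^sup>2" "a3 = 1 + r + 2 * t"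
    "a4 = - 1 - s - (t + r * s) + 3 * r\<^sup>2 - 2 * s * t" "a6 = - r + r ^ 3 - t - t\<^sup>2 - r * t"
  have c: "change_vars u r s t (Weierstrass 1 0 1 (- 1) 0) =
    Weierstrass (a1 / u) (a2 / u\<^sup>2) (a3 / u ^ 3) (a4 / u ^ 4) (a6 / u ^ 6)"
    by (simp add: change_vars_def a1_a2_a3_a4_a6_def)
  define b2 b4 b6 b8 where "b2 = a1\<^sup>2 + 4 * a2" "b4 = 2 * a4 + a1 * a3" "b6 = a3\<^sup>2 + 4 * a6"
    "b8 = a1\<^sup>2 * a6 + 4 * a2 * a6 - a1 * a3 * a4 + a2 * a3\<^sup>2 - a4\<^sup>2"
  have d: "(a1 / u)\<^sup>2 + 4 * (a2 / u\<^sup>2) = b2 / u\<^sup>2" "2 * (a4 / u ^ 4) + a1 / u * (a3 / u ^ 3) = b4 / u ^ 4"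
    "(a3 / u ^ 3)\<^sup>2 + 4 * (a6 / u ^ 6) = b6 / u ^ 6"
    "(a1 / u)\<^sup>2 * (a6 / u ^ 6) + 4 * (a2 / u\<^sup>2) * (a6 / u ^ 6) - a1 / u * (a3 / u ^ 3) * (a4 / u ^ 4) +
       a2 / u\<^sup>2 * (a3 / u ^ 3)\<^sup>2 - (a4 / u ^ 4)\<^sup>2 = b8 / u ^ 8"
    using assms by (simp_all add: b2_b4_b6_b8_def field_simps eval_nat_numeral)
  have "weierstrass_disc (change_vars u r s t (Weierstrass 1 0 1 (- 1) 0)) =
    - ((b2 / u\<^sup>2)\<^sup>2 * (b8 / u ^ 8)) - 8 * (b4 / u ^ 4) ^ 3 - 27 * (b6 / u ^ 6)\<^sup>2 + 9 * (b2 / u\<^sup>2) * (b4 / u ^ 4) * (b6 / u ^ 6)"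
    unfolding c weierstrass_disc_def Let_def weierstrass.sel d ..
  also have "\<dots> = (- (b2\<^sup>2 * b8) - 8 * b4 ^ 3 - 27 * b6\<^sup>2 + 9 * b2 * b4 * b6) / u ^ 12"
    using assms by (simp add: field_simps eval_nat_numeral)
  also have "- (b2\<^sup>2 * b8) - 8 * b4 ^ 3 - 27 * b6\<^sup>2 + 9 * b2 * b4 * b6 = - 28"
  proof -
    have 2: "b2 = 1 + 12 * r" unfolding b2_b4_b6_b8_def a1_a2_a3_a4_a6_def
      by (simp add: algebra_simps power2_eq_square)
    have 4: "b4 = - 1 + r + 6 * r\<^sup>2" unfolding b2_b4_b6_b8_def a1_a2_a3_a4_a6_def
      by (simp add: algebra_simps power2_eq_square)
    have 6: "b6 = 1 - 2 * r + r\<^sup>2 + 4 * r ^ 3" unfolding b2_b4_b6_b8_def a1_a2_a3_a4_a6_def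
      by (simp add: algebra_simps eval_nat_numeral)
    have 8: "b8 = 3 * r - 3 * r\<^sup>2 + r ^ 3 + 3 * r ^ 4" unfolding b2_b4_b6_b8_def a1_a2_a3_a4_a6_def
      by (simp add: algebra_simps eval_nat_numeral)
    show ?thesis unfolding 2 4 6 8 by (simp add: algebra_simps eval_nat_numeral)
  qed
  finally show ?thesis .
qed

text \<open>Allows fractions that are not in lowest terms, as sums and products produce.\<close>

lemma p_integral_iff:
  assumes p: "prime p"
  shows "p_integral p x \<longleftrightarrow> (\<exists>a b. x = of_int a / of_int b \<and> \<not> p dvd b)"
proof
  assume "p_integral p x"
  then show "\<exists>a b. x = of_int a / of_int b \<and> \<not> p dvd b"
    unfolding p_integral_def using quotient_of_div[of x "fst (quotient_of x)" "snd (quotient_of x)"] by auto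
next
  assume "\<exists>a b. x = of_int a / of_int b \<and> \<not> p dvd b"
  then obtain a b where x: "x = of_int a / of_int b" and b: "\<not> p dvd b" by blast
  obtain n d where nd: "quotient_of x = (n, d)" by fastforce
  have d: "d > 0" and cop: "coprime n d" and x': "x = of_int n / of_int d"
    using nd quotient_of_denom_pos quotient_of_coprime quotient_of_div by blast+
  have b0: "b \<noteq> 0" using b by auto
  have "(of_int (a * d) :: rat) = of_int (n * b)"
    using x x' d b0 by (simp add: field_simps)
  then have eq: "a * d = n * b" by (simp only: of_int_eq_iff)
  show "p_integral p x"
    unfolding p_integral_def nd snd_conv
  proof
    assume pd: "p dvd d"
    then have "p dvd n * b" using eq by (metis dvd_mult)
    then have "p dvd n" using b p prime_dvd_mult_iff by blast
    with pd cop have "is_unit p" using coprime_common_divisor by blast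
    with p show False using not_prime_unit by blast
  qed
qed

lemma p_integral_closed:
  assumes p: "prime p"
  shows "p_integral p (of_int n)"
    and "p_integral p x \<Longrightarrow> p_integral p y \<Longrightarrow> p_integral p (x + y)"
    and "p_integral p x \<Longrightarrow> p_integral p y \<Longrightarrow> p_integral p (x * y)"
proof -
  have "\<not> p dvd 1" using p not_prime_unit by blast
  then show "p_integral p (of_int n)"
    unfolding p_integral_iff[OF p] by (intro exI[of _ n] exI[of _ 1]) simp
  assume "p_integral p x" "p_integral p y"
  then obtain a b c d where x: "x = of_int a / of_int b" "\<not> p dvd b" and y: "y = of_int c / of_int d" "\<not> p dvd d"
    unfolding p_integral_iff[OF p] by blast
  have bd: "\<not> p dvd b * d" using x y p by (simp add: prime_dvd_mult_iff)
  have "b \<noteq> 0" "d \<noteq> 0" using x y by auto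
  then have "x + y = of_int (a * d + c * b) / of_int (b * d)" "x * y = of_int (a * c) / of_int (b * d)"
    using x y by (simp_all add: field_simps)
  with bd show "p_integral p (x + y)" "p_integral p (x * y)"
    unfolding p_integral_iff[OF p] by blast+
qed

lemma p_integral_weierstrass_disc:
  assumes p: "prime p" and E: "\<forall>a\<in>set_weierstrass E. p_integral p a"
  shows "p_integral p (weierstrass_disc E)"
proof -
  note cl = p_integral_closed[OF p]
  have num: "p_integral p (numeral n)" "p_integral p (- numeral n)" "p_integral p (- 1)" for n
    using cl(1)[of "numeral n"] cl(1)[of "- numeral n"] cl(1)[of "-1"] by simp_all
  have minus: "p_integral p (- x)" if "p_integral p x" for x
    using cl(3)[OF num(3) that] by simp
  have diff: "p_integral p (x - y)" if "p_integral p x" "p_integral p y" for x y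
    using cl(2)[OF that(1) minus[OF that(2)]] by simp
  have one: "p_integral p 1" using cl(1)[of 1] by simp
  have pow: "p_integral p (x ^ n)" if "p_integral p x" for x n
    by (induction n) (use that one cl(3) in auto)
  obtain a1 a2 a3 a4 a6 where E': "E = Weierstrass a1 a2 a3 a4 a6" by (cases E)
  have a: "p_integral p a1" "p_integral p a2" "p_integral p a3" "p_integral p a4" "p_integral p a6"
    using E by (simp_all add: E')
  show ?thesis
    unfolding E' weierstrass_disc_def Let_def weierstrass.sel
    by (intro cl(2,3) diff minus pow num a)
qed

lemma rat_val_fraction:
  assumes p: "prime p" and a: "a \<noteq> 0" and b: "b \<noteq> 0"
  shows "rat_val p (of_int a / of_int b) = int (multiplicity p a) - int (multiplicity p b)"
proof -
  obtain n d where nd: "quotient_of (of_int a / of_int b :: rat) = (n, d)" by fastforce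
  have d: "d > 0" and x': "of_int a / of_int b = (of_int n / of_int d :: rat)"
    using nd quotient_of_denom_pos quotient_of_div by blast+
  have "(of_int (a * d) :: rat) = of_int (n * b)"
    using x' d b by (simp add: field_simps)
  then have eq: "a * d = n * b" by (simp only: of_int_eq_iff)
  have n: "n \<noteq> 0" using eq a d by auto
  have "multiplicity p a + multiplicity p d = multiplicity p n + multiplicity p b"
    using prime_elem_multiplicity_mult_distrib[OF prime_imp_prime_elem[OF p], of a d]
      prime_elem_multiplicity_mult_distrib[OF prime_imp_prime_elem[OF p], of n b] eq a b d n
    by simp
  then show ?thesis by (simp add: rat_val_def nd)
qed

text \<open>A change of variables alters the valuation of the discriminant by a multiple of 12, and
  an integral equation has nonnegative valuation. Since 2^12 exceeds 28, the valuation of -28 is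
  below 12 at every prime and so cannot be lowered.\<close>

lemma minimal_model: "global_minimal_model (Weierstrass 1 0 1 (- 1) 0)"
  unfolding global_minimal_model_def
proof (intro conjI allI impI)
  have disc: "weierstrass_disc (Weierstrass 1 0 1 (- 1) 0 :: rat weierstrass) = - 28"
    by (simp add: weierstrass_disc_def)
  then show "weierstrass_disc (Weierstrass 1 0 1 (- 1) 0 :: rat weierstrass) \<noteq> 0" by simp
  show "set_weierstrass (Weierstrass 1 0 1 (- 1) 0 :: rat weierstrass) \<subseteq> \<int>" by simp
  fix p :: int assume p: "prime p"
  show "minimal_at p (Weierstrass 1 0 1 (- 1) 0)"
    unfolding minimal_at_def
  proof (intro conjI allI impI ballI)
    fix a :: rat assume "a \<in> set_weierstrass (Weierstrass 1 0 1 (- 1) 0)"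
    then have "a \<in> \<int>" by auto
    then show "p_integral p a" using p_integral_closed(1)[OF p] by (auto elim: Ints_cases)
  next
    fix u r s t :: rat
    let ?E = "change_vars u r s t (Weierstrass 1 0 1 (- 1) 0)"
    assume "u \<noteq> 0 \<and> (\<forall>a\<in>set_weierstrass ?E. p_integral p a)"
    then have u: "u \<noteq> 0" and int: "p_integral p (weierstrass_disc ?E)"
      using p_integral_weierstrass_disc[OF p] by auto
    obtain n d where nd: "quotient_of u = (n, d)" by fastforce
    have d: "d > 0" and u': "u = of_int n / of_int d"
      using nd quotient_of_denom_pos quotient_of_div by blast+
    have n: "n \<noteq> 0" using u u' by auto
    have D: "weierstrass_disc ?E = of_int (- 28 * d ^ 12) / of_int (n ^ 12)"
      using weierstrass_disc_change_vars[OF u, of r s t] n d by (simp add: u' power_divide)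
    have v: "rat_val p (weierstrass_disc ?E) = int (multiplicity p (28::int)) + 12 * int (multiplicity p d) - 12 * int (multiplicity p n)"
    proof -
      have "rat_val p (weierstrass_disc ?E) = int (multiplicity p (- 28 * d ^ 12)) - int (multiplicity p (n ^ 12))"
        unfolding D using n d by (intro rat_val_fraction[OF p]) auto
      also have "multiplicity p (- 28 * d ^ 12) = multiplicity p (28::int) + 12 * multiplicity p d"
        using d prime_elem_multiplicity_mult_distrib[OF prime_imp_prime_elem[OF p], of "-28" "d ^ 12"]
          prime_elem_multiplicity_power_distrib[OF prime_imp_prime_elem[OF p], of d 12]
        by simp
      also have "multiplicity p (n ^ 12) = 12 * multiplicity p n"
        using p n by (intro prime_elem_multiplicity_power_distrib) auto
      finally show ?thesis by simp
    qed
    have v0: "rat_val p (of_int (- 28) / of_int 1) = int (multiplicity p (28::int))"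
      using rat_val_fraction[OF p, of "-28" 1] by simp
    have nonneg: "rat_val p (weierstrass_disc ?E) \<ge> 0"
      using int unfolding rat_val_def p_integral_def by (simp add: not_dvd_imp_multiplicity_0)
    have "multiplicity p (28::int) < 12"
    proof (rule ccontr)
      assume "\<not> multiplicity p (28::int) < 12"
      then have "p ^ 12 dvd (28::int)" by (intro multiplicity_dvd') simp
      then have "p ^ 12 \<le> 28" by (intro zdvd_imp_le) auto
      moreover have "2 ^ 12 \<le> p ^ 12" using prime_ge_2_int[OF p] by (intro power_mono) auto
      ultimately show False by simp
    qed
    then show "rat_val p (weierstrass_disc (Weierstrass 1 0 1 (- 1) 0)) \<le> rat_val p (weierstrass_disc ?E)"
      using v nonneg v0 unfolding disc by simp
  qed
qed

theorem proposition6p7: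
  fixes K :: "(complex \<Rightarrow> complex) ring" and E :: "rat weierstrass"
  defines "K \<equiv> modular_function_field (Gamma1 14)"
    and "E \<equiv> Weierstrass 1 0 1 (-1) 0"
  shows "generated_over_C K {upsilon, g1}
    \<and> mer (\<lambda>\<tau>. (Y0 \<tau>)\<^sup>2 + X0 \<tau> * Y0 \<tau> + Y0 \<tau>) = mer (\<lambda>\<tau>. (X0 \<tau>) ^ 3 - X0 \<tau>)
    \<and> weierstrass_model (map_weierstrass of_rat E) X0 Y0 K
    \<and> global_minimal_model E"
proof (intro conjI)
  show "generated_over_C K {upsilon, g1}"
    unfolding K_def by (rule generated_by_upsilon_g1)
  have "\<forall>\<^sub>\<approx>t\<in>HH. t \<in> HH" by (rule eventually_in_cosparse) auto
  then have "\<forall>\<^sub>\<approx>t\<in>HH. (Y0 t)\<^sup>2 + X0 t * Y0 t + Y0 t = X0 t ^ 3 - X0 t"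
    by eventually_elim (rule X0_Y0_relation)
  then show "mer (\<lambda>\<tau>. (Y0 \<tau>)\<^sup>2 + X0 \<tau> * Y0 \<tau> + Y0 \<tau>) = mer (\<lambda>\<tau>. (X0 \<tau>) ^ 3 - X0 \<tau>)"
    by (rule mer_cong)
  have "map_weierstrass of_rat E = (Weierstrass 1 0 1 (- 1) 0 :: complex weierstrass)"
    by (simp add: E_def of_rat_minus)
  then show "weierstrass_model (map_weierstrass of_rat E) X0 Y0 K"
    unfolding K_def using X0_Y0_weierstrass_model by simp
  show "global_minimal_model E"
    unfolding E_def by (rule minimal_model)
qed

end
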